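(* Let $G=(V,E)$ be a $3$-edge-connected graph with at most one root vertex and $|V|\ge 4$. Then $G$ does not have an immersion of $K_4$ (a rooted immersion of $K_4$ with one root, if $G$ has a root vertex) if and only if: (i) $G$ is a doubled cycle, or (ii) $G$ has a $(2,2)$-segmentation of width three.
   Context: All graphs are finite, loopless and undirected, and parallel edges are permitted. For $X\subseteq V(G)$, $d(X)$ is the number of edges with exactly one endpoint in $X$. $G$ is $k$-edge-connected if $d(X)\ge k$ whenever $|X|,|V(G)\setminus X|\ge 1$. Immersion: if $xy,yz$ are two distinct edges sharing the vertex $y$, splitting them off at $y$ means deleting both and adding a new edge $xz$ (a loop, if $x=z$, is discarded). $G$ has an immersion of $H$ if a graph isomorphic to $H$ can be obtained from a subgraph of $G$ by a sequence of splittings. Equivalently, there is an injection $\phi:V(H)\to V(G)$ and pairwise edge-disjoint paths of $G$, one for each edge $uv$ of $H$, joining $\phi(u)$ to $\phi(v)$. If $G$ has a root vertex $x$ and $H$ has a root vertex $y$, a rooted immersion of $H$ in $G$ is an immersion in which moreover $y$ corresponds to $x$, i.e. $\phi(y)=x$. When $G$ has a root vertex, $K_4$ is considered with one (arbitrary) vertex as its root. A doubled cycle is a graph obtained from a cycle by adding a second copy of each edge. For disjoint $X,Y\subseteq V(G)$, a segmentation of $G$ relative to $(X,Y)$ is a nested family $X_1\subset X_2\subset\dots\subset X_k$ of vertex sets with $X_1=X$, $V(G)\setminus X_k=Y$, and $|X_{i+1}\setminus X_i|=1$ for $1\le i\le k-1$. It has width $w$ if $d(X_i)=w$ for every $1\le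 i\le k$, and it is an $(a,b)$-segmentation if $|X|\le a$ and $|Y|\le b$. *)

theory Defs
  imports Main
begin

record ('v, 'e) mgraph =
  vertices :: "'v set"
  edges :: "'e set"
  ends :: "'e \<Rightarrow> 'v set"

text \<open>Finite loopless undirected graphs. Edges have an identity of their own, so distinct edges
  may have the same pair of ends (parallel edges).\<close>

definition multigraph :: "('v, 'e) mgraph \<Rightarrow> bool" where
  "multigraph G \<longleftrightarrow> finite (vertices G) \<and> finite (edges G) \<and>
     (\<forall>e\<in>edges G. ends G e \<subseteq> vertices G \<and> card (ends G e) = 2)"

definition cut_degree :: "('v, 'e) mgraph \<Rightarrow> 'v set \<Rightarrow> nat" where
  "cut_degree G X = card {e \<in> edges G. card (ends G e \<inter> X) = 1}"

definition edge_connected :: "nat \<Rightarrow> ('v, 'e) mgraph \<Rightarrow> bool" where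
  "edge_connected k G \<longleftrightarrow>
     (\<forall>X \<subseteq> vertices G. card X \<ge> 1 \<and> card (vertices G - X) \<ge> 1 \<longrightarrow> cut_degree G X \<ge> k)"

definition complete_graph :: "nat \<Rightarrow> (nat, nat set) mgraph" where
  "complete_graph n = \<lparr>vertices = {..<n}, edges = {e. e \<subseteq> {..<n} \<and> card e = 2}, ends = (\<lambda>e. e)\<rparr>"


text \<open>A path is given by its vertices together with its edges, because the vertices alone do not
  determine which of several parallel edges is used.\<close>

definition is_path :: "('v, 'e) mgraph \<Rightarrow> 'v list \<Rightarrow> 'e list \<Rightarrow> bool" where
  "is_path G vs es \<longleftrightarrow> length vs = Suc (length es) \<and> distinct vs \<and>
     set vs \<subseteq> vertices G \<and> set es \<subseteq> edges G \<and>
     (\<forall>i < length es. ends G (es ! i) = {vs ! i, vs ! Suc i})"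

text \<open>\<open>immersion_map H G \<phi>\<close>: \<open>\<phi>\<close> is the vertex map of an immersion of \<open>H\<close> in \<open>G\<close>. The path for the
  edge \<open>e\<close> of \<open>H\<close> has edge list \<open>P e\<close>; paths for different edges may share vertices, and may pass
  through images of vertices of \<open>H\<close>.\<close>

definition immersion_map :: "('w, 'f) mgraph \<Rightarrow> ('v, 'e) mgraph \<Rightarrow> ('w \<Rightarrow> 'v) \<Rightarrow> bool" where
  "immersion_map H G \<phi> \<longleftrightarrow> inj_on \<phi> (vertices H) \<and> \<phi> ` vertices H \<subseteq> vertices G \<and>
     (\<exists>P. (\<forall>e\<in>edges H. \<exists>vs. is_path G vs (P e) \<and> {hd vs, last vs} = \<phi> ` ends H e) \<and>
          (\<forall>e\<in>edges H. \<forall>f\<in>edges H. e \<noteq> f \<longrightarrow> set (P e) \<inter> set (P f) = {}))"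

definition has_immersion :: "('v, 'e) mgraph \<Rightarrow> ('w, 'f) mgraph \<Rightarrow> bool" where
  "has_immersion G H \<longleftrightarrow> (\<exists>\<phi>. immersion_map H G \<phi>)"

definition has_rooted_immersion :: "('v, 'e) mgraph \<Rightarrow> 'v \<Rightarrow> ('w, 'f) mgraph \<Rightarrow> 'w \<Rightarrow> bool" where
  "has_rooted_immersion G x H y \<longleftrightarrow> (\<exists>\<phi>. immersion_map H G \<phi> \<and> \<phi> y = x)"


text \<open>Two parallel edges form a cycle of length 2.\<close>

definition is_cycle :: "('v, 'e) mgraph \<Rightarrow> bool" where
  "is_cycle C \<longleftrightarrow> (\<exists>vs es. length vs \<ge> 2 \<and> length es = length vs \<and> distinct vs \<and> distinct es \<and>
     set vs = vertices C \<and> set es = edges C \<and>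
     (\<forall>i < length vs. ends C (es ! i) = {vs ! i, vs ! (Suc i mod length vs)}))"

text \<open>\<open>C\<close> is the edge set of the underlying cycle and \<open>f\<close> sends each of its edges to the added copy.\<close>

definition doubled_cycle :: "('v, 'e) mgraph \<Rightarrow> bool" where
  "doubled_cycle G \<longleftrightarrow> (\<exists>C \<subseteq> edges G. is_cycle (G\<lparr>edges := C\<rparr>) \<and>
     (\<exists>f. bij_betw f C (edges G - C) \<and> (\<forall>e\<in>C. ends G (f e) = ends G e)))"


text \<open>The list \<open>Xs\<close> is \<open>X\<^sub>1, \<dots>, X\<^sub>k\<close>, indexed from \<open>0\<close>.\<close>

definition segmentation :: "('v, 'e) mgraph \<Rightarrow> 'v set \<Rightarrow> 'v set \<Rightarrow> 'v set list \<Rightarrow> bool" where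
  "segmentation G X Y Xs \<longleftrightarrow> X \<subseteq> vertices G \<and> Y \<subseteq> vertices G \<and> X \<inter> Y = {} \<and>
     Xs \<noteq> [] \<and> (\<forall>Z\<in>set Xs. Z \<subseteq> vertices G) \<and> hd Xs = X \<and> vertices G - last Xs = Y \<and>
     (\<forall>i. Suc i < length Xs \<longrightarrow> Xs ! i \<subset> Xs ! Suc i \<and> card (Xs ! Suc i - Xs ! i) = 1)"

definition has_segmentation :: "('v, 'e) mgraph \<Rightarrow> nat \<Rightarrow> nat \<Rightarrow> nat \<Rightarrow> bool" where
  "has_segmentation G a b w \<longleftrightarrow> (\<exists>X Y Xs. segmentation G X Y Xs \<and>
     card X \<le> a \<and> card Y \<le> b \<and> (\<forall>Z\<in>set Xs. cut_degree G Z = w))"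

end

theory Submission
  imports Defs
begin

text \<open>A cut of width 3 cannot separate two terminals of a \<open>K\<^sub>4\<close> from the other two, which rules out
  segmentations, and in a doubled cycle the six paths need more edges than there are.

  For the converse let \<open>G\<close> be a smallest counterexample with root \<open>x\<close>. If a set \<open>X\<close> has a cut of width
  \<open>k\<close> and no set between \<open>{a}\<close> and \<open>X\<close> has a smaller one, then contracting \<open>X\<close> to \<open>a\<close> gives an immersed
  graph. If there is a 3-cut with two vertices on either side, both contractions have
  segmentations; by parity the contracted vertex of degree 3 lies at an end of each, so the two can be
  concatenated. Otherwise all cuts with two vertices on either side have width at least 4. An edge
  between two vertices of degree at least 4 can then be deleted; a segmentation of the rest
  yields a pair of vertices with a cut of width 4, and contracting this pair, and then a second one,
  shows that \<open>G\<close> is a doubled cycle. If there is no such edge, deleting an edge and suppressing its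
  ends of degree 2 gives a smaller graph without segmentations. Graphs on four vertices are
  settled by explicit splittings.\<close>

section \<open>Cuts, contractions and edge-disjoint connections\<close>

text \<open>The root shapes the proof. A contraction must keep \<open>x\<close>, so a set containing
  \<open>x\<close> is contracted to \<open>x\<close>, and then \<open>x\<close> itself must have
  degree at least the width of the cut. For 3-cuts this is automatic. For 4-cuts a representative of
  degree at least 4 is required. This is why an edge between two such vertices is deleted: the two
  end pairs of a segmentation of the rest are disjoint, the edge has an end in each, and one of them
  avoids \<open>x\<close>. Without a given root any vertex is declared the root: the obstructions
  exclude a \<open>K4_on\<close> for every set of four vertices, so unrooted immersions and
  immersions rooted at a given vertex exist under the same conditions. In the induction doubled
  cycles appear only through degrees and multiplicities, which a contraction leaves visible outside
  the contracted set. Parity is the other recurring argument: passing between two 3-cuts by adding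
  one vertex requires that vertex to have even degree.\<close>

definition cutset :: "('v, 'e) mgraph \<Rightarrow> 'v set \<Rightarrow> 'e set" where
  "cutset G X = {e \<in> edges G. card (ends G e \<inter> X) = 1}"

text \<open>For disjoint \<open>A\<close> and \<open>B\<close> this is the number of edges between
  them. Because it is built from cuts, every fact about cuts under contraction or deletion carries
  over to it at once.\<close>

definition joins :: "('v, 'e) mgraph \<Rightarrow> 'v set \<Rightarrow> 'v set \<Rightarrow> nat" where
  "joins G A B = card (cutset G A \<inter> cutset G B)"

text \<open>The merged vertex is named by a member \<open>a\<close> of \<open>X\<close> and edges
  keep their identity, so the types stay fixed for the induction and the root survives when
  \<open>a\<close> is the root.\<close>

definition contract :: "('v, 'e) mgraph \<Rightarrow> 'v set \<Rightarrow> 'v \<Rightarrow> ('v, 'e) mgraph" where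
  "contract G X a = \<lparr>vertices = insert a (vertices G - X), edges = {e \<in> edges G. \<not> ends G e \<subseteq> X},
     ends = (\<lambda>e. (\<lambda>v. if v \<in> X then a else v) ` ends G e)\<rparr>"

definition del_edge :: "('v, 'e) mgraph \<Rightarrow> 'e \<Rightarrow> ('v, 'e) mgraph" where
  "del_edge G e = G\<lparr>edges := edges G - {e}\<rparr>"

definition adj :: "('v, 'e) mgraph \<Rightarrow> 'e set \<Rightarrow> ('v \<times> 'v) set" where
  "adj G S = {(p, q). \<exists>e\<in>S. ends G e = {p, q}}"

text \<open>The paths of an immersion are replaced by edge sets that connect their ends, so that splittings
  and contractions can be undone by taking unions.\<close>
definition K4_on :: "('v, 'e) mgraph \<Rightarrow> 'v set \<Rightarrow> bool" where
  "K4_on G T \<longleftrightarrow> T \<subseteq> vertices G \<and> card T = 4 \<and>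
     (\<exists>S. (\<forall>p\<in>T. \<forall>q\<in>T. p \<noteq> q \<longrightarrow> S {p, q} \<subseteq> edges G \<and> (p, q) \<in> (adj G (S {p, q}))\<^sup>*) \<and>
          (\<forall>d d'. d \<subseteq> T \<and> card d = 2 \<and> d' \<subseteq> T \<and> card d' = 2 \<and> d \<noteq> d' \<longrightarrow> S d \<inter> S d' = {}))"

lemma cut_degree_cutset: "cut_degree G X = card (cutset G X)"
  by (simp add: cut_degree_def cutset_def)

lemma del_edge_simps [simp]:
  "vertices (del_edge G e) = vertices G" "edges (del_edge G e) = edges G - {e}"
  "ends (del_edge G e) = ends G"
  by (auto simp: del_edge_def)

lemma contract_simps [simp]:
  "vertices (contract G X a) = insert a (vertices G - X)"
  "edges (contract G X a) = {e \<in> edges G. \<not> ends G e \<subseteq> X}"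
  by (auto simp: contract_def)

lemma ends_contract:
  "ends G e = {p, q} \<Longrightarrow> ends (contract G X a) e = {if p \<in> X then a else p, if q \<in> X then a else q}"
  by (simp only: contract_def mgraph.simps image_insert image_empty)

lemma edge_ends:
  assumes "multigraph G" "e \<in> edges G"
  obtains p q where "ends G e = {p, q}" "p \<noteq> q" "p \<in> vertices G" "q \<in> vertices G"
proof -
  have "card (ends G e) = 2" "ends G e \<subseteq> vertices G" using assms by (auto simp: multigraph_def)
  then show ?thesis using that by (auto simp: card_2_iff)
qed

lemma edge_at:
  assumes "multigraph G" "e \<in> edges G" "p \<in> ends G e"
  obtains q where "ends G e = {p, q}" "p \<noteq> q" "p \<in> vertices G" "q \<in> vertices G"
proof -
  obtain a b where "ends G e = {a, b}" "a \<noteq> b" "a \<in> vertices G" "b \<in> vertices G"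
    by (rule edge_ends[OF assms(1,2)])
  then show ?thesis using that[of a] that[of b] assms(3) by auto
qed

lemma cutset_subset: "cutset G X \<subseteq> edges G"
  by (auto simp: cutset_def)

lemma cutsetD: "e \<in> cutset G X \<Longrightarrow> e \<in> edges G"
  by (auto simp: cutset_def)

lemma eq_on_superset: "A \<subseteq> E \<Longrightarrow> B \<subseteq> E \<Longrightarrow> (\<And>e. e \<in> E \<Longrightarrow> e \<in> A \<longleftrightarrow> e \<in> B) \<Longrightarrow> A = B"
  by blast

lemma finite_edges: "multigraph G \<Longrightarrow> finite (edges G)"
  and finite_vertices: "multigraph G \<Longrightarrow> finite (vertices G)"
  by (auto simp: multigraph_def)

lemma finite_cutset: "multigraph G \<Longrightarrow> finite (cutset G X)"
  using finite_subset[OF cutset_subset] finite_edges by blast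

lemma cutset_iff:
  assumes "ends G e = {p, q}" "p \<noteq> q"
  shows "e \<in> cutset G X \<longleftrightarrow> e \<in> edges G \<and> (p \<in> X \<longleftrightarrow> q \<notin> X)"
  using assms by (auto simp: cutset_def Int_insert_left)

lemma cutset_singleton_iff:
  assumes "multigraph G"
  shows "e \<in> cutset G {v} \<longleftrightarrow> e \<in> edges G \<and> v \<in> ends G e"
  by (auto simp: cutset_def Int_insert_right)

lemma cutset_doubleton:
  assumes "multigraph G" "p \<noteq> q"
  shows "cutset G {p} \<inter> cutset G {q} = {e \<in> edges G. ends G e = {p, q}}"
proof -
  have "ends G e = {p, q}" if e: "e \<in> edges G" "p \<in> ends G e" "q \<in> ends G e" for e
  proof -
    obtain r where "ends G e = {p, r}" by (rule edge_at[OF assms(1) e(1,2)])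
    then show ?thesis using e(3) assms(2) by auto
  qed
  moreover have "p \<in> ends G e" "q \<in> ends G e" if "ends G e = {p, q}" for e using that by auto
  ultimately show ?thesis unfolding set_eq_iff Int_iff mem_Collect_eq cutset_singleton_iff[OF assms(1)] by blast
qed

section \<open>Cuts of complements and disjoint unions\<close>

lemma cutset_compl:
  assumes "multigraph G"
  shows "cutset G (vertices G - X) = cutset G X"
proof -
  have "e \<in> cutset G (vertices G - X) \<longleftrightarrow> e \<in> cutset G X" if e: "e \<in> edges G" for e
  proof -
    obtain p q where "ends G e = {p, q}" "p \<noteq> q" "p \<in> vertices G" "q \<in> vertices G"
      by (rule edge_ends[OF assms e])
    then show ?thesis by (auto simp: cutset_iff)
  qed
  then show ?thesis by (rule eq_on_superset[OF cutset_subset cutset_subset])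
qed

lemma cut_degree_compl:
  "multigraph G \<Longrightarrow> cut_degree G (vertices G - X) = cut_degree G X"
  by (simp add: cut_degree_cutset cutset_compl)

lemma cutset_un:
  assumes "multigraph G" "A \<inter> B = {}"
  shows "cutset G (A \<union> B) = (cutset G A - cutset G B) \<union> (cutset G B - cutset G A)"
proof -
  have "e \<in> cutset G (A \<union> B) \<longleftrightarrow> (e \<in> cutset G A) \<noteq> (e \<in> cutset G B)" if "e \<in> edges G" for e
    using edge_ends[OF assms(1) that]
  proof cases
    case (1 p q)
    then show ?thesis using assms(2) that by (auto simp: cutset_iff)
  qed
  then show ?thesis
    by (intro eq_on_superset[of _ "edges G"]) (auto dest: cutsetD)
qed

text \<open>The edges between the two sets are counted in both degrees and in no cut of the union.
  Being an equality, it also gives the parity statements used for 3-cuts.\<close>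

lemma cut_degree_un:
  assumes "multigraph G" "A \<inter> B = {}"
  shows "cut_degree G (A \<union> B) + 2 * joins G A B = cut_degree G A + cut_degree G B"
proof -
  let ?a = "cutset G A" and ?b = "cutset G B"
  note f = finite_cutset[OF assms(1)]
  have "cut_degree G (A \<union> B) = card (?a - ?b) + card (?b - ?a)"
    unfolding cut_degree_cutset cutset_un[OF assms] by (rule card_Un_disjoint) (auto simp: f)
  moreover have "card ?a = card (?a - ?b) + joins G A B"
    unfolding joins_def using f by (metis card_Int_Diff add.commute)
  moreover have "card ?b = card (?b - ?a) + joins G A B"
    unfolding joins_def using f by (metis card_Int_Diff add.commute Int_commute)
  ultimately show ?thesis by (simp add: cut_degree_cutset)
qed

lemma joins_commute: "joins G A B = joins G B A"
  by (simp add: joins_def Int_commute)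

lemma joins_un:
  assumes "multigraph G" "A \<inter> B = {}" "A \<inter> C = {}" "B \<inter> C = {}"
  shows "joins G A (B \<union> C) = joins G A B + joins G A C"
proof -
  have *: "(e \<in> cutset G A \<and> e \<in> cutset G (B \<union> C) \<longleftrightarrow> e \<in> cutset G A \<and> (e \<in> cutset G B \<or> e \<in> cutset G C))
        \<and> \<not> (e \<in> cutset G A \<and> e \<in> cutset G B \<and> e \<in> cutset G C)"
    if "e \<in> edges G" for e
    using edge_ends[OF assms(1) that]
  proof cases
    case (1 p q)
    then show ?thesis using assms(2-) that by (auto simp: cutset_iff)
  qed
  have "cutset G A \<inter> cutset G (B \<union> C) = (cutset G A \<inter> cutset G B) \<union> (cutset G A \<inter> cutset G C)"
    by (rule eq_on_superset[of _ "edges G"]) (use * in \<open>auto dest: cutsetD\<close>)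
  moreover have "(cutset G A \<inter> cutset G B) \<inter> (cutset G A \<inter> cutset G C) = {}"
    by (rule eq_on_superset[of _ "edges G"]) (use * in \<open>auto dest: cutsetD\<close>)
  ultimately show ?thesis unfolding joins_def
    by (simp add: card_Un_disjoint finite_cutset[OF assms(1)])
qed

lemma joins_compl:
  assumes "multigraph G"
  shows "joins G A (vertices G - A) = cut_degree G A"
  by (simp add: joins_def cutset_compl[OF assms] cut_degree_cutset)

lemma cut_degree_split:
  assumes "multigraph G" "A \<inter> B = {}" "B \<subseteq> vertices G"
  shows "cut_degree G A = joins G A B + joins G A (vertices G - A - B)"
proof -
  have "vertices G - A = B \<union> (vertices G - A - B)" using assms by auto
  then show ?thesis using joins_un[OF assms(1), of A B "vertices G - A - B"] joins_compl[OF assms(1), of A] assms(2)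
    by auto
qed

lemma joins_mono:
  assumes "multigraph G" "A \<inter> C = {}" "B \<subseteq> C"
  shows "joins G A B \<le> joins G A C"
proof -
  have "C = B \<union> (C - B)" using assms by auto
  moreover have "A \<inter> B = {}" "A \<inter> (C - B) = {}" using assms by auto
  ultimately show ?thesis using joins_un[OF assms(1), of A B "C - B"] by auto
qed

lemma cut_degree_pair:
  assumes "multigraph G" "p \<noteq> q"
  shows "cut_degree G {p, q} + 2 * joins G {p} {q} = cut_degree G {p} + cut_degree G {q}"
  using cut_degree_un[OF assms(1), of "{p}" "{q}"] assms(2) by (simp add: insert_commute)

lemma joins_pos:
  assumes "multigraph G" "p \<noteq> q"
  shows "joins G {p} {q} > 0 \<longleftrightarrow> (\<exists>e\<in>edges G. ends G e = {p, q})"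
  unfolding joins_def cutset_doubleton[OF assms]
  using finite_edges[OF assms(1)] by (auto simp: card_gt_0_iff)

lemma multigraph_del_edge: "multigraph G \<Longrightarrow> multigraph (del_edge G e)"
  by (auto simp: multigraph_def)

lemma cutset_del_edge: "cutset (del_edge G e) X = cutset G X - {e}"
  by (auto simp: cutset_def)

lemma cut_degree_del_edge:
  assumes "multigraph G"
  shows "cut_degree G X = cut_degree (del_edge G e) X + (if e \<in> cutset G X then 1 else 0)"
  unfolding cut_degree_cutset cutset_del_edge
  using finite_cutset[OF assms, of X] card_Suc_Diff1[of "cutset G X" e] by auto

section \<open>Contraction and its effect on cuts\<close>

lemma multigraph_contract:
  assumes "multigraph G" "X \<subseteq> vertices G" "a \<in> X"
  shows "multigraph (contract G X a)"
proof -
  have "ends (contract G X a) e \<subseteq> vertices (contract G X a) \<and> card (ends (contract G X a) e) = 2"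
    if e: "e \<in> edges (contract G X a)" for e
  proof -
    have e': "e \<in> edges G" using e by simp
    obtain p q where pq: "ends G e = {p, q}" "p \<noteq> q" "p \<in> vertices G" "q \<in> vertices G"
      by (rule edge_ends[OF assms(1) e'])
    have "\<not> (p \<in> X \<and> q \<in> X)" using e pq(1) by simp
    then have "card {if p \<in> X then a else p, if q \<in> X then a else q} = 2"
      using pq(2) assms(3) by (cases "p \<in> X"; cases "q \<in> X") (auto simp: card_2_iff)
    then show ?thesis using pq by (simp add: ends_contract[OF pq(1)])
  qed
  then show ?thesis
    using assms finite_edges finite_vertices unfolding multigraph_def by simp
qed

text \<open>The preimage of \<open>Z\<close> under the map collapsing \<open>X\<close> to
  \<open>a\<close>. Cuts of the contraction are the cuts of \<open>G\<close> by sets that do not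
  split \<open>X\<close>.\<close>

definition expand :: "'v set \<Rightarrow> 'v \<Rightarrow> 'v set \<Rightarrow> 'v set" where
  "expand X a Z = (if a \<in> Z then Z \<union> X else Z - X)"

lemma cutset_contract:
  assumes "multigraph G" "a \<in> X"
  shows "cutset (contract G X a) Z = cutset G (expand X a Z)"
proof -
  have "e \<in> cutset (contract G X a) Z \<longleftrightarrow> e \<in> cutset G (expand X a Z)" if "e \<in> edges G" for e
    using edge_ends[OF assms(1) that]
  proof cases
    case (1 p q)
    show ?thesis
    proof (cases "p \<in> X \<and> q \<in> X")
      case True
      then have "e \<notin> edges (contract G X a)" using 1 by auto
      then show ?thesis using True 1 by (auto simp: cutset_iff expand_def dest: cutsetD)
    next
      case False
      define P where "P = (if p \<in> X then a else p)"
      define Q where "Q = (if q \<in> X then a else q)"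
      have e: "ends (contract G X a) e = {P, Q}" unfolding P_def Q_def by (rule ends_contract[OF 1(1)])
      have "P \<noteq> Q" unfolding P_def Q_def using False 1(2) assms(2) by auto
      moreover have "e \<in> edges (contract G X a)" using False 1(1) that by simp
      ultimately have "e \<in> cutset (contract G X a) Z \<longleftrightarrow> (P \<in> Z \<longleftrightarrow> Q \<notin> Z)"
        using cutset_iff[OF e] by blast
      moreover have "P \<in> Z \<longleftrightarrow> p \<in> expand X a Z" "Q \<in> Z \<longleftrightarrow> q \<in> expand X a Z"
        using assms(2) by (auto simp: P_def Q_def expand_def)
      ultimately show ?thesis using cutset_iff[OF 1(1,2)] that by simp
    qed
  qed
  then show ?thesis
    by (rule eq_on_superset[of _ "edges G", rotated 2]) (auto dest: cutsetD)
qed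

lemma cut_degree_contract:
  assumes "multigraph G" "a \<in> X"
  shows "cut_degree (contract G X a) Z = cut_degree G (expand X a Z)"
  by (simp add: cut_degree_cutset cutset_contract[OF assms])

lemma joins_contract:
  assumes "multigraph G" "a \<in> X"
  shows "joins (contract G X a) Y Z = joins G (expand X a Y) (expand X a Z)"
  by (simp add: joins_def cutset_contract[OF assms])

lemma card_contract:
  assumes "multigraph G" "X \<subseteq> vertices G" "a \<in> X"
  shows "card (vertices (contract G X a)) + card X = card (vertices G) + 1"
proof -
  have "finite X" using assms finite_subset finite_vertices by blast
  then show ?thesis using assms finite_vertices[OF assms(1)]
    by (simp add: card_insert_if card_Diff_subset card_mono)
qed

lemma edge_connected_iff:
  assumes "multigraph G"
  shows "edge_connected k G \<longleftrightarrow>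
    (\<forall>X. X \<noteq> {} \<and> X \<subset> vertices G \<longrightarrow> k \<le> cut_degree G X)"
proof -
  have "(card X \<ge> 1 \<and> card (vertices G - X) \<ge> 1) \<longleftrightarrow> (X \<noteq> {} \<and> X \<noteq> vertices G)" if "X \<subseteq> vertices G" for X
    using that finite_vertices[OF assms] finite_subset[OF that]
    by (auto simp: Suc_le_eq card_gt_0_iff)
  then show ?thesis unfolding edge_connected_def by (metis psubset_eq)
qed

lemma edge_connected_contract:
  assumes "multigraph G" "X \<subseteq> vertices G" "a \<in> X" "edge_connected k G"
  shows "edge_connected k (contract G X a)"
  unfolding edge_connected_iff[OF multigraph_contract[OF assms(1-3)]]
proof (intro allI impI)
  fix Z assume Z: "Z \<noteq> {} \<and> Z \<subset> vertices (contract G X a)"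
  then have "expand X a Z \<noteq> {} \<and> expand X a Z \<subset> vertices G"
    using assms(2,3) by (auto simp: expand_def split: if_splits)
  then show "k \<le> cut_degree (contract G X a) Z"
    using assms(4) unfolding edge_connected_iff[OF assms(1)] cut_degree_contract[OF assms(1,3)] by blast
qed

text \<open>Immersions compose: if the edges of \<open>G'\<close> are realized by disjoint
  connecting edge sets \<open>R e\<close> of \<open>G\<close>, unions of these realize the
  connections. Deletions, splittings and contractions all pass through this lemma.\<close>

lemma K4_on_transfer:
  assumes K: "K4_on G' T" and V: "vertices G' \<subseteq> vertices G"
    and R: "\<And>e. e \<in> edges G' \<Longrightarrow> R e \<subseteq> edges G"
    and D: "\<And>e e'. e \<in> edges G' \<Longrightarrow> e' \<in> edges G' \<Longrightarrow> e \<noteq> e' \<Longrightarrow> R e \<inter> R e' = {}"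
    and C: "\<And>e p q. e \<in> edges G' \<Longrightarrow> ends G' e = {p, q} \<Longrightarrow> (p, q) \<in> (adj G (R e))\<^sup>*"
  shows "K4_on G T"
proof -
  obtain S where S: "\<And>p q. p \<in> T \<Longrightarrow> q \<in> T \<Longrightarrow> p \<noteq> q \<Longrightarrow> S {p, q} \<subseteq> edges G' \<and> (p, q) \<in> (adj G' (S {p, q}))\<^sup>*"
    and SD: "\<And>d d'. d \<subseteq> T \<Longrightarrow> card d = 2 \<Longrightarrow> d' \<subseteq> T \<Longrightarrow> card d' = 2 \<Longrightarrow> d \<noteq> d' \<Longrightarrow> S d \<inter> S d' = {}"
    using K unfolding K4_on_def by metis
  have T: "T \<subseteq> vertices G" "card T = 4" using K V unfolding K4_on_def by auto
  let ?S = "\<lambda>d. \<Union>(R ` S d)"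
  have sub: "(adj G' A)\<^sup>* \<subseteq> (adj G (\<Union>(R ` A)))\<^sup>*" if "A \<subseteq> edges G'" for A
  proof (rule rtrancl_subset_rtrancl, rule subrelI)
    fix p q assume "(p, q) \<in> adj G' A"
    then obtain e where e: "e \<in> A" "ends G' e = {p, q}" by (auto simp: adj_def)
    have "(p, q) \<in> (adj G (R e))\<^sup>*" using C e that by blast
    moreover have "adj G (R e) \<subseteq> adj G (\<Union>(R ` A))" using e(1) by (auto simp: adj_def)
    ultimately show "(p, q) \<in> (adj G (\<Union>(R ` A)))\<^sup>*" using rtrancl_mono by blast
  qed
  have in_edges: "S d \<subseteq> edges G'" if d: "d \<subseteq> T" "card d = 2" for d
  proof -
    obtain p q where "d = {p, q}" "p \<noteq> q" using d(2) card_2_iff by metis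
    then show ?thesis using S[of p q] d(1) by auto
  qed
  have "?S d \<inter> ?S d' = {}" if d: "d \<subseteq> T" "card d = 2" "d' \<subseteq> T" "card d' = 2" "d \<noteq> d'" for d d'
  proof -
    have "R e \<inter> R e' = {}" if "e \<in> S d" "e' \<in> S d'" for e e'
      using that SD[OF d] D[of e e'] in_edges[OF d(1,2)] in_edges[OF d(3,4)] by blast
    then show ?thesis by blast
  qed
  moreover have "?S {p, q} \<subseteq> edges G \<and> (p, q) \<in> (adj G (?S {p, q}))\<^sup>*" if "p \<in> T" "q \<in> T" "p \<noteq> q" for p q
    using S[OF that] R sub by blast
  ultimately show ?thesis unfolding K4_on_def using T by (intro conjI exI[of _ ?S]) auto
qed

lemma adj_sym: "sym (adj G S)"
  by (auto simp: adj_def sym_def insert_commute)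

lemma K4_on_del_edge: "K4_on (del_edge G e) T \<Longrightarrow> K4_on G T"
  by (erule K4_on_transfer[where R = "\<lambda>e. {e}"]) (auto simp: adj_def)

section \<open>Contracting a set with a minimum cut\<close>

text \<open>An edge leaving \<open>X\<close> at \<open>w\<close> has to be prolonged to
  \<open>a\<close>. By \<open>le\<close> there are enough parallel edges from \<open>w\<close> to
  \<open>a\<close> to give each such edge its own continuation, which amounts to splitting off at
  \<open>w\<close>.\<close>

lemma K4_on_contract_star:
  assumes G: "multigraph G" and X: "X \<subseteq> vertices G" "a \<in> X"
    and star: "\<And>e. e \<in> edges G \<Longrightarrow> ends G e \<subseteq> X \<Longrightarrow> a \<in> ends G e"
    and le: "\<And>w. w \<in> X \<Longrightarrow> w \<noteq> a \<Longrightarrow> joins G {w} (vertices G - X) \<le> joins G {w} {a}"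
    and K: "K4_on (contract G X a) T"
  shows "K4_on G T"
proof -
  let ?O = "\<lambda>w. cutset G {w} \<inter> cutset G (vertices G - X)"
  let ?I = "\<lambda>w. cutset G {w} \<inter> cutset G {a}"
  have "\<exists>h. h ` ?O w \<subseteq> ?I w \<and> inj_on h (?O w)" if "w \<in> X" "w \<noteq> a" for w
    using le[OF that] unfolding joins_def
    by (intro card_le_inj) (auto simp: finite_cutset[OF G])
  then obtain h where h: "\<And>w. w \<in> X \<Longrightarrow> w \<noteq> a \<Longrightarrow> h w ` ?O w \<subseteq> ?I w"
    and inj: "\<And>w. w \<in> X \<Longrightarrow> w \<noteq> a \<Longrightarrow> inj_on (h w) (?O w)"
    by metis
  \<comment> \<open>An edge of the contraction has at most one end in \<open>X\<close>, so at most
    one continuation is added.\<close>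
  define R where "R e = insert e {h w e | w. w \<in> X \<and> w \<noteq> a \<and> e \<in> ?O w}" for e
  have I_ends: "e \<in> edges G" "ends G e = {w, a}" if "w \<noteq> a" "e \<in> ?I w" for w e
    using that cutset_doubleton[OF G that(1)] by auto
  have O_ends: "\<exists>q. ends G e = {w, q} \<and> q \<in> vertices G - X" if e: "e \<in> ?O w" and w: "w \<in> X" for w e
  proof -
    have e': "e \<in> edges G" "w \<in> ends G e" using e cutset_singleton_iff[OF G] by blast+
    obtain q where q: "ends G e = {w, q}" "w \<noteq> q" "q \<in> vertices G"
      by (rule edge_at[OF G e'])
    have "e \<in> cutset G (vertices G - X)" using e by simp
    then have "q \<in> vertices G - X" unfolding cutset_iff[OF q(1,2)] using w q(3) by auto
    then show ?thesis using q by blast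
  qed
  have w_unique: "w = w'" if "e \<in> ?O w" "w \<in> X" "e \<in> ?O w'" "w' \<in> X" for e w w'
    using O_ends[OF that(1,2)] O_ends[OF that(3,4)] that(2,4) by (auto simp: doubleton_eq_iff)
  \<comment> \<open>Continuations lie inside \<open>X\<close>, hence never coincide with an edge of
    the contraction.\<close>
  have not_h: "h w e \<noteq> e'" if "e \<in> ?O w" "w \<in> X" "w \<noteq> a" "e' \<in> edges (contract G X a)" for e e' w
  proof -
    have "h w e \<in> ?I w" using h[OF that(2,3)] that(1) by blast
    then have "ends G (h w e) = {w, a}" using I_ends(2)[OF that(3)] by blast
    then show ?thesis using that X(2) by auto
  qed
  have h_inj: "e = e'" if "e \<in> ?O w" "w \<in> X" "w \<noteq> a" "e' \<in> ?O w'" "w' \<in> X" "w' \<noteq> a" "h w e = h w' e'" for e e' w w'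
  proof -
    have "h w e \<in> ?I w" "h w' e' \<in> ?I w'" using h[OF that(2,3)] h[OF that(5,6)] that(1,4) by blast+
    then have "{w, a} = {w', a}" using I_ends(2) that(3,6,7) by metis
    then have "w = w'" using that(3,6) by (auto simp: doubleton_eq_iff)
    then show ?thesis using inj[OF that(2,3)] that(1,4,7) by (auto dest: inj_onD)
  qed
  show ?thesis
  proof (rule K4_on_transfer[OF K, where R = R])
    show "vertices (contract G X a) \<subseteq> vertices G" using X by auto
    show "R e \<subseteq> edges G" if "e \<in> edges (contract G X a)" for e
    proof -
      have "h w e \<in> edges G" if "w \<in> X" "w \<noteq> a" "e \<in> ?O w" for w
        using h[OF that(1,2)] that(3) I_ends(1)[OF that(2)] by blast
      moreover have "e \<in> edges G" using that by simp
      ultimately show ?thesis unfolding R_def by blast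
    qed
    show "R e \<inter> R e' = {}"
      if e: "e \<in> edges (contract G X a)" "e' \<in> edges (contract G X a)" "e \<noteq> e'" for e e'
    proof -
      have "h w e \<noteq> e'" if "e \<in> ?O w" "w \<in> X" "w \<noteq> a" for w using not_h that e(2) by blast
      moreover have "h w e' \<noteq> e" if "e' \<in> ?O w" "w \<in> X" "w \<noteq> a" for w using not_h that e(1) by blast
      moreover have "h w e \<noteq> h w' e'" if "e \<in> ?O w" "w \<in> X" "w \<noteq> a" "e' \<in> ?O w'" "w' \<in> X" "w' \<noteq> a" for w w'
        using h_inj[OF that] e(3) by blast
      ultimately show ?thesis using e(3) unfolding R_def by blast
    qed
    show "(p, q) \<in> (adj G (R e))\<^sup>*"
      if e: "e \<in> edges (contract G X a)" and pq: "ends (contract G X a) e = {p, q}" for e p q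
    proof -
      have e': "e \<in> edges G" using e by simp
      obtain b c where bc: "ends G e = {b, c}" "b \<noteq> c" "b \<in> vertices G" "c \<in> vertices G"
        by (rule edge_ends[OF G e'])
      have main: "((if b \<in> X then a else b), (if c \<in> X then a else c)) \<in> (adj G (R e))\<^sup>*"
        if bc: "ends G e = {b, c}" "b \<noteq> c" "b \<in> vertices G" "c \<in> vertices G" and c: "c \<notin> X" for b c
      proof -
        have bcR: "(b, c) \<in> adj G (R e)" using bc(1) by (auto simp: adj_def R_def)
        show ?thesis
        proof (cases "b \<in> X \<and> b \<noteq> a")
          case True
          have "e \<in> cutset G {b}" using e' bc cutset_singleton_iff[OF G] by blast
          moreover have "e \<in> cutset G (vertices G - X)"
            unfolding cutset_iff[OF bc(1,2)] using e' bc c True by blast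
          ultimately have O: "e \<in> ?O b" by blast
          then have "h b e \<in> R e" using True unfolding R_def by blast
          moreover have "ends G (h b e) = {b, a}" using h[of b] True O I_ends(2)[of b] by blast
          ultimately have "(a, b) \<in> adj G (R e)" by (auto simp: adj_def insert_commute)
          then show ?thesis using bcR True c by simp
        next
          case False
          then show ?thesis using bcR c by auto
        qed
      qed
      have "b \<notin> X \<or> c \<notin> X" using e bc(1) by simp
      then have "((if b \<in> X then a else b), (if c \<in> X then a else c)) \<in> (adj G (R e))\<^sup>*"
      proof
        assume "b \<notin> X"
        then show ?thesis
          using main[of c b] bc symD[OF sym_rtrancl[OF adj_sym[of G "R e"]]] by (auto simp: insert_commute)
      qed (use main bc in blast)
      moreover have "{p, q} = {if b \<in> X then a else b, if c \<in> X then a else c}"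
        using pq ends_contract[OF bc(1), of X a] by simp
      ultimately show ?thesis
        using symD[OF sym_rtrancl[OF adj_sym[of G "R e"]]] by (auto simp: doubleton_eq_iff)
    qed
  qed
qed

lemma contract_contract:
  assumes "a \<in> Z" "Z \<subseteq> X"
  shows "contract (contract G Z a) (insert a (X - Z)) a = contract G X a"
proof -
  let ?f = "\<lambda>Y v. if v \<in> Y then a else v"
  have f: "?f (insert a (X - Z)) \<circ> ?f Z = ?f X" using assms by (auto simp: fun_eq_iff)
  have "?f Z ` A \<subseteq> insert a (X - Z) \<longleftrightarrow> A \<subseteq> X" for A
    unfolding image_subset_iff using assms by auto
  then have e: "{e \<in> {e \<in> edges G. \<not> ends G e \<subseteq> Z}. \<not> ?f Z ` ends G e \<subseteq> insert a (X - Z)} = {e \<in> edges G. \<not> ends G e \<subseteq> X}"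
    using assms(2) by blast
  have v: "insert a (insert a (vertices G - Z) - insert a (X - Z)) = insert a (vertices G - X)"
    using assms by auto
  show ?thesis unfolding contract_def mgraph.simps image_comp f e v ..
qed

lemma contract_del_edge:
  assumes "ends G e \<subseteq> X"
  shows "contract (del_edge G e) X a = contract G X a"
proof -
  have "{f \<in> edges G - {e}. \<not> ends G f \<subseteq> X} = {f \<in> edges G. \<not> ends G f \<subseteq> X}" using assms by auto
  then show ?thesis by (simp add: contract_def del_edge_def)
qed

text \<open>This replaces the edge version of Menger's theorem: \<open>k\<close> edge-disjoint paths from \<open>a\<close> to the \<open>k\<close>
  edges leaving \<open>X\<close> are never constructed, they arise from successive contractions of stars.\<close>
lemma K4_on_contract:
  assumes "multigraph G" "X \<subseteq> vertices G" "a \<in> X" "cut_degree G X = k"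
    and "\<And>Z. a \<in> Z \<Longrightarrow> Z \<subseteq> X \<Longrightarrow> k \<le> cut_degree G Z"
    and "K4_on (contract G X a) T"
  shows "K4_on G T"
  using assms
proof (induction "card X + card (edges G)" arbitrary: G X rule: less_induct)
  case less
  note G = less.prems(1) and X = less.prems(2,3) and d = less.prems(4) and ge = less.prems(5) and K = less.prems(6)
  have fX: "finite X" using X(1) finite_vertices[OF G] finite_subset by blast
  show ?case
  \<comment> \<open>A tight set strictly between \<open>{a}\<close> and \<open>X\<close> is
    contracted first and the rest of \<open>X\<close> afterwards. Both contracted sets are smaller
    than \<open>X\<close>, and the sets tested in the second contraction expand to sets between
    \<open>{a}\<close> and \<open>X\<close>.\<close>
  proof (cases "\<exists>Z. a \<in> Z \<and> Z \<subset> X \<and> Z \<noteq> {a} \<and> cut_degree G Z = k")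
    case True
    then obtain Z where Z: "a \<in> Z" "Z \<subset> X" "Z \<noteq> {a}" "cut_degree G Z = k" by blast
    have cZ: "card Z < card X" using Z(2) fX by (rule psubset_card_mono[rotated])
    let ?G = "contract G Z a" and ?X = "insert a (X - Z)"
    have G': "multigraph ?G" using multigraph_contract[OF G _ Z(1)] Z(2) X(1) by blast
    have exp: "expand Z a Y = Y \<union> Z" if "a \<in> Y" for Y using that by (simp add: expand_def)
    have fZ: "finite Z" using Z(2) fX finite_subset by blast
    obtain z where z: "z \<in> Z" "z \<noteq> a" using Z(1,3) by blast
    have "X - Z \<subseteq> X - {a} - {z}" using z Z by blast
    then have "card (X - Z) \<le> card (X - {a} - {z})" using fX by (intro card_mono) auto
    moreover have "card (X - {a} - {z}) + 2 = card X"
      using fX X(2) z Z(2) card_Suc_Diff1[of "X - {a}" z] card_Suc_Diff1[of X a] by auto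
    ultimately have cX: "card ?X < card X" using card_insert_le_m1[of "card X - 1" "X - Z" a] by (simp add: card_insert_if fX)
    have "K4_on ?G T"
    proof (rule less.hyps)
      have "card (edges ?G) \<le> card (edges G)"
        using finite_edges[OF G] by (intro card_mono) auto
      then show "card ?X + card (edges ?G) < card X + card (edges G)" using cX by simp
      show "multigraph ?G" by fact
      show "?X \<subseteq> vertices ?G" using X by auto
      show "a \<in> ?X" by simp
      have "?X \<union> Z = X" using Z X by auto
      then show "cut_degree ?G ?X = k"
        using exp[of ?X] d cut_degree_contract[OF G Z(1)] by simp
      show "k \<le> cut_degree ?G Y" if "a \<in> Y" "Y \<subseteq> ?X" for Y
        unfolding cut_degree_contract[OF G Z(1)] exp[OF that(1)]
        using that Z X(2) by (intro ge) auto
      show "K4_on (contract ?G ?X a) T"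
        unfolding contract_contract[OF Z(1) psubset_imp_subset[OF Z(2)]] by (rule K)
    qed
    then show ?thesis
      using less.hyps[of Z G] cZ G Z X(1) ge by (meson add_less_mono1 order_trans psubset_imp_subset)
  next
    case noZ: False
    show ?thesis
    \<comment> \<open>Now only \<open>X\<close> and possibly \<open>{a}\<close> are tight. An edge
      inside \<open>X\<close> that avoids \<open>a\<close> crosses neither, so every relevant cut
      through it has an edge to spare and it can be deleted.\<close>
    proof (cases "\<exists>e\<in>edges G. ends G e \<subseteq> X \<and> a \<notin> ends G e")
      case True
      then obtain e where e: "e \<in> edges G" "ends G e \<subseteq> X" "a \<notin> ends G e" by blast
      obtain p q where pq: "ends G e = {p, q}" "p \<noteq> q"
        by (rule edge_ends[OF G e(1)])
      have "K4_on (del_edge G e) T"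
      proof (rule less.hyps)
        show "card X + card (edges (del_edge G e)) < card X + card (edges G)"
          using card_Diff1_less[OF finite_edges[OF G] e(1)] by (simp only: del_edge_simps add_less_cancel_left)
        show "multigraph (del_edge G e)" using G by (rule multigraph_del_edge)
        show "X \<subseteq> vertices (del_edge G e)" "a \<in> X" using X by auto
        have "e \<notin> cutset G X" using cutset_iff[OF pq] e(2) pq(1) by auto
        then show "cut_degree (del_edge G e) X = k" using cut_degree_del_edge[OF G, of X e] d by simp
        show "k \<le> cut_degree (del_edge G e) Y" if Y: "a \<in> Y" "Y \<subseteq> X" for Y
        proof (cases "e \<in> cutset G Y")
          case True
          then have "(p \<in> Y) = (q \<notin> Y)" using cutset_iff[OF pq] by blast
          moreover have "p \<in> X" "q \<in> X" "a \<noteq> p" "a \<noteq> q" using e(2,3) pq(1) by simp_all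
          ultimately have "Y \<noteq> X" "Y \<noteq> {a}" by blast+
          then have "Y \<subset> X" "Y \<noteq> {a}" using Y(2) by blast+
          then have "cut_degree G Y \<noteq> k" using noZ Y(1) by blast
          then have "k < cut_degree G Y" using ge[OF Y] by linarith
          then show ?thesis using cut_degree_del_edge[OF G, of Y e] by (simp split: if_splits)
        next
          case False
          then show ?thesis using cut_degree_del_edge[OF G, of Y e] ge[OF Y] by simp
        qed
        show "K4_on (contract (del_edge G e) X a) T" unfolding contract_del_edge[OF e(2)] by (rule K)
      qed
      then show ?thesis by (rule K4_on_del_edge)
    next
      case False
      then have star: "a \<in> ends G e" if "e \<in> edges G" "ends G e \<subseteq> X" for e using that by blast
      show ?thesis
      proof (rule K4_on_contract_star[OF G X star _ K])
        \<comment> \<open>Only a star at \<open>a\<close> is left. Comparing the cuts of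
          \<open>X\<close> and \<open>X - {w}\<close> shows that at least half of the edges at
          \<open>w\<close> stay in \<open>X\<close>, and these all end in \<open>a\<close>.\<close>
        fix w assume w: "w \<in> X" "w \<noteq> a"
        have "cut_degree G X + 2 * joins G (X - {w}) {w} = cut_degree G (X - {w}) + cut_degree G {w}"
          using cut_degree_un[OF G, of "X - {w}" "{w}"] w(1) by (simp add: insert_absorb)
        moreover have "cut_degree G X \<le> cut_degree G (X - {w})" unfolding d using w X by (intro ge) auto
        moreover have "cut_degree G {w} = joins G {w} (X - {w}) + joins G {w} (vertices G - X)"
        proof -
          have "vertices G - {w} - (X - {w}) = vertices G - X" using w by auto
          then show ?thesis using cut_degree_split[OF G, of "{w}" "X - {w}"] X(1) by auto
        qed
        moreover have "joins G {w} (X - {w}) = joins G {w} {a}"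
        proof -
          have "cutset G {w} \<inter> cutset G (X - {w}) = cutset G {w} \<inter> cutset G {a}"
          proof (rule eq_on_superset[of _ "edges G"])
            fix e assume e: "e \<in> edges G"
            show "e \<in> cutset G {w} \<inter> cutset G (X - {w}) \<longleftrightarrow> e \<in> cutset G {w} \<inter> cutset G {a}"
            proof (cases "w \<in> ends G e")
              case True
              obtain q where q: "ends G e = {w, q}" "w \<noteq> q" by (rule edge_at[OF G e True])
              have "q \<in> X \<longleftrightarrow> q = a" using star[OF e] q w X(2) by auto
              then show ?thesis using e q w by (auto simp: cutset_iff[OF q])
            next
              case False
              then show ?thesis by (simp add: cutset_singleton_iff[OF G])
            qed
          qed (auto dest: cutsetD)
          then show ?thesis by (simp add: joins_def)
        qed
        ultimately show "joins G {w} (vertices G - X) \<le> joins G {w} {a}"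
          using joins_commute[of G "X - {w}" "{w}"] by linarith
      qed
    qed
  qed
qed

section \<open>Immersions and segmentations\<close>

lemma is_path_rtrancl:
  assumes "is_path G vs es"
  shows "(hd vs, last vs) \<in> (adj G (set es))\<^sup>*"
proof -
  have l: "length vs = Suc (length es)" and e: "\<And>i. i < length es \<Longrightarrow> ends G (es ! i) = {vs ! i, vs ! Suc i}"
    using assms by (auto simp: is_path_def)
  have "(vs ! 0, vs ! i) \<in> (adj G (set es))\<^sup>*" if "i \<le> length es" for i
    using that
  proof (induction i)
    case (Suc i)
    then have "(vs ! i, vs ! Suc i) \<in> adj G (set es)" using e[of i] by (auto simp: adj_def)
    then show ?case using Suc by (auto intro: rtrancl_into_rtrancl)
  qed simp
  moreover have "vs \<noteq> []" using l by auto
  ultimately show ?thesis using l by (simp add: hd_conv_nth last_conv_nth)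
qed

text \<open>The path follows the reachability derivation; when the next vertex already lies on it,
  the path is cut back to that vertex and so stays simple.\<close>

lemma rtrancl_is_path:
  assumes G: "multigraph G" and S: "S \<subseteq> edges G" and p: "p \<in> vertices G" and "(p, q) \<in> (adj G S)\<^sup>*"
  shows "\<exists>vs es. is_path G vs es \<and> set es \<subseteq> S \<and> hd vs = p \<and> last vs = q"
  using assms(4)
proof (induction rule: rtrancl_induct)
  case base
  then show ?case using p by (intro exI[of _ "[p]"] exI[of _ "[]"]) (auto simp: is_path_def)
next
  case (step q r)
  then obtain vs es where vs: "is_path G vs es" "set es \<subseteq> S" "hd vs = p" "last vs = q" by blast
  then have l: "length vs = Suc (length es)" and d: "distinct vs" and v: "set vs \<subseteq> vertices G" and ee: "set es \<subseteq> edges G"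
    and e: "\<And>i. i < length es \<Longrightarrow> ends G (es ! i) = {vs ! i, vs ! Suc i}"
    by (auto simp: is_path_def)
  have ne: "vs \<noteq> []" using l by auto
  obtain f where f: "f \<in> S" "ends G f = {q, r}" using step by (auto simp: adj_def)
  show ?case
  proof (cases "r \<in> set vs")
    case True
    then obtain k where k: "k < length vs" "vs ! k = r" by (auto simp: in_set_conv_nth)
    have "is_path G (take (Suc k) vs) (take k es)"
      unfolding is_path_def using k l d v ee e set_take_subset[of "Suc k" vs] set_take_subset[of k es]
      by (auto simp: min_def)
    moreover have "last (take (Suc k) vs) = r" using k by (simp add: take_Suc_conv_app_nth)
    moreover have "hd (take (Suc k) vs) = p" using vs(3) ne by simp
    moreover have "set (take k es) \<subseteq> S" using vs(2) set_take_subset[of k es] by blast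
    ultimately show ?thesis by blast
  next
    case False
    have "ends G f \<subseteq> vertices G" using f(1) S G by (auto simp: multigraph_def)
    then have rv: "r \<in> vertices G" using f(2) by simp
    have "vs ! length es = q" using vs(4) l ne by (simp add: last_conv_nth)
    then have "ends G ((es @ [f]) ! i) = {(vs @ [r]) ! i, (vs @ [r]) ! Suc i}" if "i < length (es @ [f])" for i
      using that e[of i] f(2) l by (cases "i < length es") (auto simp: nth_append less_Suc_eq)
    then have "is_path G (vs @ [r]) (es @ [f])"
      unfolding is_path_def using l d v ee rv f(1) S False by auto
    then show ?thesis using vs f(1) ne by (intro exI[of _ "vs @ [r]"] exI[of _ "es @ [f]"]) auto
  qed
qed

lemma K4_edges: "edges (complete_graph 4) = {e. e \<subseteq> {..<4::nat} \<and> card e = 2}"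
  "vertices (complete_graph 4) = {..<4::nat}" "ends (complete_graph 4) e = e"
  by (auto simp: complete_graph_def)

lemma immersion_map_K4_on:
  assumes "immersion_map (complete_graph 4) G \<phi>"
  shows "K4_on G (\<phi> ` {..<4})"
proof -
  have inj: "inj_on \<phi> {..<4}" and sub: "\<phi> ` {..<4} \<subseteq> vertices G"
    using assms by (auto simp: immersion_map_def K4_edges)
  obtain P where P': "\<forall>e\<in>edges (complete_graph 4). \<exists>vs. is_path G vs (P e) \<and> {hd vs, last vs} = \<phi> ` ends (complete_graph 4) e"
    and D': "\<forall>e\<in>edges (complete_graph 4). \<forall>f\<in>edges (complete_graph 4). e \<noteq> f \<longrightarrow> set (P e) \<inter> set (P f) = {}"
    using assms unfolding immersion_map_def by blast
  have P: "\<exists>vs. is_path G vs (P e) \<and> {hd vs, last vs} = \<phi> ` e" if "e \<subseteq> {..<4}" "card e = 2" for e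
    using P' that unfolding K4_edges by blast
  have D: "set (P e) \<inter> set (P f) = {}"
    if "e \<subseteq> {..<4}" "card e = 2" "f \<subseteq> {..<4}" "card f = 2" "e \<noteq> f" for e f
    using D' that unfolding K4_edges by blast
  \<comment> \<open>Connections are indexed by pairs of vertices of \<open>G\<close>, paths by edges
    of the complete graph; injectivity makes the translation preserve sizes.\<close>
  define pre where "pre d = {i \<in> {..<4::nat}. \<phi> i \<in> d}" for d
  have pre: "pre d \<subseteq> {..<4}" "\<phi> ` pre d = d" "card (pre d) = card d" if d: "d \<subseteq> \<phi> ` {..<4}" for d
  proof -
    show "pre d \<subseteq> {..<4}" by (auto simp: pre_def)
    show im: "\<phi> ` pre d = d" using d by (auto simp: pre_def)
    have "inj_on \<phi> (pre d)" using inj by (rule inj_on_subset) (auto simp: pre_def)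
    then show "card (pre d) = card d" using card_image im by fastforce
  qed
  let ?S = "\<lambda>d. set (P (pre d))"
  have "?S {p, q} \<subseteq> edges G \<and> (p, q) \<in> (adj G (?S {p, q}))\<^sup>*"
    if pq: "p \<in> \<phi> ` {..<4}" "q \<in> \<phi> ` {..<4}" "p \<noteq> q" for p q
  proof -
    have d: "{p, q} \<subseteq> \<phi> ` {..<4}" "card {p, q} = 2" using pq by auto
    obtain vs where vs: "is_path G vs (P (pre {p, q}))" "{hd vs, last vs} = \<phi> ` pre {p, q}"
      using P[OF pre(1)[OF d(1)]] pre(3)[OF d(1)] d(2) by auto
    have "{hd vs, last vs} = {p, q}" using vs(2) unfolding pre(2)[OF d(1)] .
    \<comment> \<open>An immersion does not fix the direction of its paths, so both orders must be
      treated; reachability is symmetric.\<close>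
    then have "hd vs = p \<and> last vs = q \<or> hd vs = q \<and> last vs = p" by (simp add: doubleton_eq_iff)
    moreover note c = is_path_rtrancl[OF vs(1)] symD[OF sym_rtrancl[OF adj_sym] is_path_rtrancl[OF vs(1)]]
    ultimately have "(p, q) \<in> (adj G (?S {p, q}))\<^sup>*" using c by (elim disjE conjE) simp_all
    then show ?thesis using vs(1) by (simp add: is_path_def)
  qed
  moreover have "?S d \<inter> ?S d' = {}"
    if d: "d \<subseteq> \<phi> ` {..<4}" "card d = 2" "d' \<subseteq> \<phi> ` {..<4}" "card d' = 2" "d \<noteq> d'" for d d'
  proof (rule D)
    show "pre d \<noteq> pre d'" using pre(2)[OF d(1)] pre(2)[OF d(3)] d(5) by metis
  qed (use pre d in auto)
  moreover have "card (\<phi> ` {..<4}) = 4" using card_image[OF inj] by simp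
  ultimately show ?thesis unfolding K4_on_def using sub by (intro conjI exI[of _ ?S]) auto
qed

text \<open>Any bijection onto the terminals works, since there is a connection for each pair of
  them. This is why the choice of the root of the complete graph is immaterial.\<close>

lemma K4_on_immersion_map:
  assumes G: "multigraph G" and K: "K4_on G T" and x: "x \<in> T" and y: "y < (4::nat)"
  shows "\<exists>\<phi>. immersion_map (complete_graph 4) G \<phi> \<and> \<phi> y = x"
proof -
  have T: "T \<subseteq> vertices G" "card T = 4" using K by (auto simp: K4_on_def)
  obtain S where S: "\<And>p q. p \<in> T \<Longrightarrow> q \<in> T \<Longrightarrow> p \<noteq> q \<Longrightarrow> S {p, q} \<subseteq> edges G \<and> (p, q) \<in> (adj G (S {p, q}))\<^sup>*"
    and D: "\<And>d d'. d \<subseteq> T \<Longrightarrow> card d = 2 \<Longrightarrow> d' \<subseteq> T \<Longrightarrow> card d' = 2 \<Longrightarrow> d \<noteq> d' \<Longrightarrow> S d \<inter> S d' = {}"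
    using K unfolding K4_on_def by metis
  have "finite T" using T(2) by (intro card_ge_0_finite) simp
  then have "card ({..<4} - {y}) = card (T - {x})" using T(2) x y by simp
  then obtain g where g: "bij_betw g ({..<4} - {y}) (T - {x})"
    using \<open>finite T\<close> finite_same_card_bij[of "{..<4} - {y}" "T - {x}"] by auto
  define \<phi> where "\<phi> = g(y := x)"
  have "bij_betw \<phi> ({..<4} - {y}) (T - {x})" using g by (rule bij_betw_cong[THEN iffD1, rotated]) (auto simp: \<phi>_def)
  moreover have "bij_betw \<phi> {y} {x}" by (auto simp: \<phi>_def bij_betw_def)
  ultimately have "bij_betw \<phi> (({..<4} - {y}) \<union> {y}) ((T - {x}) \<union> {x})" by (rule bij_betw_combine) auto
  moreover have "({..<4} - {y}) \<union> {y} = {..<4}" "(T - {x}) \<union> {x} = T" using x y by auto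
  ultimately have bij: "bij_betw \<phi> {..<4} T" by simp
  then have inj: "inj_on \<phi> {..<4}" and im: "\<phi> ` {..<4} = T" by (auto simp: bij_betw_def)
  have "\<exists>es vs. is_path G vs es \<and> set es \<subseteq> S (\<phi> ` e) \<and> {hd vs, last vs} = \<phi> ` e" if e: "e \<subseteq> {..<4}" "card e = 2" for e
  proof -
    obtain i j where ij: "e = {i, j}" "i \<noteq> j" using e(2) card_2_iff by metis
    have ij': "i \<in> {..<4}" "j \<in> {..<4}" using ij(1) e(1) by blast+
    then have "\<phi> i \<in> T" "\<phi> j \<in> T" using im by blast+
    moreover have "\<phi> i \<noteq> \<phi> j" using inj_on_eq_iff[OF inj ij'] ij(2) by blast
    ultimately have "S {\<phi> i, \<phi> j} \<subseteq> edges G" "(\<phi> i, \<phi> j) \<in> (adj G (S {\<phi> i, \<phi> j}))\<^sup>*" "\<phi> i \<in> vertices G"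
      using S T(1) by blast+
    then obtain vs es where "is_path G vs es" "set es \<subseteq> S {\<phi> i, \<phi> j}" "hd vs = \<phi> i" "last vs = \<phi> j"
      using rtrancl_is_path[OF G] by metis
    moreover have "\<phi> ` e = {\<phi> i, \<phi> j}" using ij(1) by simp
    ultimately show ?thesis by metis
  qed
  then obtain P where P: "\<And>e. e \<subseteq> {..<4} \<Longrightarrow> card e = 2 \<Longrightarrow>
      \<exists>vs. is_path G vs (P e) \<and> set (P e) \<subseteq> S (\<phi> ` e) \<and> {hd vs, last vs} = \<phi> ` e"
    by metis
  have dis: "set (P e) \<inter> set (P f) = {}"
    if e: "e \<subseteq> {..<4}" "card e = 2" "f \<subseteq> {..<4}" "card f = 2" "e \<noteq> f" for e f
  proof -
    have "\<phi> ` e \<noteq> \<phi> ` f" using inj_on_image_eq_iff[OF inj e(1,3)] e(5) by simp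
    moreover have "card (\<phi> ` e) = 2" "card (\<phi> ` f) = 2"
      using e card_image inj inj_on_subset by metis+
    moreover have "\<phi> ` e \<subseteq> T" "\<phi> ` f \<subseteq> T" using im e by blast+
    ultimately have "S (\<phi> ` e) \<inter> S (\<phi> ` f) = {}" by (intro D)
    then show ?thesis using P[OF e(1,2)] P[OF e(3,4)] by blast
  qed
  have "immersion_map (complete_graph 4) G \<phi>"
    unfolding immersion_map_def K4_edges
  proof (intro conjI exI[of _ P] ballI impI)
    show "\<exists>vs. is_path G vs (P e) \<and> {hd vs, last vs} = \<phi> ` e" if "e \<in> {e. e \<subseteq> {..<4} \<and> card e = 2}" for e
      using P[of e] that by blast
  qed (use inj im T dis in auto)
  then show ?thesis by (auto simp: \<phi>_def)
qed

lemma rtrancl_adj_cutset: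
  assumes G: "multigraph G" and S: "S \<subseteq> edges G" and pq: "(p, q) \<in> (adj G S)\<^sup>*" and X: "p \<in> X" "q \<notin> X"
  shows "\<exists>e\<in>S. e \<in> cutset G X"
  using pq X(2)
proof (induction rule: rtrancl_induct)
  case (step q r)
  show ?case
  proof (cases "q \<in> X")
    case True
    obtain e where e: "e \<in> S" "ends G e = {q, r}" using step by (auto simp: adj_def)
    moreover have "q \<noteq> r" using True step by auto
    ultimately show ?thesis using True step(4) S cutset_iff[OF e(2)] by blast
  qed (use step in blast)
qed (use X in simp)

text \<open>The 2 * 2 separated pairs of terminals each need an edge of the cut, and their
  connections are disjoint.\<close>

lemma K4_on_cut_degree:
  assumes G: "multigraph G" and K: "K4_on G T" and X: "card (T \<inter> X) = 2"
  shows "4 \<le> cut_degree G X"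
proof -
  have T: "T \<subseteq> vertices G" "card T = 4" using K by (auto simp: K4_on_def)
  obtain S where S: "\<And>p q. p \<in> T \<Longrightarrow> q \<in> T \<Longrightarrow> p \<noteq> q \<Longrightarrow> S {p, q} \<subseteq> edges G \<and> (p, q) \<in> (adj G (S {p, q}))\<^sup>*"
    and D: "\<And>d d'. d \<subseteq> T \<Longrightarrow> card d = 2 \<Longrightarrow> d' \<subseteq> T \<Longrightarrow> card d' = 2 \<Longrightarrow> d \<noteq> d' \<Longrightarrow> S d \<inter> S d' = {}"
    using K unfolding K4_on_def by metis
  let ?D = "(T \<inter> X) \<times> (T - X)"
  have "\<exists>e. e \<in> S {fst d, snd d} \<and> e \<in> cutset G X" if "d \<in> ?D" for d
  proof -
    have d: "fst d \<in> T" "snd d \<in> T" "fst d \<noteq> snd d" "fst d \<in> X" "snd d \<notin> X" using that by auto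
    then show ?thesis using rtrancl_adj_cutset[OF G] S[OF d(1-3)] by blast
  qed
  then obtain c where c: "\<And>d. d \<in> ?D \<Longrightarrow> c d \<in> S {fst d, snd d} \<and> c d \<in> cutset G X" by metis
  have "inj_on c ?D"
  proof (rule inj_onI, rule ccontr)
    fix d d' assume d: "d \<in> ?D" "d' \<in> ?D" "c d = c d'" "d \<noteq> d'"
    then have "{fst d, snd d} \<noteq> {fst d', snd d'}" by (auto simp: doubleton_eq_iff)
    moreover have "{fst d, snd d} \<subseteq> T" "card {fst d, snd d} = 2" "{fst d', snd d'} \<subseteq> T" "card {fst d', snd d'} = 2"
      using d by (auto simp: card_insert_if)
    ultimately have "S {fst d, snd d} \<inter> S {fst d', snd d'} = {}" by (intro D)
    then show False using c[OF d(1)] c[OF d(2)] d(3) by auto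
  qed
  moreover have "c ` ?D \<subseteq> cutset G X" using c by blast
  ultimately have "card ?D \<le> card (cutset G X)" by (rule card_inj_on_le) (rule finite_cutset[OF G])
  moreover have "card (T - X) = 2"
  proof -
    have "finite T" using T(2) by (intro card_ge_0_finite) simp
    then have "card T = card (T \<inter> X) + card (T - X)" by (rule card_Int_Diff)
    then show ?thesis using X T(2) by linarith
  qed
  ultimately show ?thesis using X by (simp add: cut_degree_cutset card_cartesian_product)
qed

text \<open>Away from the ends of a segmentation the number of terminals below grows in unit steps from
  at most 1 to at least 3, so it would have to pass 2.\<close>
lemma has_segmentation_not_K4_on:
  assumes G: "multigraph G" and s: "has_segmentation G 2 2 3"
  shows "\<not> K4_on G T"
proof
  assume K: "K4_on G T"
  have T: "T \<subseteq> vertices G" "card T = 4" using K by (auto simp: K4_on_def)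
  have fT: "finite T" using T(2) by (intro card_ge_0_finite) simp
  obtain X Y Xs where s: "segmentation G X Y Xs" "card X \<le> 2" "card Y \<le> 2" "\<And>Z. Z \<in> set Xs \<Longrightarrow> cut_degree G Z = 3"
    using s unfolding has_segmentation_def by blast
  have ne: "Xs \<noteq> []" and hd: "Xs ! 0 = X" and last: "vertices G - Xs ! (length Xs - 1) = Y" and X: "X \<subseteq> vertices G" "Y \<subseteq> vertices G"
    and step: "\<And>i. Suc i < length Xs \<Longrightarrow> Xs ! i \<subset> Xs ! Suc i \<and> card (Xs ! Suc i - Xs ! i) = 1"
    using s(1) by (auto simp: segmentation_def hd_conv_nth last_conv_nth)
  have not2: "card (T \<inter> Xs ! i) \<noteq> 2" if "i < length Xs" for i
    using K4_on_cut_degree[OF G K, of "Xs ! i"] s(4)[of "Xs ! i"] that by auto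
  have "card (T \<inter> Xs ! i) \<le> 1" if "i < length Xs" for i
    using that
  proof (induction i)
    case 0
    have "card (T \<inter> X) \<le> card X" using X finite_vertices[OF G] by (intro card_mono) (auto intro: finite_subset)
    then show ?case using not2[of 0] 0 s(2) hd by auto
  next
    case (Suc i)
    obtain v where v: "Xs ! Suc i - Xs ! i = {v}" using step[OF Suc.prems] card_1_singletonE by blast
    then have "T \<inter> Xs ! Suc i \<subseteq> insert v (T \<inter> Xs ! i)" by blast
    then have "card (T \<inter> Xs ! Suc i) \<le> card (insert v (T \<inter> Xs ! i))" using fT by (intro card_mono) auto
    also have "\<dots> \<le> Suc (card (T \<inter> Xs ! i))" using fT by (simp add: card_insert_if)
    finally show ?case using Suc not2[OF Suc.prems] by simp
  qed
  then have "card (T \<inter> Xs ! (length Xs - 1)) \<le> 1" using ne by simp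
  moreover have "card (T \<inter> Y) \<le> 2"
    using s(3) card_mono[of Y "T \<inter> Y"] finite_subset[OF X(2) finite_vertices[OF G]] by auto
  moreover have "T = (T \<inter> Xs ! (length Xs - 1)) \<union> (T \<inter> Y)" using T last by blast
  ultimately show False using T(2) card_Un_le[of "T \<inter> Xs ! (length Xs - 1)" "T \<inter> Y"] by simp
qed

text \<open>The inductive form of a segmentation of width three, without bounds on its ends. Gluing
  is transitivity, reversal is complementation, and no list indices appear until
  \<open>chain_list\<close>.\<close>

inductive chain :: "('v, 'e) mgraph \<Rightarrow> 'v set \<Rightarrow> 'v set \<Rightarrow> bool" for G where
  chain_refl: "A \<subseteq> vertices G \<Longrightarrow> cut_degree G A = 3 \<Longrightarrow> chain G A A"
| chain_step: "chain G A B \<Longrightarrow> v \<in> vertices G \<Longrightarrow> v \<notin> B \<Longrightarrow> cut_degree G (insert v B) = 3 \<Longrightarrow> chain G A (insert v B)"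

lemma chain_ends:
  "chain G A B \<Longrightarrow> A \<subseteq> B \<and> A \<subseteq> vertices G \<and> B \<subseteq> vertices G \<and> cut_degree G A = 3 \<and> cut_degree G B = 3"
  by (induction rule: chain.induct) auto

lemma chain_trans: "chain G B C \<Longrightarrow> chain G A B \<Longrightarrow> chain G A C"
  by (induction rule: chain.induct) (auto intro: chain_step)

text \<open>The rules extend a chain only at its large end; this extends it at the small end, as
  reversal requires.\<close>

lemma chain_insert:
  assumes "cut_degree G B = 3" "chain G (insert v B) C" "v \<notin> B"
  shows "chain G B C"
proof -
  have i: "insert v B \<subseteq> vertices G" "cut_degree G (insert v B) = 3" using chain_ends[OF assms(2)] by auto
  have "chain G B B" using i(1) assms(1) by (intro chain_refl) auto
  then have "chain G B (insert v B)" using i assms(3) by (intro chain_step) auto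
  then show ?thesis using assms(2) chain_trans by blast
qed

lemma chain_compl:
  assumes G: "multigraph G"
  shows "chain G A B \<Longrightarrow> chain G (vertices G - B) (vertices G - A)"
proof (induction rule: chain.induct)
  case (chain_refl A)
  then show ?case by (intro chain.chain_refl) (auto simp: cut_degree_compl[OF G])
next
  case (chain_step A B v)
  have eq: "insert v (vertices G - insert v B) = vertices G - B" using chain_step by auto
  show ?case
    by (rule chain_insert[of _ _ v]) (use chain_step eq cut_degree_compl[OF G] in auto)
qed

text \<open>Sizes grow by one in each step, so a chain can be cut at every intermediate
  size.\<close>

lemma chain_at_card:
  assumes "multigraph G" "chain G A B" "card A \<le> k" "k \<le> card B"
  shows "\<exists>Z. chain G A Z \<and> chain G Z B \<and> card Z = k"
  using assms(2-4)
proof (induction rule: chain.induct)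
  case (chain_refl A)
  then show ?case by (intro exI[of _ A]) (auto intro: chain.chain_refl)
next
  case (chain_step A B v)
  have B: "B \<subseteq> vertices G" "insert v B \<subseteq> vertices G" "cut_degree G B = 3" using chain_ends[OF chain_step(1)] chain_step by auto
  then have fB: "finite B" using finite_subset finite_vertices[OF assms(1)] by blast
  have AV: "chain G A (insert v B)" using chain_step by (intro chain.chain_step) auto
  show ?case
  proof (cases "k \<le> card B")
    case True
    then obtain Z where Z: "chain G A Z" "chain G Z B" "card Z = k" using chain_step by blast
    then have "chain G Z (insert v B)" using chain_step by (intro chain.chain_step) auto
    then show ?thesis using Z by blast
  next
    case False
    then have "card (insert v B) = k" using chain_step fB by auto
    moreover have "chain G (insert v B) (insert v B)" using B chain_step by (intro chain.chain_refl) auto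
    ultimately show ?thesis using AV by blast
  qed
qed

lemma chain_list:
  assumes "chain G A B"
  shows "\<exists>Xs. Xs \<noteq> [] \<and> hd Xs = A \<and> last Xs = B \<and>
    (\<forall>Z\<in>set Xs. Z \<subseteq> vertices G \<and> cut_degree G Z = 3) \<and>
    (\<forall>i. Suc i < length Xs \<longrightarrow> Xs ! i \<subset> Xs ! Suc i \<and> card (Xs ! Suc i - Xs ! i) = 1)"
  using assms
proof (induction rule: chain.induct)
  case (chain_refl A)
  then show ?case by (intro exI[of _ "[A]"]) auto
next
  case (chain_step A B v)
  then obtain Xs where Xs: "Xs \<noteq> []" "hd Xs = A" "last Xs = B" "\<forall>Z\<in>set Xs. Z \<subseteq> vertices G \<and> cut_degree G Z = 3"
    and st: "\<And>i. Suc i < length Xs \<Longrightarrow> Xs ! i \<subset> Xs ! Suc i \<and> card (Xs ! Suc i - Xs ! i) = 1" by blast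
  let ?Ys = "Xs @ [insert v B]"
  have iB: "insert v B - B = {v}" using chain_step by auto
  have "?Ys ! i \<subset> ?Ys ! Suc i \<and> card (?Ys ! Suc i - ?Ys ! i) = 1" if "Suc i < length ?Ys" for i
  proof (cases "Suc i < length Xs")
    case True
    then show ?thesis using st[OF True] by (simp add: nth_append)
  next
    case False
    then have i: "i = length Xs - 1" "Suc i = length Xs" using that by auto
    then have "?Ys ! i = B" using Xs(1,3) by (simp add: nth_append last_conv_nth)
    moreover have "?Ys ! Suc i = insert v B" unfolding i(2) by simp
    ultimately have "?Ys ! i = B" "?Ys ! Suc i = insert v B" by blast+
    then show ?thesis using iB chain_step(3) by auto
  qed
  moreover have "insert v B \<subseteq> vertices G" using chain_ends[OF chain_step(1)] chain_step by auto
  ultimately show ?case using Xs chain_step by (intro exI[of _ ?Ys]) auto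
qed

definition chainseg :: "('v, 'e) mgraph \<Rightarrow> bool" where
  "chainseg G \<longleftrightarrow> (\<exists>A B. chain G A B \<and> card A \<le> 2 \<and> card (vertices G - B) \<le> 2)"

lemma chainseg_has_segmentation:
  assumes "chainseg G"
  shows "has_segmentation G 2 2 3"
proof -
  obtain A B where AB: "chain G A B" "card A \<le> 2" "card (vertices G - B) \<le> 2" using assms by (auto simp: chainseg_def)
  obtain Xs where Xs: "Xs \<noteq> []" "hd Xs = A" "last Xs = B" "\<forall>Z\<in>set Xs. Z \<subseteq> vertices G \<and> cut_degree G Z = 3"
    "\<forall>i. Suc i < length Xs \<longrightarrow> Xs ! i \<subset> Xs ! Suc i \<and> card (Xs ! Suc i - Xs ! i) = 1"
    using chain_list[OF AB(1)] by blast
  have "segmentation G A (vertices G - B) Xs"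
    unfolding segmentation_def using Xs chain_ends[OF AB(1)] by auto
  then show ?thesis unfolding has_segmentation_def using AB(2,3) Xs(4) by blast
qed

section \<open>Doubled cycles\<close>

text \<open>Four terminals \<open>0, 1, 2, 3\<close> cut a doubled cycle into four arcs, where arc \<open>k\<close> starts at terminal
  \<open>k\<close>; \<open>xij k\<close> says that the connection of \<open>i\<close> and \<open>j\<close> uses one of the two parallel edges at the start of
  arc \<open>k\<close>. The four connections of neighbours use at least one of these 8 edges each and the other two
  at least two each, so none is left; but the other two have an arc in common, which is overloaded.\<close>
lemma four_arcs_overloaded:
  fixes x01 x12 x23 x03 x02 x13 :: "nat \<Rightarrow> bool"
  assumes "\<And>k. k \<in> {1, 2, 3} \<Longrightarrow> x01 0 \<or> x01 k"
    and "\<And>k. k \<in> {0, 2, 3} \<Longrightarrow> x12 1 \<or> x12 k"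
    and "\<And>k. k \<in> {0, 1, 3} \<Longrightarrow> x23 2 \<or> x23 k"
    and "\<And>k. k \<in> {0, 1, 2} \<Longrightarrow> x03 3 \<or> x03 k"
    and "\<And>j k. j \<in> {0, 1} \<Longrightarrow> k \<in> {2, 3} \<Longrightarrow> x02 j \<or> x02 k"
    and "\<And>j k. j \<in> {1, 2} \<Longrightarrow> k \<in> {0, 3} \<Longrightarrow> x13 j \<or> x13 k"
  shows "\<exists>k<4. of_bool (x01 k) + of_bool (x12 k) + of_bool (x23 k) + of_bool (x03 k)
    + of_bool (x02 k) + of_bool (x13 k) > (2 :: nat)"
proof (rule ccontr)
  assume "\<not> ?thesis"
  then have le: "of_bool (x01 k) + of_bool (x12 k) + of_bool (x23 k) + of_bool (x03 k)
    + of_bool (x02 k) + of_bool (x13 k) \<le> (2 :: nat)" if "k < 4" for k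
    using that by (meson not_less)
  let ?s = "\<lambda>x :: nat \<Rightarrow> bool. of_bool (x 0) + of_bool (x 1) + of_bool (x 2) + of_bool (x 3) :: nat"
  have total: "?s x01 + ?s x12 + ?s x23 + ?s x03 + ?s x02 + ?s x13 \<le> 8"
    using le[of 0] le[of 1] le[of 2] le[of 3] by simp
  have 1: "x01 0 \<or> 2 \<le> ?s x01" "1 \<le> ?s x01"
    using assms(1)[of 1] assms(1)[of 2] by (cases "x01 0"; simp)+
  have 2: "x12 1 \<or> 2 \<le> ?s x12" "1 \<le> ?s x12"
    using assms(2)[of 0] assms(2)[of 2] by (cases "x12 1"; simp)+
  have 3: "x23 2 \<or> 2 \<le> ?s x23" "1 \<le> ?s x23"
    using assms(3)[of 0] assms(3)[of 1] by (cases "x23 2"; simp)+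
  have 4: "x03 3 \<or> 2 \<le> ?s x03" "1 \<le> ?s x03"
    using assms(4)[of 0] assms(4)[of 1] by (cases "x03 3"; simp)+
  have 5: "(x02 0 \<and> x02 1) \<or> (x02 2 \<and> x02 3)"
    using assms(5)[of 0 2] assms(5)[of 0 3] assms(5)[of 1 2] assms(5)[of 1 3] by auto
  have 6: "(x13 1 \<and> x13 2) \<or> (x13 0 \<and> x13 3)"
    using assms(6)[of 1 0] assms(6)[of 1 3] assms(6)[of 2 0] assms(6)[of 2 3] by auto
  have two: "2 \<le> ?s x02" "2 \<le> ?s x13" using 5 6 by auto
  have *: "\<not> 2 \<le> ?s x01" "\<not> 2 \<le> ?s x12" "\<not> 2 \<le> ?s x23" "\<not> 2 \<le> ?s x03"
    using total 1(2) 2(2) 3(2) 4(2) two by linarith+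
  have "x01 0" "x12 1" "x23 2" "x03 3"
    using 1(1) 2(1) 3(1) 4(1) * by blast+
  then have "\<not> (x02 0 \<and> x13 0)" "\<not> (x02 1 \<and> x13 1)" "\<not> (x02 2 \<and> x13 2)" "\<not> (x02 3 \<and> x13 3)"
    using le[of 0] le[of 1] le[of 2] le[of 3] by auto
  then show False using 5 6 by blast
qed

section \<open>Doubled cycles as an obstruction\<close>

lemma card_disjoint_meets:
  assumes "finite B" "finite D" "\<And>d d'. d \<in> D \<Longrightarrow> d' \<in> D \<Longrightarrow> d \<noteq> d' \<Longrightarrow> S d \<inter> S d' = {}"
  shows "card {d \<in> D. S d \<inter> B \<noteq> {}} \<le> card B"
proof -
  define b where "b d = (SOME e. e \<in> S d \<inter> B)" for d
  have b: "b d \<in> S d \<inter> B" if d: "d \<in> {d \<in> D. S d \<inter> B \<noteq> {}}" for d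
  proof -
    obtain e where "e \<in> S d \<inter> B" using d by blast
    then show ?thesis unfolding b_def by (rule someI[of "\<lambda>e. e \<in> S d \<inter> B"])
  qed
  have "inj_on b {d \<in> D. S d \<inter> B \<noteq> {}}"
  proof (rule inj_onI, rule ccontr)
    fix d d' assume d: "d \<in> {d \<in> D. S d \<inter> B \<noteq> {}}" "d' \<in> {d \<in> D. S d \<inter> B \<noteq> {}}" "b d = b d'" "d \<noteq> d'"
    have "d \<in> D" "d' \<in> D" using d(1,2) by blast+
    then have "S d \<inter> S d' = {}" using assms(3) d(4) by blast
    then show False using b[OF d(1)] b[OF d(2)] unfolding d(3) by blast
  qed
  moreover have "b ` {d \<in> D. S d \<inter> B \<noteq> {}} \<subseteq> B" using b by blast
  ultimately show ?thesis using assms(1) by (rule card_inj_on_le)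
qed

lemma doubled_cycle_not_K4_on:
  assumes G: "multigraph G" and dc: "doubled_cycle G"
  shows "\<not> K4_on G T"
proof
  assume K: "K4_on G T"
  have T: "T \<subseteq> vertices G" "card T = 4" using K by (auto simp: K4_on_def)
  obtain S where S: "\<And>p q. p \<in> T \<Longrightarrow> q \<in> T \<Longrightarrow> p \<noteq> q \<Longrightarrow> S {p, q} \<subseteq> edges G \<and> (p, q) \<in> (adj G (S {p, q}))\<^sup>*"
    and D: "\<And>d d'. d \<subseteq> T \<Longrightarrow> card d = 2 \<Longrightarrow> d' \<subseteq> T \<Longrightarrow> card d' = 2 \<Longrightarrow> d \<noteq> d' \<Longrightarrow> S d \<inter> S d' = {}"
    using K unfolding K4_on_def by metis
  obtain C f where C: "C \<subseteq> edges G" "is_cycle (G\<lparr>edges := C\<rparr>)" and f: "bij_betw f C (edges G - C)"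
    and fe: "\<And>e. e \<in> C \<Longrightarrow> ends G (f e) = ends G e"
    using dc unfolding doubled_cycle_def by blast
  obtain vs es where len: "length es = length vs" and dv: "distinct vs" and de: "distinct es"
    and vs: "set vs = vertices G" and es: "set es = C"
    and ee: "\<And>i. i < length vs \<Longrightarrow> ends G (es ! i) = {vs ! i, vs ! (Suc i mod length vs)}"
    using C(2) unfolding is_cycle_def by auto
  let ?n = "length vs"
  define A where "A i = {es ! i, f (es ! i)}" for i
  have Aends: "ends G e = {vs ! i, vs ! (Suc i mod ?n)}" if "e \<in> A i" "i < ?n" for e i
    using that ee[of i] fe[of "es ! i"] es len nth_mem[of i es] by (auto simp: A_def)
  have cover: "\<exists>i<?n. e \<in> A i" if e: "e \<in> edges G" for e
  proof (cases "e \<in> C")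
    case True
    then show ?thesis using es len by (auto simp: A_def in_set_conv_nth)
  next
    case False
    then have "e \<in> f ` C" using e f by (simp add: bij_betw_def)
    then obtain c where "c \<in> C" "f c = e" by blast
    then show ?thesis using es len by (auto simp: A_def in_set_conv_nth)
  qed
  \<comment> \<open>Half-open, because the edges at position \<open>i\<close> join the vertices
    \<open>i\<close> and \<open>i + 1\<close>: exactly the positions \<open>a\<close> and
    \<open>b\<close> then border the arc. As \<open>b\<close> is less than the length of the cycle,
    arcs never wrap around.\<close>
  define arc where "arc a b = {vs ! j | j. a < j \<and> j \<le> b}" for a b
  have arc_iff: "vs ! j \<in> arc a b \<longleftrightarrow> a < j \<and> j \<le> b" if "j < ?n" "b < ?n" for a b j
    using that dv by (auto simp: arc_def nth_eq_iff_index_eq)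
  have arc_cut: "cutset G (arc a b) \<subseteq> A a \<union> A b" if ab: "a < b" "b < ?n" for a b
  proof
    fix e assume e: "e \<in> cutset G (arc a b)"
    have eE: "e \<in> edges G" using e by (rule cutsetD)
    obtain i where i: "i < ?n" "e \<in> A i" using cover[OF eE] by blast
    have n: "Suc i mod ?n < ?n" using i by (intro mod_less_divisor) auto
    obtain p q where pq: "ends G e = {p, q}" "p \<noteq> q" by (rule edge_ends[OF G eE])
    have "{p, q} = {vs ! i, vs ! (Suc i mod ?n)}" using Aends[OF i(2,1)] pq(1) by simp
    then have "vs ! i \<noteq> vs ! (Suc i mod ?n)" using pq(2) by auto
    then have "vs ! i \<in> arc a b \<longleftrightarrow> vs ! (Suc i mod ?n) \<notin> arc a b"
      using e cutset_iff[OF Aends[OF i(2,1)]] by blast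
    then have "(a < i \<and> i \<le> b) \<longleftrightarrow> \<not> (a < Suc i mod ?n \<and> Suc i mod ?n \<le> b)"
      using arc_iff[OF i(1) ab(2)] arc_iff[OF n ab(2)] by blast
    then have "i = a \<or> i = b" using ab i(1) by (auto simp: mod_Suc split: if_splits)
    then show "e \<in> A a \<union> A b" using i(2) by auto
  qed
  define I where "I = {i. i < ?n \<and> vs ! i \<in> T}"
  have "bij_betw ((!) vs) I T"
    unfolding bij_betw_def
  proof
    show "inj_on ((!) vs) I" using dv by (auto simp: I_def inj_on_def nth_eq_iff_index_eq)
    show "(!) vs ` I = T"
    proof
      show "T \<subseteq> (!) vs ` I"
      proof
        fix t assume t: "t \<in> T"
        then have "t \<in> set vs" using T(1) vs by blast
        then obtain i where "i < ?n" "vs ! i = t" by (auto simp: in_set_conv_nth)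
        then show "t \<in> (!) vs ` I" using t by (auto simp: I_def)
      qed
    qed (auto simp: I_def)
  qed
  then have cI: "card I = 4" using T(2) bij_betw_same_card by metis
  have fI: "finite I" by (simp add: I_def)
  let ?l = "sorted_list_of_set I"
  have "length ?l = 4" using cI by simp
  then obtain t0 t1 t2 t3 where l: "?l = [t0, t1, t2, t3]"
    by (auto simp: numeral_eq_Suc length_Suc_conv simp del: length_sorted_list_of_set sorted_list_of_set.length_sorted_key_list_of_set)
  have lt: "t0 < t1" "t1 < t2" "t2 < t3" using strict_sorted_list_of_set[of I] unfolding l by auto
  have "set ?l = I" using fI by simp
  then have tI: "t0 \<in> I" "t1 \<in> I" "t2 \<in> I" "t3 \<in> I" unfolding l by auto
  then have tn: "t0 < ?n" "t1 < ?n" "t2 < ?n" "t3 < ?n" and tT: "vs ! t0 \<in> T" "vs ! t1 \<in> T" "vs ! t2 \<in> T" "vs ! t3 \<in> T"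
    by (auto simp: I_def)
  \<comment> \<open>A connection with exactly one end in an arc must use an edge at one of the two
    border positions.\<close>
  have meets: "S {vs ! i, vs ! j} \<inter> A a \<noteq> {} \<or> S {vs ! i, vs ! j} \<inter> A b \<noteq> {}"
    if "i \<in> I" "j \<in> I" "a < b" "b < ?n" "(a < i \<and> i \<le> b) \<longleftrightarrow> \<not> (a < j \<and> j \<le> b)" for i j a b
  proof -
    have ij: "i < ?n" "j < ?n" "vs ! i \<in> T" "vs ! j \<in> T" using that by (auto simp: I_def)
    have "i \<noteq> j" using that(5) by auto
    then have ne: "vs ! i \<noteq> vs ! j" using ij dv by (simp add: nth_eq_iff_index_eq)
    note s = S[OF ij(3,4) ne] and s' = S[OF ij(4,3) ne[symmetric]]
    have "\<exists>e\<in>S {vs ! i, vs ! j}. e \<in> cutset G (arc a b)"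
    proof (cases "vs ! i \<in> arc a b")
      case True
      then have "vs ! j \<notin> arc a b" using that(5) arc_iff ij that(4) by blast
      then show ?thesis using rtrancl_adj_cutset[OF G _ _ True] s by blast
    next
      case False
      then have "vs ! j \<in> arc a b" using that(5) arc_iff ij that(4) by blast
      then show ?thesis using rtrancl_adj_cutset[OF G _ _ _ False] s' by (simp add: insert_commute) blast
    qed
    then show ?thesis using arc_cut[OF that(3,4)] by blast
  qed
  define t where "t k = [t0, t1, t2, t3] ! k" for k :: nat
  have t: "t 0 = t0" "t 1 = t1" "t 2 = t2" "t 3 = t3" by (simp_all add: t_def numeral_eq_Suc)
  \<comment> \<open>Positions of terminals are the borders of the arcs. The arc from
    \<open>t a\<close> to \<open>t b\<close> contains exactly the terminals numbered
    \<open>a + 1\<close> to \<open>b\<close>, which decides the pairs to which \<open>meets\<close>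
    applies.\<close>
  define x where "x i j k \<longleftrightarrow> S {vs ! i, vs ! j} \<inter> A (t k) \<noteq> {}" for i j k
  have m01:"x t0 t1 0 \<or> x t0 t1 1" "x t0 t1 0 \<or> x t0 t1 2" "x t0 t1 0 \<or> x t0 t1 3"
    unfolding x_def t One_nat_def[symmetric]
    by (rule meets; use tI lt tn in simp)+
  have m12:"x t1 t2 0 \<or> x t1 t2 1" "x t1 t2 1 \<or> x t1 t2 2" "x t1 t2 1 \<or> x t1 t2 3"
    unfolding x_def t One_nat_def[symmetric]
    by (rule meets; use tI lt tn in simp)+
  have m23:"x t2 t3 0 \<or> x t2 t3 2" "x t2 t3 1 \<or> x t2 t3 2" "x t2 t3 2 \<or> x t2 t3 3"
    unfolding x_def t One_nat_def[symmetric]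
    by (rule meets; use tI lt tn in simp)+
  have m03:"x t0 t3 0 \<or> x t0 t3 3" "x t0 t3 1 \<or> x t0 t3 3" "x t0 t3 2 \<or> x t0 t3 3"
    unfolding x_def t One_nat_def[symmetric]
    by (rule meets; use tI lt tn in simp)+
  have m02:"x t0 t2 0 \<or> x t0 t2 2" "x t0 t2 0 \<or> x t0 t2 3" "x t0 t2 1 \<or> x t0 t2 2" "x t0 t2 1 \<or> x t0 t2 3"
    unfolding x_def t One_nat_def[symmetric]
    by (rule meets; use tI lt tn in simp)+
  have m13:"x t1 t3 0 \<or> x t1 t3 1" "x t1 t3 0 \<or> x t1 t3 2" "x t1 t3 1 \<or> x t1 t3 3" "x t1 t3 2 \<or> x t1 t3 3"
    unfolding x_def t One_nat_def[symmetric]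
    by (rule meets; use tI lt tn in simp)+
  have "\<exists>k<4. of_bool (x t0 t1 k) + of_bool (x t1 t2 k) + of_bool (x t2 t3 k) + of_bool (x t0 t3 k)
    + of_bool (x t0 t2 k) + of_bool (x t1 t3 k) > (2 :: nat)"
  proof (rule four_arcs_overloaded)
    fix k :: nat
    show "k \<in> {1, 2, 3} \<Longrightarrow> x t0 t1 0 \<or> x t0 t1 k" using m01 by blast
    show "k \<in> {0, 2, 3} \<Longrightarrow> x t1 t2 1 \<or> x t1 t2 k" using m12 by blast
    show "k \<in> {0, 1, 3} \<Longrightarrow> x t2 t3 2 \<or> x t2 t3 k" using m23 by blast
    show "k \<in> {0, 1, 2} \<Longrightarrow> x t0 t3 3 \<or> x t0 t3 k" using m03 by blast
    fix j :: nat
    show "j \<in> {0, 1} \<Longrightarrow> k \<in> {2, 3} \<Longrightarrow> x t0 t2 j \<or> x t0 t2 k" using m02 by blast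
    show "j \<in> {1, 2} \<Longrightarrow> k \<in> {0, 3} \<Longrightarrow> x t1 t3 j \<or> x t1 t3 k" using m13 by blast
  qed
  then obtain k where k: "of_bool (x t0 t1 k) + of_bool (x t1 t2 k) + of_bool (x t2 t3 k) + of_bool (x t0 t3 k)
    + of_bool (x t0 t2 k) + of_bool (x t1 t3 k) > (2 :: nat)" by blast
  have ne: "vs ! t0 \<noteq> vs ! t1" "vs ! t0 \<noteq> vs ! t2" "vs ! t0 \<noteq> vs ! t3" "vs ! t1 \<noteq> vs ! t2" "vs ! t1 \<noteq> vs ! t3" "vs ! t2 \<noteq> vs ! t3"
    using lt tn dv by (simp_all add: nth_eq_iff_index_eq)
  define d where "d = [{vs ! t0, vs ! t1}, {vs ! t1, vs ! t2}, {vs ! t2, vs ! t3}, {vs ! t0, vs ! t3}, {vs ! t0, vs ! t2}, {vs ! t1, vs ! t3}]"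
  have dd: "distinct d" unfolding d_def using ne by (simp add: doubleton_eq_iff) 
  have "length (filter (\<lambda>p. S p \<inter> A (t k) \<noteq> {}) d) = of_bool (x t0 t1 k) + of_bool (x t1 t2 k) + of_bool (x t2 t3 k) + of_bool (x t0 t3 k)
    + of_bool (x t0 t2 k) + of_bool (x t1 t3 k)" by (simp add: d_def x_def)
  then have "2 < length (filter (\<lambda>p. S p \<inter> A (t k) \<noteq> {}) d)" using k by simp
  also have "\<dots> = card {p \<in> set d. S p \<inter> A (t k) \<noteq> {}}"
    using dd distinct_card[of "filter (\<lambda>p. S p \<inter> A (t k) \<noteq> {}) d"] by simp
  also have "\<dots> \<le> card (A (t k))"
  proof (rule card_disjoint_meets)
    show "finite (A (t k))" by (simp add: A_def)
    have "p \<subseteq> T \<and> card p = 2" if "p \<in> set d" for p using that tT ne by (auto simp: d_def)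
    then show "S p \<inter> S q = {}" if "p \<in> set d" "q \<in> set d" "p \<noteq> q" for p q using D that by blast
  qed simp
  also have "\<dots> \<le> 2" by (simp add: A_def card_insert_if)
  finally show False by simp
qed

text \<open>For connected graphs this describes the doubled cycles of length at least 3. Unlike a
  cyclic order, it is a condition on single vertices and pairs and can be checked outside a
  contracted set.\<close>

definition double_regular :: "('v, 'e) mgraph \<Rightarrow> bool" where
  "double_regular G \<longleftrightarrow> (\<forall>v\<in>vertices G. cut_degree G {v} = 4) \<and>
     (\<forall>v\<in>vertices G. \<forall>w\<in>vertices G. v \<noteq> w \<longrightarrow> joins G {v} {w} = 0 \<or> joins G {v} {w} = 2)"

lemma double_regularD:
  assumes "double_regular G" "v \<in> vertices G"
  shows "cut_degree G {v} = 4"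
    and "w \<in> vertices G \<Longrightarrow> v \<noteq> w \<Longrightarrow> joins G {v} {w} = 0 \<or> joins G {v} {w} = 2"
  using assms by (simp_all add: double_regular_def)

lemma joins_sum:
  assumes "multigraph G" "finite B" "A \<inter> B = {}"
  shows "joins G A B = (\<Sum>w\<in>B. joins G A {w})"
  using assms(2,3)
proof (induction B rule: finite_induct)
  case empty
  then show ?case by (simp add: joins_def cutset_def)
next
  case (insert w B)
  have "joins G A ({w} \<union> B) = joins G A {w} + joins G A B"
    using insert by (intro joins_un[OF assms(1)]) auto
  then show ?case using insert by simp
qed

lemma double_regular_neighbours:
  assumes G: "multigraph G" and d: "double_regular G" and v: "v \<in> vertices G"
  shows "card {w \<in> vertices G. w \<noteq> v \<and> joins G {v} {w} = 2} = 2"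
proof -
  let ?N = "{w \<in> vertices G. w \<noteq> v \<and> joins G {v} {w} = 2}"
  have fin: "finite (vertices G)" using finite_vertices[OF G] .
  have "4 = joins G {v} (vertices G - {v})"
    using d v joins_compl[OF G, of "{v}"] by (simp add: double_regular_def)
  also have "\<dots> = (\<Sum>w\<in>vertices G - {v}. joins G {v} {w})"
    using fin by (intro joins_sum[OF G]) auto
  also have "\<dots> = (\<Sum>w\<in>?N. joins G {v} {w})"
  proof (rule sum.mono_neutral_right)
    show "\<forall>w\<in>(vertices G - {v}) - ?N. joins G {v} {w} = 0"
    proof
      fix w assume w: "w \<in> (vertices G - {v}) - ?N"
      then have "w \<in> vertices G" "v \<noteq> w" by auto
      then have "joins G {v} {w} = 0 \<or> joins G {v} {w} = 2"
        using d v unfolding double_regular_def by simp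
      then show "joins G {v} {w} = 0" using w by blast
    qed
  qed (use fin in auto)
  also have "\<dots> = (\<Sum>w\<in>?N. 2)" by (rule sum.cong) auto
  finally show ?thesis by simp
qed

text \<open>Joining vertices that share two edges gives a simple 2-regular graph. A longest path in
  it closes up, because the last vertex can have no second neighbour outside the path or in its
  interior; connectivity makes the cycle spanning.\<close>

lemma double_regular_Hamilton:
  assumes G: "multigraph G" and c: "edge_connected 3 G" and n: "vertices G \<noteq> {}" and d: "double_regular G"
  obtains vs where "distinct vs" "set vs = vertices G" "3 \<le> length vs"
    "\<And>i. i < length vs \<Longrightarrow> joins G {vs ! i} {vs ! (Suc i mod length vs)} = 2"
    "\<And>e. e \<in> edges G \<Longrightarrow> \<exists>i<length vs. ends G e = {vs ! i, vs ! (Suc i mod length vs)}"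
proof -
  define N where "N v = {w \<in> vertices G. w \<noteq> v \<and> joins G {v} {w} = 2}" for v
  have N2: "card (N v) = 2" if "v \<in> vertices G" for v
    unfolding N_def using double_regular_neighbours[OF G d that] .
  have Nsym: "w \<in> N v \<longleftrightarrow> v \<in> N w" if "v \<in> vertices G" "w \<in> vertices G" for v w
    using that by (auto simp: N_def joins_commute)
  have Neq: "N v = {a, b}" if "v \<in> vertices G" "a \<in> N v" "b \<in> N v" "a \<noteq> b" for v a b
    using N2[OF that(1)] that(2-) by (auto simp: card_2_iff)
  define P where "P vs \<longleftrightarrow> distinct vs \<and> set vs \<subseteq> vertices G \<and> (\<forall>i. Suc i < length vs \<longrightarrow> vs ! Suc i \<in> N (vs ! i))" for vs
  have bound: "length vs \<le> card (vertices G)" if "P vs" for vs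
    using that distinct_card[of vs] card_mono[OF finite_vertices[OF G], of "set vs"] by (simp add: P_def)
  obtain v0 where v0: "v0 \<in> vertices G" using n by blast
  obtain a b where ab: "N v0 = {a, b}" "a \<noteq> b" using N2[OF v0] by (auto simp: card_2_iff)
  have abV: "a \<in> vertices G" "b \<in> vertices G" "a \<noteq> v0" "b \<noteq> v0" using ab by (auto simp: N_def)
  have "v0 \<in> N a" using Nsym[OF v0 abV(1)] ab by simp
  \<comment> \<open>This forces a longest path to have three vertices, so its last three positions
    are distinct.\<close>
  then have P3: "P [a, v0, b]" using v0 ab abV by (auto simp: P_def nth_Cons split: nat.splits)
  have "\<forall>ws. P ws \<longrightarrow> length ws < Suc (card (vertices G))" using bound by (simp add: less_Suc_eq_le)
  with P3 have "\<exists>vs. P vs \<and> (\<forall>ws. P ws \<longrightarrow> length ws \<le> length vs)"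
    by (rule ex_has_greatest_nat[of P _ length])
  then obtain vs where vs: "P vs" and max: "\<And>ws. P ws \<Longrightarrow> length ws \<le> length vs" by blast
  let ?n = "length vs"
  have n3: "3 \<le> ?n" using max[OF P3] by simp
  have dv: "distinct vs" and vsV: "set vs \<subseteq> vertices G" and st: "\<And>i. Suc i < ?n \<Longrightarrow> vs ! Suc i \<in> N (vs ! i)"
    using vs by (auto simp: P_def)
  have V: "vs ! i \<in> vertices G" if "i < ?n" for i using vsV that by auto
  have prev: "vs ! i \<in> N (vs ! Suc i)" if "Suc i < ?n" for i
    using st[OF that] Nsym V that by (meson Suc_lessD)
  have eq: "vs ! i = vs ! j \<longleftrightarrow> i = j" if "i < ?n" "j < ?n" for i j using dv that by (simp add: nth_eq_iff_index_eq)
  have inner: "N (vs ! Suc i) = {vs ! i, vs ! Suc (Suc i)}" if "Suc (Suc i) < ?n" for i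
    using that st[of "Suc i"] prev[of i] V eq by (intro Neq) auto
  define l where "l = ?n - 1"
  have l: "Suc l = ?n" "2 \<le> l" using n3 by (auto simp: l_def)
  \<comment> \<open>The other neighbour of the last vertex. Interior vertices already have both
    their neighbours on the path, so \<open>w\<close> can only be the first vertex.\<close>
  obtain w where w: "w \<in> N (vs ! l)" "w \<noteq> vs ! (l - 1)"
  proof -
    have "\<exists>w \<in> N (vs ! l). w \<noteq> vs ! (l - 1)"
    proof (rule ccontr)
      assume "\<not> ?thesis"
      then have "N (vs ! l) \<subseteq> {vs ! (l - 1)}" by blast
      then have "card (N (vs ! l)) \<le> 1" using card_mono[of "{vs ! (l - 1)}"] by simp
      then show False using N2[OF V, of l] l by simp
    qed
    then show ?thesis using that by blast
  qed
  have wV: "w \<in> vertices G" using w by (simp add: N_def)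
  have "w \<in> set vs"
  proof (rule ccontr)
    assume wn: "w \<notin> set vs"
    have "(vs @ [w]) ! Suc i \<in> N ((vs @ [w]) ! i)" if i: "Suc i < length (vs @ [w])" for i
    proof (cases "Suc i < ?n")
      case True
      then show ?thesis using st[OF True] by (simp add: nth_append)
    next
      case False
      then have "i = l" using i l by simp
      then show ?thesis using w(1) l by (simp add: nth_append)
    qed
    then have "P (vs @ [w])" using dv vsV wn wV by (simp add: P_def)
    then show False using max by fastforce
  qed
  then obtain j where j: "j < ?n" "vs ! j = w" by (auto simp: in_set_conv_nth)
  have "j \<noteq> l" using w(1) j by (auto simp: N_def)
  moreover have "j \<noteq> l - 1" using w(2) j by auto
  moreover have "j = 0"
  proof (rule ccontr)
    assume "j \<noteq> 0"
    then obtain i where i: "j = Suc i" using not0_implies_Suc by blast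
    have jl: "Suc (Suc i) < ?n" using i j(1) l \<open>j \<noteq> l\<close> by simp
    have "vs ! l \<in> N w" using Nsym[OF V[of l] wV] w(1) l by simp
    then have "vs ! l = vs ! i \<or> vs ! l = vs ! Suc (Suc i)" using inner[OF jl] j i by simp
    then have "l = i \<or> l = Suc (Suc i)" using eq[of l] jl l by auto
    then show False using i j(1) l \<open>j \<noteq> l - 1\<close> by auto
  qed
  ultimately have w0: "vs ! 0 \<in> N (vs ! l)" using w j by simp
  have cons: "vs ! (Suc i mod ?n) \<in> N (vs ! i)" if "i < ?n" for i
  proof (cases "Suc i < ?n")
    case True
    then show ?thesis using st by simp
  next
    case False
    then have "Suc i = ?n" using that by simp
    moreover from this have "i = l" using l by simp
    ultimately show ?thesis using w0 by simp
  qed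
  have Ncyc: "\<exists>j<?n. w = vs ! j \<and> (j = Suc i mod ?n \<or> i = Suc j mod ?n)" if i: "i < ?n" and w: "w \<in> N (vs ! i)" for i w
  proof -
    \<comment> \<open>The cyclic predecessor of \<open>i\<close>.\<close>
    define k where "k = (if i = 0 then l else i - 1)"
    have k: "k < ?n" "Suc k mod ?n = i" "Suc i mod ?n \<noteq> k"
      using i l by (auto simp: k_def mod_Suc)
    have "vs ! i \<in> N (vs ! k)" using cons[OF k(1)] k(2) by simp
    then have "vs ! k \<in> N (vs ! i)" using Nsym[OF V[OF i] V[OF k(1)]] by simp
    moreover have m: "Suc i mod ?n < ?n" using i by (intro mod_less_divisor) auto
    moreover have "vs ! (Suc i mod ?n) \<noteq> vs ! k" using eq[OF m k(1)] k(3) by simp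
    ultimately have "N (vs ! i) = {vs ! (Suc i mod ?n), vs ! k}" using cons[OF i] V[OF i] by (intro Neq) auto
    then show ?thesis using w k m by auto
  qed
  have edge_N: "\<exists>p q. ends G e = {p, q} \<and> p \<noteq> q \<and> p \<in> N q \<and> q \<in> N p" if e: "e \<in> edges G" for e
  proof -
    obtain p q where pq: "ends G e = {p, q}" "p \<noteq> q" "p \<in> vertices G" "q \<in> vertices G" by (rule edge_ends[OF G e])
    have "joins G {p} {q} > 0" using joins_pos[OF G pq(2)] e pq(1) by blast
    then have "joins G {p} {q} = 2" using double_regularD(2)[OF d pq(3,4,2)] by simp
    then have "q \<in> N p" "p \<in> N q" using pq(2-) by (auto simp: N_def joins_commute)
    then show ?thesis using pq(1,2) by blast
  qed
  \<comment> \<open>The vertices of the cycle are closed under adjacency, so no edge leaves them and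
    the cut would be empty.\<close>
  have setV: "set vs = vertices G"
  proof (rule ccontr)
    assume "set vs \<noteq> vertices G"
    moreover have "set vs \<noteq> {}" using n3 by auto
    ultimately have "3 \<le> cut_degree G (set vs)" using c vsV unfolding edge_connected_iff[OF G] by blast
    then have "cutset G (set vs) \<noteq> {}" by (auto simp: cut_degree_cutset)
    then obtain e where e: "e \<in> cutset G (set vs)" by blast
    obtain p q where pq: "ends G e = {p, q}" "p \<noteq> q" "p \<in> N q" "q \<in> N p" using edge_N[OF cutsetD[OF e]] by blast
    have "x \<in> set vs" if y: "y \<in> set vs" and x: "x \<in> N y" for x y
    proof -
      obtain i where i: "i < ?n" "vs ! i = y" using y unfolding in_set_conv_nth by blast
      then show ?thesis using Ncyc[OF i(1), of x] x by auto
    qed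
    moreover have "(p \<in> set vs) = (q \<notin> set vs)" using e cutset_iff[OF pq(1,2)] by blast
    ultimately show False using pq(3,4) by blast
  qed
  show ?thesis
  proof (rule that[OF dv setV n3])
    show "joins G {vs ! i} {vs ! (Suc i mod ?n)} = 2" if "i < ?n" for i
      using cons[OF that] by (simp add: N_def)
    show "\<exists>i<?n. ends G e = {vs ! i, vs ! (Suc i mod ?n)}" if e: "e \<in> edges G" for e
    proof -
      obtain p q where pq: "ends G e = {p, q}" "q \<in> N p" using edge_N[OF e] by blast
      have "p \<in> set vs" unfolding setV using e pq(1) G by (auto simp: multigraph_def)
      then obtain i where i: "i < ?n" "vs ! i = p" unfolding in_set_conv_nth by blast
      then obtain j where j: "j < ?n" "q = vs ! j" "j = Suc i mod ?n \<or> i = Suc j mod ?n"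
        using Ncyc[OF i(1), of q] pq(2) by auto
      from j(3) show ?thesis
      proof
        assume "j = Suc i mod ?n"
        then show ?thesis using pq(1) i j(2) by blast
      next
        assume "i = Suc j mod ?n"
        then have "ends G e = {vs ! j, vs ! (Suc j mod ?n)}" using pq(1) i(2) j(2) by (simp add: insert_commute)
        then show ?thesis using j(1) by blast
      qed
    qed
  qed
qed

lemma double_regular_doubled_cycle:
  assumes G: "multigraph G" and c: "edge_connected 3 G" and n: "vertices G \<noteq> {}" and d: "double_regular G"
  shows "doubled_cycle G"
proof -
  obtain vs where vs: "distinct vs" "set vs = vertices G" "3 \<le> length vs"
    and j2: "\<And>i. i < length vs \<Longrightarrow> joins G {vs ! i} {vs ! (Suc i mod length vs)} = 2"
    and cover: "\<And>e. e \<in> edges G \<Longrightarrow> \<exists>i<length vs. ends G e = {vs ! i, vs ! (Suc i mod length vs)}"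
    using double_regular_Hamilton[OF assms] by (metis (no_types, lifting))
  let ?n = "length vs"
  define E where "E i = {e \<in> edges G. ends G e = {vs ! i, vs ! (Suc i mod ?n)}}" for i
  have eq: "vs ! i = vs ! j \<longleftrightarrow> i = j" if "i < ?n" "j < ?n" for i j using vs(1) that by (simp add: nth_eq_iff_index_eq)
  have m: "Suc i mod ?n < ?n" for i using vs(3) by (intro mod_less_divisor) auto
  have "Suc i mod ?n \<noteq> i" if "i < ?n" for i using that vs(3) by (auto simp: mod_Suc)
  then have neq: "vs ! i \<noteq> vs ! (Suc i mod ?n)" if "i < ?n" for i using eq[OF that m] that by metis
  have cE: "card (E i) = 2" if "i < ?n" for i
    using j2[OF that] unfolding joins_def cutset_doubleton[OF G neq[OF that]] E_def .
  \<comment> \<open>Length at least 3 enters here: on a cycle of length 2 both positions would have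
    the same pair of ends.\<close>
  have E_inj: "i = j" if "i < ?n" "j < ?n" "e \<in> E i" "e' \<in> E j" "ends G e = ends G e'" for i j e e'
  proof -
    have "{vs ! i, vs ! (Suc i mod ?n)} = {vs ! j, vs ! (Suc j mod ?n)}" using that by (simp add: E_def)
    then have "i = j \<or> (i = Suc j mod ?n \<and> Suc i mod ?n = j)"
      using eq that(1,2) m by (auto simp: doubleton_eq_iff)
    then show ?thesis using that(1,2) vs(3) by (auto simp: mod_Suc split: if_splits)
  qed
  have "\<exists>e e'. E i = {e, e'} \<and> e \<noteq> e'" if "i < ?n" for i using cE[OF that] card_2_iff[of "E i"] by blast
  then obtain a b where ab: "\<And>i. i < ?n \<Longrightarrow> E i = {a i, b i} \<and> a i \<noteq> b i" by metis
  have abE: "a i \<in> E i" "b i \<in> E i" if "i < ?n" for i using ab[OF that] by auto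
  have abe: "a i \<in> edges G" "b i \<in> edges G" "ends G (a i) = {vs ! i, vs ! (Suc i mod ?n)}" "ends G (b i) = ends G (a i)"
    if "i < ?n" for i using abE[OF that] by (simp_all add: E_def)
  have a_inj: "i = j" if "i < ?n" "j < ?n" "a i = a j" for i j using E_inj[OF that(1,2) abE(1)[OF that(1)] abE(1)[OF that(2)]] that(3) by simp
  have b_inj: "i = j" if "i < ?n" "j < ?n" "b i = b j" for i j using E_inj[OF that(1,2) abE(2)[OF that(1)] abE(2)[OF that(2)]] that(3) by simp
  have a_b: "a i \<noteq> b j" if "i < ?n" "j < ?n" for i j
  proof
    assume e: "a i = b j"
    then have "i = j" using E_inj[OF that abE(1)[OF that(1)] abE(2)[OF that(2)]] by simp
    then show False using e ab that by auto
  qed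
  define C where "C = a ` {..<?n}"
  have inj_a: "inj_on a {..<?n}" using a_inj by (auto intro: inj_onI)
  define f where "f = b \<circ> inv_into {..<?n} a"
  have fa: "f (a i) = b i" if "i < ?n" for i using that inj_a by (simp add: f_def)
  have "bij_betw f C (edges G - C)"
    unfolding bij_betw_def
  proof
    show "inj_on f C"
    proof (rule inj_onI)
      fix c c' assume "c \<in> C" "c' \<in> C" "f c = f c'"
      moreover from this obtain i j where "i < ?n" "c = a i" "j < ?n" "c' = a j" by (auto simp: C_def)
      ultimately show "c = c'" using fa b_inj[of i j] by simp
    qed
    show "f ` C = edges G - C"
    proof
      show "f ` C \<subseteq> edges G - C"
      proof
        fix e assume "e \<in> f ` C"
        then obtain i where i: "i < ?n" "e = b i" using fa by (auto simp: C_def)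
        then show "e \<in> edges G - C" using abe(2) a_b[of _ i] by (auto simp: C_def) metis
      qed
      show "edges G - C \<subseteq> f ` C"
      proof
        fix e assume e: "e \<in> edges G - C"
        then obtain i where i: "i < ?n" "ends G e = {vs ! i, vs ! (Suc i mod ?n)}" using cover by blast
        then have "e \<in> E i" using e by (simp add: E_def)
        moreover have "e \<noteq> a i" using e i(1) by (auto simp: C_def)
        ultimately have "e = f (a i)" using ab[OF i(1)] fa[OF i(1)] by auto
        then show "e \<in> f ` C" using i(1) by (auto simp: C_def)
      qed
    qed
  qed
  moreover have "ends G (f e) = ends G e" if "e \<in> C" for e
    using that fa abe(4) by (auto simp: C_def)
  moreover have "is_cycle (G\<lparr>edges := C\<rparr>)"
    unfolding is_cycle_def
  proof (intro exI conjI allI impI)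
    show "2 \<le> length vs" using vs(3) by simp
    show "length (map a [0..<?n]) = length vs" by simp
    show "distinct vs" "set vs = vertices (G\<lparr>edges := C\<rparr>)" using vs by simp_all
    show "distinct (map a [0..<?n])" using inj_a by (simp add: distinct_map atLeast0LessThan)
    show "set (map a [0..<?n]) = edges (G\<lparr>edges := C\<rparr>)" by (simp add: C_def atLeast0LessThan)
    show "ends (G\<lparr>edges := C\<rparr>) (map a [0..<?n] ! i) = {vs ! i, vs ! (Suc i mod ?n)}" if "i < ?n" for i
      using that abe(3) by simp
  qed
  moreover have "C \<subseteq> edges G" using abe(1) by (auto simp: C_def)
  ultimately show ?thesis unfolding doubled_cycle_def by blast
qed

section \<open>Graphs on four vertices\<close>

text \<open>Multiplicities \<open>ab ac ad bc bd cd\<close> of a graph on four vertices that can be turned by splittings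
  into one in which all pairs are adjacent.\<close>
inductive splits_to_K4 :: "nat \<Rightarrow> nat \<Rightarrow> nat \<Rightarrow> nat \<Rightarrow> nat \<Rightarrow> nat \<Rightarrow> bool" where
  all_pos: "0 < ab \<Longrightarrow> 0 < ac \<Longrightarrow> 0 < ad \<Longrightarrow> 0 < bc \<Longrightarrow> 0 < bd \<Longrightarrow> 0 < cd \<Longrightarrow> splits_to_K4 ab ac ad bc bd cd"
| split_c_ab: "0 < ac \<Longrightarrow> 0 < bc \<Longrightarrow> splits_to_K4 (ab + 1) (ac - 1) ad (bc - 1) bd cd \<Longrightarrow> splits_to_K4 ab ac ad bc bd cd"
| swap_ab: "splits_to_K4 ab bc bd ac ad cd \<Longrightarrow> splits_to_K4 ab ac ad bc bd cd"
| swap_bc: "splits_to_K4 ac ab ad bc cd bd \<Longrightarrow> splits_to_K4 ab ac ad bc bd cd"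
| swap_cd: "splits_to_K4 ab ad ac bd bc cd \<Longrightarrow> splits_to_K4 ab ac ad bc bd cd"

text \<open>In these names \<open>split_v_pq\<close> splits at \<open>v\<close> and creates an edge
  \<open>pq\<close>. Each is \<open>split_c_ab\<close> conjugated by transpositions of
  vertices.\<close>

lemma split_d_ab: "0 < ad \<Longrightarrow> 0 < bd \<Longrightarrow> splits_to_K4 (ab + 1) ac (ad - 1) bc (bd - 1) cd \<Longrightarrow> splits_to_K4 ab ac ad bc bd cd"
  by (rule swap_cd, rule split_c_ab, assumption+, rule swap_cd)
lemma split_d_ac: "0 < ad \<Longrightarrow> 0 < cd \<Longrightarrow> splits_to_K4 ab (ac + 1) (ad - 1) bc bd (cd - 1) \<Longrightarrow> splits_to_K4 ab ac ad bc bd cd"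
  by (rule swap_bc, rule split_d_ab, assumption+, rule swap_bc)
lemma split_b_ac: "0 < ab \<Longrightarrow> 0 < bc \<Longrightarrow> splits_to_K4 (ab - 1) (ac + 1) ad (bc - 1) bd cd \<Longrightarrow> splits_to_K4 ab ac ad bc bd cd"
  by (rule swap_bc, rule split_c_ab, assumption+, rule swap_bc)
lemma split_d_bc: "0 < bd \<Longrightarrow> 0 < cd \<Longrightarrow> splits_to_K4 ab ac ad (bc + 1) (bd - 1) (cd - 1) \<Longrightarrow> splits_to_K4 ab ac ad bc bd cd"
  by (rule swap_ab, rule split_d_ac, assumption+, rule swap_ab)
lemma split_c_ad: "0 < ac \<Longrightarrow> 0 < cd \<Longrightarrow> splits_to_K4 ab (ac - 1) (ad + 1) bc bd (cd - 1) \<Longrightarrow> splits_to_K4 ab ac ad bc bd cd"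
  by (rule swap_cd, rule split_d_ac, assumption+, rule swap_cd)
lemma split_c_bd: "0 < bc \<Longrightarrow> 0 < cd \<Longrightarrow> splits_to_K4 ab ac ad (bc - 1) (bd + 1) (cd - 1) \<Longrightarrow> splits_to_K4 ab ac ad bc bd cd"
  by (rule swap_ab, rule split_c_ad, assumption+, rule swap_ab)
lemma split_b_cd: "0 < bc \<Longrightarrow> 0 < bd \<Longrightarrow> splits_to_K4 ab ac ad (bc - 1) (bd - 1) (cd + 1) \<Longrightarrow> splits_to_K4 ab ac ad bc bd cd"
  by (rule swap_bc, rule split_c_bd, assumption+, rule swap_bc)

text \<open>Here \<open>d\<close> is the only neighbour of \<open>a\<close>. The first bound is the
  degree of \<open>a\<close>, the second the cut around \<open>{a, d}\<close>, the next two the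
  degrees of \<open>c\<close> and \<open>b\<close>. New edges at \<open>a\<close> are created
  through \<open>d\<close>, and where \<open>bd\<close> or \<open>cd\<close> is scarce through
  \<open>c\<close> or \<open>b\<close> as well.\<close>

lemma splits_two_nonadjacent:
  assumes "ad \<ge> 3" "bd + cd \<ge> 4" "bc + cd \<ge> 3" "bc + bd \<ge> 3" "cd \<ge> 1"
  shows "splits_to_K4 0 0 ad bc bd cd"
proof -
  consider "bd \<ge> 2" "cd \<ge> 2" "bc \<ge> 1" | "bc = 0" | "bd = 1" "bc \<ge> 1" | "bd = 0" | "cd = 1" "bc \<ge> 1"
    using assms by linarith
  then show ?thesis
  proof cases
    case 1
    show ?thesis
      by (rule split_d_ab, use 1 assms in simp, use 1 assms in simp,
          rule split_d_ac, use 1 assms in simp, use 1 assms in simp, rule all_pos; use 1 assms in simp)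
  next
    case 2
    show ?thesis
      by (rule split_d_ab, use 2 assms in simp, use 2 assms in simp,
          rule split_d_ac, use 2 assms in simp, use 2 assms in simp,
          rule split_d_bc, use 2 assms in simp, use 2 assms in simp, rule all_pos; use 2 assms in simp)
  next
    case 3
    show ?thesis
      by (rule split_d_ac, use 3 assms in simp, use 3 assms in simp,
          rule split_d_ac, use 3 assms in simp, use 3 assms in simp,
          rule split_c_ab, use 3 assms in simp, use 3 assms in simp, rule all_pos; use 3 assms in simp)
  next
    case 4
    show ?thesis
      by (rule split_d_ac, use 4 assms in simp, use 4 assms in simp,
          rule split_d_ac, use 4 assms in simp, use 4 assms in simp,
          rule split_c_ab, use 4 assms in simp, use 4 assms in simp,
          rule split_c_bd, use 4 assms in simp, use 4 assms in simp, rule all_pos; use 4 assms in simp)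
  next
    case 5
    show ?thesis
      by (rule split_d_ab, use 5 assms in simp, use 5 assms in simp,
          rule split_d_ab, use 5 assms in simp, use 5 assms in simp,
          rule split_b_ac, use 5 assms in simp, use 5 assms in simp, rule all_pos; use 5 assms in simp)
  qed
qed

lemma splits_heavy_edge:
  assumes "bd \<ge> 3" "ad \<ge> 2" "bc \<ge> 2" "ac \<ge> 1"
  shows "splits_to_K4 0 ac ad bc bd 0"
  by (rule split_d_ab, use assms in simp, use assms in simp,
      rule split_b_cd, use assms in simp, use assms in simp, rule all_pos; use assms in simp)

text \<open>The graph is a thick path \<open>a d b c\<close>. The four splittings use up two copies
  of \<open>ad\<close>, three of \<open>bd\<close> and two of \<open>bc\<close>, so the bounds leave
  one of each.\<close>

lemma splits_path:
  assumes "bd \<ge> 4" "ad \<ge> 3" "bc \<ge> 3"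
  shows "splits_to_K4 0 0 ad bc bd 0"
  by (rule split_d_ab, use assms in simp, use assms in simp,
      rule split_d_ab, use assms in simp, use assms in simp,
      rule split_b_ac, use assms in simp, use assms in simp,
      rule split_b_cd, use assms in simp, use assms in simp, rule all_pos; use assms in simp)

text \<open>With \<open>a\<close> and \<open>b\<close> nonadjacent, the assumptions are the four
  degree bounds and the cuts around \<open>{a, c}\<close> and \<open>{a, d}\<close>; the cut around
  \<open>{a, b}\<close> is large by the degrees. The exception is the doubled cycle
  \<open>a c b d\<close>.\<close>

lemma splits_nonadjacent:
  assumes "ac + ad \<ge> 3" "bc + bd \<ge> 3" "ac + bc + cd \<ge> 3" "ad + bd + cd \<ge> 3"
    and "ad + bc + cd \<ge> 4" "ac + bd + cd \<ge> 4"
  shows "splits_to_K4 0 ac ad bc bd cd \<or> (ac = 2 \<and> ad = 2 \<and> bc = 2 \<and> bd = 2 \<and> cd = 0)"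
proof (cases "cd = 0")
  case True
  show ?thesis
  proof (cases "ac = 2 \<and> ad = 2 \<and> bc = 2 \<and> bd = 2")
    case False
    \<comment> \<open>All edges lie on the cycle \<open>a c b d\<close>. A missing side leaves a
      thick path. A side of multiplicity 1 makes the opposite one at least 3; if all are at least 2,
      some side is at least 3 because the doubled cycle is excluded.\<close>
    consider "ac = 0" | "ad = 0" | "bc = 0" | "bd = 0"
      | "bd \<ge> 3" "ad \<ge> 2" "bc \<ge> 2" "ac \<ge> 1" | "bc \<ge> 3" "ac \<ge> 2" "bd \<ge> 2" "ad \<ge> 1"
      | "ad \<ge> 3" "bd \<ge> 2" "ac \<ge> 2" "bc \<ge> 1" | "ac \<ge> 3" "bc \<ge> 2" "ad \<ge> 2" "bd \<ge> 1"
    proof -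
      have "ac \<ge> 1 \<Longrightarrow> ad \<ge> 1 \<Longrightarrow> bc \<ge> 1 \<Longrightarrow> bd \<ge> 1 \<Longrightarrow> thesis"
      proof -
        assume pos: "ac \<ge> 1" "ad \<ge> 1" "bc \<ge> 1" "bd \<ge> 1"
        consider "ac = 1" | "ad = 1" | "bc = 1" | "bd = 1" | "ac \<ge> 2" "ad \<ge> 2" "bc \<ge> 2" "bd \<ge> 2"
          using pos by force
        then show thesis
        proof cases
          case 1
          then show thesis using assms True by (intro that(5)) linarith+
        next
          case 2
          then show thesis using assms True by (intro that(6)) linarith+
        next
          case 3
          then show thesis using assms True by (intro that(7)) linarith+
        next
          case 4
          then show thesis using assms True by (intro that(8)) linarith+
        next
          case 5
          then consider "ac \<ge> 3" | "ad \<ge> 3" | "bc \<ge> 3" | "bd \<ge> 3" using False by force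
          then show thesis
          proof cases
            case 1
            then show thesis using 5 by (intro that(8)) linarith+
          next
            case 2
            then show thesis using 5 by (intro that(7)) linarith+
          next
            case 3
            then show thesis using 5 by (intro that(6)) linarith+
          next
            case 4
            then show thesis using 5 by (intro that(5)) linarith+
          qed
        qed
      qed
      then show thesis using that(1-4) by force
    qed
    then have "splits_to_K4 0 ac ad bc bd 0"
    proof cases
      case 1
      then show ?thesis using True assms by (simp add: splits_path)
    next
      case 2
      then show ?thesis using True assms by (intro swap_cd[of 0 ad]) (simp add: splits_path)
    next
      case 3
      then show ?thesis using True assms by (intro swap_ab[of 0 bc]) (simp add: splits_path)
    next
      case 4
      then show ?thesis using True assms by (intro swap_ab[of 0 bc] swap_cd[of 0 bd]) (simp add: splits_path)
    next
      case 5
      then show ?thesis by (rule splits_heavy_edge)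
    next
      case 6
      then show ?thesis by (intro swap_cd[of 0 ad] splits_heavy_edge)
    next
      case 7
      then show ?thesis by (intro swap_ab[of 0 bc] splits_heavy_edge)
    next
      case 8
      then show ?thesis by (intro swap_ab[of 0 bc] swap_cd[of 0 bd] splits_heavy_edge)
    qed
    then show ?thesis using True by simp
  qed (use True in simp)
next
  case False
  have "splits_to_K4 0 ac ad bc bd cd"
  proof -
    consider "ac = 0" | "ad = 0" | "bc = 0" | "bd = 0"
      | "ac \<ge> 2" "bc \<ge> 2" "ad \<ge> 1" "bd \<ge> 1" | "ad \<ge> 2" "bd \<ge> 2" "ac \<ge> 1" "bc \<ge> 1"
      | "ad \<ge> 2" "cd \<ge> 2" "bc \<ge> 2" "ac \<ge> 1" "bd \<ge> 1" | "ac \<ge> 2" "cd \<ge> 2" "bd \<ge> 2" "ad \<ge> 1" "bc \<ge> 1"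
    proof -
      have "ac \<ge> 1 \<Longrightarrow> ad \<ge> 1 \<Longrightarrow> bc \<ge> 1 \<Longrightarrow> bd \<ge> 1 \<Longrightarrow> thesis"
      proof -
        assume pos: "ac \<ge> 1" "ad \<ge> 1" "bc \<ge> 1" "bd \<ge> 1"
        consider "ac = 1" "bd = 1" | "ac = 1" "ad = 1" | "bc = 1" "ad = 1" | "bc = 1" "bd = 1"
          | "ac \<ge> 2" "bc \<ge> 2" | "ad \<ge> 2" "bd \<ge> 2"
          using pos by force
        then show thesis
        proof cases
          case 1
          then show thesis using assms pos by (intro that(7)) linarith+
        next
          case 2
          then show thesis using assms by linarith
        next
          case 3
          then show thesis using assms pos by (intro that(8)) linarith+
        next
          case 4
          then show thesis using assms by linarith
        next
          case 5
          then show thesis using pos by (intro that(5))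
        next
          case 6
          then show thesis using pos by (intro that(6))
        qed
      qed
      then show thesis using that(1-4) by force
    qed
    then show ?thesis
    proof cases
      case 1
      then show ?thesis using False assms by (simp add: splits_two_nonadjacent)
    next
      case 2
      then show ?thesis using False assms by (intro swap_cd[of 0 ad]) (simp add: splits_two_nonadjacent)
    next
      case 3
      then show ?thesis using False assms by (intro swap_ab[of 0 bc]) (simp add: splits_two_nonadjacent)
    next
      case 4
      then show ?thesis using False assms by (intro swap_ab[of 0 bc] swap_cd[of 0 bd]) (simp add: splits_two_nonadjacent)
    next
      case 5
      show ?thesis by (rule split_c_ab, use 5 in simp, use 5 in simp, rule all_pos; use 5 False in simp)
    next
      case 6
      show ?thesis by (rule split_d_ab, use 6 in simp, use 6 in simp, rule all_pos; use 6 False in simp)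
    next
      case 7
      show ?thesis
        by (rule split_d_ac, use 7 in simp, use 7 in simp, rule split_c_ab, use 7 in simp, use 7 in simp,
            rule all_pos; use 7 in simp)
    next
      case 8
      show ?thesis
        by (rule split_c_ad, use 8 in simp, use 8 in simp, rule split_d_ab, use 8 in simp, use 8 in simp,
            rule all_pos; use 8 in simp)
    qed
  qed
  then show ?thesis ..
qed

section \<open>Realizing splittings in a multigraph\<close>

lemma K4_on_all_adjacent:
  assumes G: "multigraph G" and c: "card (vertices G) = 4"
    and adj: "\<And>p q. p \<in> vertices G \<Longrightarrow> q \<in> vertices G \<Longrightarrow> p \<noteq> q \<Longrightarrow> 0 < joins G {p} {q}"
  shows "K4_on G (vertices G)"
  unfolding K4_on_def
proof (intro conjI exI ballI impI allI)
  let ?S = "\<lambda>d. {e \<in> edges G. ends G e = d}"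
  fix p q assume pq: "p \<in> vertices G" "q \<in> vertices G" "p \<noteq> q"
  show "?S {p, q} \<subseteq> edges G" by blast
  obtain e where "e \<in> edges G" "ends G e = {p, q}" using adj[OF pq] joins_pos[OF G pq(3)] by blast
  then have "(p, q) \<in> adj G (?S {p, q})" unfolding adj_def by blast
  then show "(p, q) \<in> (adj G (?S {p, q}))\<^sup>*" by (rule r_into_rtrancl)
next
  fix d d' assume "d \<subseteq> vertices G \<and> card d = 2 \<and> d' \<subseteq> vertices G \<and> card d' = 2 \<and> d \<noteq> d'"
  then show "{e \<in> edges G. ends G e = d} \<inter> {e \<in> edges G. ends G e = d'} = {}" by blast
qed (use c in auto)

lemma joins_card:
  "multigraph G \<Longrightarrow> p \<noteq> q \<Longrightarrow> joins G {p} {q} = card {e \<in> edges G. ends G e = {p, q}}"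
  by (simp add: joins_def cutset_doubleton)

lemma split_off:
  fixes G :: "('v, 'e) mgraph"
  assumes G: "multigraph G" and ne: "a \<noteq> b" "a \<noteq> c" "b \<noteq> c"
    and pos: "0 < joins G {a} {c}" "0 < joins G {b} {c}"
  obtains G' :: "('v, 'e) mgraph" where "multigraph G'" "vertices G' = vertices G" "\<And>T. K4_on G' T \<Longrightarrow> K4_on G T"
    "joins G' {a} {b} = joins G {a} {b} + 1"
    "joins G' {a} {c} = joins G {a} {c} - 1" "joins G' {b} {c} = joins G {b} {c} - 1"
    "\<And>p q. p \<noteq> q \<Longrightarrow> {p, q} \<noteq> {a, b} \<Longrightarrow> {p, q} \<noteq> {a, c} \<Longrightarrow> {p, q} \<noteq> {b, c} \<Longrightarrow> joins G' {p} {q} = joins G {p} {q}"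
proof -
  obtain f where f: "f \<in> edges G" "ends G f = {a, c}" using pos(1) joins_pos[OF G ne(2)] by blast
  obtain g where g: "g \<in> edges G" "ends G g = {b, c}" using pos(2) joins_pos[OF G ne(3)] by blast
  have V: "a \<in> vertices G" "b \<in> vertices G" using f g G by (auto simp: multigraph_def)
  have acb: "{a, c} \<noteq> {b, c}" "{a, b} \<noteq> {a, c}" "{a, b} \<noteq> {b, c}" using ne by (auto simp: doubleton_eq_iff)
  have fg: "f \<noteq> g" using f(2) g(2) acb by auto
  \<comment> \<open>The edge \<open>f\<close> is rerouted to serve as the new edge, so no fresh edge
    name has to exist in the type.\<close>
  define G' where "G' = \<lparr>vertices = vertices G, edges = edges G - {g}, ends = (ends G)(f := {a, b})\<rparr>"
  have sel: "vertices G' = vertices G" "edges G' = edges G - {g}" "ends G' e = (if e = f then {a, b} else ends G e)" for e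
    by (simp_all add: G'_def)
  have G': "multigraph G'" using G V ne(1) unfolding multigraph_def sel by simp
  define M where "M d = {e \<in> edges G. ends G e = d}" for d
  have fin: "finite (M d)" for d using finite_edges[OF G] by (simp add: M_def)
  have fM: "f \<in> M {a, c}" "g \<in> M {b, c}" "f \<notin> M {a, b}" using f g acb by (simp_all add: M_def)
  have jG: "joins G {p} {q} = card (M {p, q})" if "p \<noteq> q" for p q using joins_card[OF G that] by (simp add: M_def)
  have jG': "joins G' {p} {q} = card {e \<in> edges G - {g}. (if e = f then {a, b} else ends G e) = {p, q}}" if "p \<noteq> q" for p q
    using joins_card[OF G' that] by (simp add: sel)
  have 1: "{e \<in> edges G - {g}. (if e = f then {a, b} else ends G e) = {a, b}} = insert f (M {a, b})"
    using f g acb fg by (auto simp: M_def)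
  have 2: "{e \<in> edges G - {g}. (if e = f then {a, b} else ends G e) = {a, c}} = M {a, c} - {f}"
    using f g acb fg by (auto simp: M_def)
  have 3: "{e \<in> edges G - {g}. (if e = f then {a, b} else ends G e) = {b, c}} = M {b, c} - {g}"
    using f g acb fg by (auto simp: M_def)
  have 4: "{e \<in> edges G - {g}. (if e = f then {a, b} else ends G e) = d} = M d"
    if d: "d \<noteq> {a, b}" "d \<noteq> {a, c}" "d \<noteq> {b, c}" for d
  proof (rule set_eqI)
    fix e
    show "e \<in> {e \<in> edges G - {g}. (if e = f then {a, b} else ends G e) = d} \<longleftrightarrow> e \<in> M d"
      using f(2) g(2) d by (cases "e = f"; cases "e = g") (auto simp: M_def)
  qed
  show ?thesis
  proof (rule that[OF G' sel(1)])
    show "K4_on G T" if K: "K4_on G' T" for T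
    proof (rule K4_on_transfer[OF K, where R = "\<lambda>e. if e = f then {f, g} else {e}"])
      fix e p q assume e: "e \<in> edges G'" "ends G' e = {p, q}"
      show "(p, q) \<in> (adj G (if e = f then {f, g} else {e}))\<^sup>*"
      proof (cases "e = f")
        case True
        have ac: "(a, c) \<in> adj G {f, g}" "(c, b) \<in> adj G {f, g}" "(b, c) \<in> adj G {f, g}" "(c, a) \<in> adj G {f, g}"
          using f g by (auto simp: adj_def insert_commute)
        have "(a, b) \<in> (adj G {f, g})\<^sup>*" "(b, a) \<in> (adj G {f, g})\<^sup>*"
          using ac by (meson converse_rtrancl_into_rtrancl r_into_rtrancl)+
        moreover have "p = a \<and> q = b \<or> p = b \<and> q = a" using e(2) True by (auto simp: sel doubleton_eq_iff)
        ultimately show ?thesis using True by auto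
      next
        case False
        then have "(p, q) \<in> adj G {e}" using e(2) by (simp add: adj_def sel)
        then show ?thesis using False by auto
      qed
    qed (use f g in \<open>auto simp: sel split: if_splits\<close>)
    show "joins G' {a} {b} = joins G {a} {b} + 1"
      unfolding jG'[OF ne(1)] jG[OF ne(1)] 1 using fin fM by simp
    show "joins G' {a} {c} = joins G {a} {c} - 1"
      unfolding jG'[OF ne(2)] jG[OF ne(2)] 2 using fin fM by simp
    show "joins G' {b} {c} = joins G {b} {c} - 1"
      unfolding jG'[OF ne(3)] jG[OF ne(3)] 3 using fin fM by simp
    show "joins G' {p} {q} = joins G {p} {q}" if "p \<noteq> q" "{p, q} \<noteq> {a, b}" "{p, q} \<noteq> {a, c}" "{p, q} \<noteq> {b, c}" for p q
      unfolding jG'[OF that(1)] jG[OF that(1)] 4[OF that(2-4)] ..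
  qed
qed

lemma splits_to_K4_sound:
  fixes G :: "('v, 'e) mgraph"
  assumes "splits_to_K4 ab ac ad bc bd cd"
    and "multigraph G" "vertices G = {a, b, c, d}" "distinct [a, b, c, d]"
    and "joins G {a} {b} = ab" "joins G {a} {c} = ac" "joins G {a} {d} = ad"
      "joins G {b} {c} = bc" "joins G {b} {d} = bd" "joins G {c} {d} = cd"
  shows "K4_on G {a, b, c, d}"
  using assms
proof (induction arbitrary: G a b c d rule: splits_to_K4.induct)
  case (all_pos ab ac ad bc bd cd)
  have "K4_on G (vertices G)"
    by (rule K4_on_all_adjacent) (use all_pos in \<open>auto simp: joins_commute\<close>)
  then show ?case using all_pos by simp
next
  case (split_c_ab ac bc ab ad bd cd)
  note p = split_c_ab.prems
  have ne: "a \<noteq> b" "a \<noteq> c" "b \<noteq> c" "a \<noteq> d" "b \<noteq> d" "c \<noteq> d" using p(3) by auto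
  have pos: "0 < joins G {a} {c}" "0 < joins G {b} {c}" using p split_c_ab.hyps by auto
  obtain G' :: "('v, 'e) mgraph" where G': "multigraph G'" "vertices G' = vertices G" "\<And>T. K4_on G' T \<Longrightarrow> K4_on G T"
    "joins G' {a} {b} = joins G {a} {b} + 1"
    "joins G' {a} {c} = joins G {a} {c} - 1" "joins G' {b} {c} = joins G {b} {c} - 1"
    "\<And>p q. p \<noteq> q \<Longrightarrow> {p, q} \<noteq> {a, b} \<Longrightarrow> {p, q} \<noteq> {a, c} \<Longrightarrow> {p, q} \<noteq> {b, c} \<Longrightarrow> joins G' {p} {q} = joins G {p} {q}"
    using split_off[OF p(1) ne(1-3) pos] by blast
  have "K4_on G' {a, b, c, d}"
    by (rule split_c_ab.IH[OF G'(1)]) (use G' p ne in \<open>auto simp: doubleton_eq_iff\<close>)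
  then show ?case by (rule G'(3))
next
  case (swap_ab ab bc bd ac ad cd)
  have "K4_on G {b, a, c, d}"
    by (rule swap_ab.IH[OF swap_ab.prems(1)]) (use swap_ab.prems in \<open>auto simp: joins_commute\<close>)
  then show ?case by (simp add: insert_commute)
next
  case (swap_bc ac ab ad bc cd bd)
  have "K4_on G {a, c, b, d}"
    by (rule swap_bc.IH[OF swap_bc.prems(1)]) (use swap_bc.prems in \<open>auto simp: joins_commute\<close>)
  then show ?case by (simp add: insert_commute)
next
  case (swap_cd ab ad ac bd bc cd)
  have "K4_on G {a, b, d, c}"
    by (rule swap_cd.IH[OF swap_cd.prems(1)]) (use swap_cd.prems in \<open>auto simp: joins_commute\<close>)
  then show ?case by (simp add: insert_commute)
qed

lemma four_vertices_nonadjacent: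
  assumes G: "multigraph G" and V: "vertices G = {a, b, c, d}" and dist: "distinct [a, b, c, d]"
    and deg: "\<And>v. v \<in> vertices G \<Longrightarrow> 3 \<le> cut_degree G {v}"
    and cut: "\<And>v w. v \<in> vertices G \<Longrightarrow> w \<in> vertices G \<Longrightarrow> v \<noteq> w \<Longrightarrow> 4 \<le> cut_degree G {v, w}"
    and ab: "joins G {a} {b} = 0"
  shows "K4_on G (vertices G) \<or> double_regular G"
proof -
  have ne: "a \<noteq> b" "a \<noteq> c" "b \<noteq> c" "a \<noteq> d" "b \<noteq> d" "c \<noteq> d" using dist by auto
  let ?j = "\<lambda>p q. joins G {p} {q}"
  have deg_sum: "cut_degree G {v} = ?j v w1 + ?j v w2 + ?j v w3"
    if "vertices G - {v} = {w1, w2, w3}" "distinct [w1, w2, w3]" for v w1 w2 w3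
  proof -
    have "cut_degree G {v} = joins G {v} {w1, w2, w3}" using joins_compl[OF G, of "{v}"] that(1) by simp
    also have "\<dots> = (\<Sum>w\<in>{w1, w2, w3}. ?j v w)" using that(1) by (intro joins_sum[OF G]) auto
    finally show ?thesis using that(2) by simp
  qed
  have da: "cut_degree G {a} = ?j a b + ?j a c + ?j a d" by (rule deg_sum) (use V ne in auto)
  have "cut_degree G {b} = ?j b a + ?j b c + ?j b d" by (rule deg_sum) (use V ne in auto)
  then have db: "cut_degree G {b} = ?j a b + ?j b c + ?j b d" by (simp add: joins_commute)
  have "cut_degree G {c} = ?j c a + ?j c b + ?j c d" by (rule deg_sum) (use V ne in auto)
  then have dc: "cut_degree G {c} = ?j a c + ?j b c + ?j c d" by (simp add: joins_commute)
  have "cut_degree G {d} = ?j d a + ?j d b + ?j d c" by (rule deg_sum) (use V ne in auto)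
  then have dd: "cut_degree G {d} = ?j a d + ?j b d + ?j c d" by (simp add: joins_commute)
  have deg': "3 \<le> cut_degree G {a}" "3 \<le> cut_degree G {b}" "3 \<le> cut_degree G {c}" "3 \<le> cut_degree G {d}"
    using deg V by auto
  have "4 \<le> cut_degree G {a, c}" "4 \<le> cut_degree G {a, d}" using cut V ne by auto
  then have "4 \<le> ?j a d + ?j b c + ?j c d" "4 \<le> ?j a c + ?j b d + ?j c d"
    using cut_degree_pair[OF G ne(2)] cut_degree_pair[OF G ne(4)] da dc dd ab by linarith+
  then have "splits_to_K4 0 (?j a c) (?j a d) (?j b c) (?j b d) (?j c d)
      \<or> (?j a c = 2 \<and> ?j a d = 2 \<and> ?j b c = 2 \<and> ?j b d = 2 \<and> ?j c d = 0)"
    using deg' da db dc dd ab by (intro splits_nonadjacent) simp_all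
  then show ?thesis
  proof
    assume "splits_to_K4 0 (?j a c) (?j a d) (?j b c) (?j b d) (?j c d)"
    from splits_to_K4_sound[OF this G V dist ab] show ?thesis using V by simp
  next
    assume j: "?j a c = 2 \<and> ?j a d = 2 \<and> ?j b c = 2 \<and> ?j b d = 2 \<and> ?j c d = 0"
    have deg4: "\<forall>v\<in>vertices G. cut_degree G {v} = 4" unfolding V using da db dc dd ab j by simp
    have j': "?j c a = 2" "?j d a = 2" "?j c b = 2" "?j d b = 2" "?j d c = 0" "?j b a = 0"
      using j ab by (simp_all add: joins_commute)
    have "double_regular G"
      unfolding double_regular_def V using deg4[unfolded V] j j' ab by simp
    then show ?thesis ..
  qed
qed

lemma four_vertices:
  assumes G: "multigraph G" and V: "card (vertices G) = 4"
    and deg: "\<And>v. v \<in> vertices G \<Longrightarrow> 3 \<le> cut_degree G {v}"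
    and cut: "\<And>v w. v \<in> vertices G \<Longrightarrow> w \<in> vertices G \<Longrightarrow> v \<noteq> w \<Longrightarrow> 4 \<le> cut_degree G {v, w}"
  shows "K4_on G (vertices G) \<or> double_regular G"
proof (cases "\<forall>p\<in>vertices G. \<forall>q\<in>vertices G. p \<noteq> q \<longrightarrow> 0 < joins G {p} {q}")
  case True
  then show ?thesis using K4_on_all_adjacent[OF G V] by blast
next
  case False
  then obtain a b where ab: "a \<in> vertices G" "b \<in> vertices G" "a \<noteq> b" "joins G {a} {b} = 0" by auto
  have "card (vertices G - {a, b}) = 2" using V ab finite_vertices[OF G] by (simp add: card_Diff_subset)
  then obtain c d where cd: "vertices G - {a, b} = {c, d}" "c \<noteq> d" unfolding card_2_iff by blast
  have "vertices G = {a, b} \<union> (vertices G - {a, b})" using ab(1,2) by auto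
  then have V': "vertices G = {a, b, c, d}" unfolding cd(1) by auto
  have "c \<in> vertices G - {a, b}" "d \<in> vertices G - {a, b}" unfolding cd(1) by auto
  then have "distinct [a, b, c, d]" using ab(3) cd(2) by auto
  then show ?thesis using four_vertices_nonadjacent[OF G V' _ deg cut ab(4)] by blast
qed

section \<open>Contraction in a minimal counterexample\<close>

definition K4_at :: "('v, 'e) mgraph \<Rightarrow> 'v \<Rightarrow> bool" where
  "K4_at G x \<longleftrightarrow> (\<exists>T. K4_on G T \<and> x \<in> T)"

text \<open>Together with 3-edge-connectivity: 3-cuts occur only around single vertices.\<close>

definition nontrivial_cuts_ge4 :: "('v, 'e) mgraph \<Rightarrow> bool" where
  "nontrivial_cuts_ge4 G \<longleftrightarrow>
     (\<forall>X\<subseteq>vertices G. 2 \<le> card X \<and> 2 \<le> card (vertices G - X) \<longrightarrow> 4 \<le> cut_degree G X)"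

text \<open>A vertex added between two 3-cuts satisfies 3 + 2j = d + 3 and so has even degree. A
  vertex of degree 3 is therefore present from the start or never added.\<close>

lemma chain_odd:
  assumes G: "multigraph G" and a: "cut_degree G {a} = 3"
  shows "chain G A B \<Longrightarrow> a \<in> B \<Longrightarrow> a \<in> A"
proof (induction rule: chain.induct)
  case (chain_step A B v)
  have "a \<noteq> v"
  proof
    assume "a = v"
    have "cut_degree G ({v} \<union> B) + 2 * joins G {v} B = cut_degree G {v} + cut_degree G B"
      using chain_step by (intro cut_degree_un[OF G]) auto
    moreover have "cut_degree G B = 3" using chain_ends[OF chain_step(1)] by blast
    ultimately have "3 + 2 * joins G {v} B = 6" using chain_step a \<open>a = v\<close> by simp
    then show False by presburger
  qed
  then show ?case using chain_step by simp
qed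

text \<open>By \<open>chain_odd\<close> the vertex lies in the first set or outside the last one;
  reversal reduces the latter to the former. If the first set has a second vertex,
  \<open>{a}\<close> is prepended.\<close>

lemma chain_from_odd:
  assumes G: "multigraph G" and s: "chainseg G" and a: "a \<in> vertices G" "cut_degree G {a} = 3"
  shows "\<exists>B. chain G {a} B \<and> card (vertices G - B) \<le> 2"
proof -
  have start: "chain G {a} B" if AB: "chain G A B" and A: "a \<in> A" "card A \<le> 2" for A B
  proof (cases "A = {a}")
    case True
    then show ?thesis using AB by simp
  next
    case False
    have fin: "finite A" using chain_ends[OF AB] finite_subset finite_vertices[OF G] by blast
    have "card (A - {a}) \<le> 1" using A fin by simp
    moreover obtain b where b: "b \<in> A" "b \<noteq> a" using False A(1) by blast
    ultimately have "A - {a} = {b}" using card_le_Suc0_iff_eq[of "A - {a}"] fin by auto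
    then have "A = insert b {a}" using A(1) by blast
    then show ?thesis using AB b(2) a(2) by (intro chain_insert[of G "{a}" b]) auto
  qed
  obtain A B where AB: "chain G A B" "card A \<le> 2" "card (vertices G - B) \<le> 2" using s by (auto simp: chainseg_def)
  show ?thesis
  proof (cases "a \<in> A")
    case True
    then show ?thesis using start AB by blast
  next
    case False
    then have "a \<in> vertices G - B" using chain_odd[OF G a(2) AB(1)] a(1) by blast
    then have "chain G {a} (vertices G - A)" using start[OF chain_compl[OF G AB(1)]] AB(3) by blast
    moreover have "vertices G - (vertices G - A) = A" using chain_ends[OF AB(1)] by blast
    ultimately show ?thesis using AB(2) by auto
  qed
qed

lemma chain_uncontract:
  assumes G: "multigraph G" and X: "X \<subseteq> vertices G" "a \<in> X"
  shows "chain (contract G X a) A B \<Longrightarrow> a \<in> A \<Longrightarrow> chain G (A \<union> X) (B \<union> X) \<and> a \<in> B"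
proof (induction rule: chain.induct)
  case (chain_refl A)
  then show ?case using X cut_degree_contract[OF G X(2), of A]
    by (intro conjI chain.chain_refl) (auto simp: expand_def)
next
  case (chain_step A B v)
  then have IH: "chain G (A \<union> X) (B \<union> X)" "a \<in> B" by auto
  have v: "v \<in> vertices G" "v \<notin> X" using chain_step IH(2) X by auto
  have "chain G (A \<union> X) (insert v (B \<union> X))"
  proof (rule chain.chain_step[OF IH(1) v(1)])
    show "v \<notin> B \<union> X" using v chain_step by blast
    show "cut_degree G (insert v (B \<union> X)) = 3"
      using chain_step IH(2) cut_degree_contract[OF G X(2), of "insert v B"] by (simp add: expand_def)
  qed
  then show ?case using IH(2) by simp
qed

text \<open>End sets with fewer than two vertices are normalized away by trimming the chain, so both
  ends become nontrivial cuts.\<close>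

lemma chain_two_sided:
  assumes G: "multigraph G" and s: "chainseg G" and n: "4 \<le> card (vertices G)"
  obtains L R where "chain G L R" "card L = 2" "card (vertices G - R) = 2"
proof -
  obtain A B where AB: "chain G A B" "card A \<le> 2" "card (vertices G - B) \<le> 2" using s by (auto simp: chainseg_def)
  have sub: "R \<subseteq> vertices G" "card (vertices G - R) = card (vertices G) - card R" if "chain G Z R" for Z R
  proof -
    show "R \<subseteq> vertices G" using chain_ends[OF that] by blast
    then show "card (vertices G - R) = card (vertices G) - card R"
      using finite_vertices[OF G] by (intro card_Diff_subset) (auto intro: finite_subset)
  qed
  have B: "card (vertices G) - 2 \<le> card B" using AB(3) sub(2)[OF AB(1)] by simp
  have "2 \<le> card B" using B n by linarith
  then obtain L where L: "chain G A L" "chain G L B" "card L = 2"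
    using chain_at_card[OF G AB(1,2)] by blast
  have "card L \<le> card (vertices G) - 2" using L(3) n by linarith
  then obtain R where R: "chain G L R" "card R = card (vertices G) - 2"
    using chain_at_card[OF G L(2) _ B] by blast
  show ?thesis by (rule that[OF R(1) L(3)]) (use sub(2)[OF R(1)] R(2) n in simp)
qed

lemma nontrivial_cuts_ge4_not_chainseg:
  assumes G: "multigraph G" and n: "4 \<le> card (vertices G)" and c: "nontrivial_cuts_ge4 G"
  shows "\<not> chainseg G"
proof
  assume "chainseg G"
  then obtain L R where LR: "chain G L R" "card L = 2" "card (vertices G - R) = 2"
    by (rule chain_two_sided[OF G _ n])
  have L: "L \<subseteq> vertices G" "cut_degree G L = 3" using chain_ends[OF LR(1)] by auto
  then have "card (vertices G - L) = card (vertices G) - 2"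
    using LR(2) finite_vertices[OF G] by (subst card_Diff_subset) (auto intro: finite_subset)
  then have "2 \<le> card L \<and> 2 \<le> card (vertices G - L)" using LR(2) n by linarith
  then have "4 \<le> cut_degree G L" using c L(1) unfolding nontrivial_cuts_ge4_def by blast
  then show False using L(2) by linarith
qed

lemma nontrivial_cuts_ge4_contract:
  assumes G: "multigraph G" and X: "X \<subseteq> vertices G" "a \<in> X" and c: "nontrivial_cuts_ge4 G"
  shows "nontrivial_cuts_ge4 (contract G X a)"
  unfolding nontrivial_cuts_ge4_def
proof (intro allI impI)
  let ?V = "vertices (contract G X a)"
  fix Z assume Z: "Z \<subseteq> ?V" "2 \<le> card Z \<and> 2 \<le> card (?V - Z)"
  let ?Y = "expand X a Z"
  have Y: "?Y \<subseteq> vertices G" "Z \<subseteq> ?Y" "?V - Z \<subseteq> vertices G - ?Y"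
    using Z(1) X by (auto simp: expand_def)
  have "finite ?Y" using Y(1) finite_vertices[OF G] by (rule finite_subset)
  then have "2 \<le> card ?Y" using card_mono[OF _ Y(2)] Z(2) by simp
  moreover have "2 \<le> card (vertices G - ?Y)"
    using card_mono[OF _ Y(3)] Z(2) finite_vertices[OF G] by simp
  ultimately show "4 \<le> cut_degree (contract G X a) Z"
    using c Y(1) unfolding nontrivial_cuts_ge4_def cut_degree_contract[OF G X(2)] by blast
qed

section \<open>Deleting an edge and suppressing vertices of degree 2\<close>

lemma card_edges_contract: "multigraph G \<Longrightarrow> card (edges (contract G X a)) \<le> card (edges G)"
  using finite_edges by (intro card_mono) auto

lemma singleton_of_complement:
  assumes "Y \<subseteq> V" "V - Y = {w}"
  shows "Y = V - {w}"
  using assms by blast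

text \<open>A cut loses at most one edge, and cuts with two vertices on either side have one to
  spare. Only a cut around an end of \<open>e\<close> of degree 3 could drop to 2, which the
  assumptions \<open>u\<close> and \<open>v\<close> exclude.\<close>

lemma cut_degree_del_edge_ge3:
  assumes G: "multigraph G" and conn: "edge_connected 3 G" and c: "nontrivial_cuts_ge4 G"
    and e: "e \<in> edges G" "ends G e = {u, v}"
    and u: "4 \<le> cut_degree G {u} \<or> Y \<noteq> {u} \<and> Y \<noteq> vertices G - {u}"
    and v: "4 \<le> cut_degree G {v} \<or> Y \<noteq> {v} \<and> Y \<noteq> vertices G - {v}"
    and Y: "Y \<noteq> {}" "Y \<subset> vertices G"
  shows "3 \<le> cut_degree (del_edge G e) Y"
proof -
  have fin: "finite (vertices G)" "finite Y" using finite_vertices[OF G] Y(2) finite_subset by auto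
  have d: "cut_degree G Y = cut_degree (del_edge G e) Y + (if e \<in> cutset G Y then 1 else 0)"
    by (rule cut_degree_del_edge[OF G])
  have ge3: "3 \<le> cut_degree G Y" using conn Y unfolding edge_connected_iff[OF G] by blast
  \<comment> \<open>Covers \<open>{w}\<close> and its complement together, since they have the same
    cut.\<close>
  have single: ?thesis if w: "cutset G Y = cutset G {w}" "4 \<le> cut_degree G {u} \<or> w \<noteq> u" "4 \<le> cut_degree G {v} \<or> w \<noteq> v" for w
  proof (cases "e \<in> cutset G Y")
    case True
    then have "w \<in> ends G e" unfolding w(1) using cutset_singleton_iff[OF G] by blast
    then have "w = u \<or> w = v" using e(2) by simp
    then have "4 \<le> cut_degree G Y" using w(2,3) unfolding cut_degree_cutset w(1) by blast
    then show ?thesis using d by (simp split: if_splits)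
  qed (use d ge3 in simp)
  show ?thesis
  proof (cases "card Y = 1 \<or> card (vertices G - Y) = 1")
    case True
    then show ?thesis
    proof
      assume "card Y = 1"
      then obtain w where w: "Y = {w}" by (rule card_1_singletonE)
      show ?thesis by (rule single[of w]) (use u v w in auto)
    next
      assume "card (vertices G - Y) = 1"
      then obtain w where w: "vertices G - Y = {w}" by (rule card_1_singletonE)
      have "Y = vertices G - {w}" using singleton_of_complement[OF _ w] Y(2) by blast
      then show ?thesis using u v cutset_compl[OF G, of "{w}"] by (intro single[of w]) auto
    qed
  next
    case False
    have "card Y \<noteq> 0" "card (vertices G - Y) \<noteq> 0" using Y fin by auto
    then have "2 \<le> card Y" "2 \<le> card (vertices G - Y)" using False by linarith+
    then have "4 \<le> cut_degree G Y" using c Y(2) unfolding nontrivial_cuts_ge4_def by blast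
    then show ?thesis using d by (simp split: if_splits)
  qed
qed

lemma edge_connected_del_edge:
  assumes G: "multigraph G" and conn: "edge_connected 3 G" and c: "nontrivial_cuts_ge4 G"
    and e: "e \<in> edges G" "ends G e = {u, v}" and d: "4 \<le> cut_degree G {u}" "4 \<le> cut_degree G {v}"
  shows "edge_connected 3 (del_edge G e)"
  unfolding edge_connected_iff[OF multigraph_del_edge[OF G]]
  using cut_degree_del_edge_ge3[OF G conn c e disjI1[OF d(1)] disjI1[OF d(2)]] by simp

text \<open>Suppressing \<open>u\<close> is contracting it into a neighbour \<open>a\<close>: at
  most one edge at \<open>u\<close> does not go to \<open>a\<close>, so the star condition holds. If
  both edges go to \<open>a\<close>, they disappear.\<close>

lemma suppress:
  assumes G: "multigraph G" and u: "u \<in> vertices G" "cut_degree G {u} = 2"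
  obtains a where "a \<in> vertices G" "a \<noteq> u" "1 \<le> joins G {u} {a}"
    "multigraph (contract G {u, a} a)" "vertices (contract G {u, a} a) = vertices G - {u}"
    "\<And>T. K4_on (contract G {u, a} a) T \<Longrightarrow> K4_on G T"
    "\<And>Z. Z \<subseteq> vertices G - {u} \<Longrightarrow>
       cut_degree (contract G {u, a} a) Z = cut_degree G (if a \<in> Z then insert u Z else Z)"
    "\<And>w. w \<in> vertices G - {u} \<Longrightarrow> cut_degree (contract G {u, a} a) {w} \<le> cut_degree G {w}"
proof -
  have "cutset G {u} \<noteq> {}" using u(2) by (auto simp: cut_degree_cutset)
  then obtain f where f: "f \<in> edges G" "u \<in> ends G f" using cutset_singleton_iff[OF G] by blast
  obtain a where a: "ends G f = {u, a}" "u \<noteq> a" "a \<in> vertices G" by (rule edge_at[OF G f])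
  have j: "1 \<le> joins G {u} {a}" using joins_pos[OF G a(2)] f(1) a(1) by force
  have X: "{u, a} \<subseteq> vertices G" "a \<in> {u, a}" using a u by auto
  have cd: "cut_degree (contract G {u, a} a) Z = cut_degree G (if a \<in> Z then insert u Z else Z)"
    if "Z \<subseteq> vertices G - {u}" for Z
  proof -
    have "expand {u, a} a Z = (if a \<in> Z then insert u Z else Z)" using that by (auto simp: expand_def)
    then show ?thesis using cut_degree_contract[OF G X(2), of Z] by simp
  qed
  show ?thesis
  proof (rule that[OF a(3) a(2)[symmetric] j multigraph_contract[OF G X]])
    show "vertices (contract G {u, a} a) = vertices G - {u}" using a by auto
    show "K4_on G T" if K: "K4_on (contract G {u, a} a) T" for T
    proof (rule K4_on_contract_star[OF G X _ _ K])
      show "a \<in> ends G e" if e: "e \<in> edges G" "ends G e \<subseteq> {u, a}" for e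
      proof -
        obtain p q where pq: "ends G e = {p, q}" "p \<noteq> q" by (rule edge_ends[OF G e(1)])
        then show ?thesis using e(2) by auto
      qed
      fix w assume "w \<in> {u, a}" "w \<noteq> a"
      then have w: "w = u" by blast
      have "cut_degree G {u} = joins G {u} {a} + joins G {u} (vertices G - {u} - {a})"
        using a by (intro cut_degree_split[OF G]) auto
      moreover have "vertices G - {u} - {a} = vertices G - {u, a}" by blast
      ultimately have "2 = joins G {u} {a} + joins G {u} (vertices G - {u, a})" using u(2) by argo
      then show "joins G {w} (vertices G - {u, a}) \<le> joins G {w} {a}" unfolding w using j by linarith
    qed
    show "cut_degree (contract G {u, a} a) Z = cut_degree G (if a \<in> Z then insert u Z else Z)"
      if "Z \<subseteq> vertices G - {u}" for Z using cd[OF that] .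
    show "cut_degree (contract G {u, a} a) {w} \<le> cut_degree G {w}" if w: "w \<in> vertices G - {u}" for w
    proof (cases "w = a")
      case True
      have "cut_degree (contract G {u, a} a) {a} = cut_degree G {u, a}" using cd[of "{a}"] a by simp
      moreover have "cut_degree G {u, a} + 2 * joins G {u} {a} = cut_degree G {u} + cut_degree G {a}"
        using cut_degree_pair[OF G a(2)] .
      ultimately show ?thesis using j u(2) True by simp
    next
      case False
      then show ?thesis using cd[of "{w}"] w by simp
    qed
  qed
qed

text \<open>The induction hypothesis for a fixed root and fixed types, phrased with
  \<open>double_regular\<close> and \<open>chainseg\<close> because these are the forms that
  contractions can handle.\<close>

locale smaller_graphs =
  fixes G :: "('v, 'e) mgraph" and x :: 'v
  assumes G: "multigraph G" and conn: "edge_connected 3 G" and card4: "4 \<le> card (vertices G)"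
    and x: "x \<in> vertices G"
    and smaller: "\<And>H :: ('v, 'e) mgraph. multigraph H \<Longrightarrow> edge_connected 3 H \<Longrightarrow> 4 \<le> card (vertices H) \<Longrightarrow>
      x \<in> vertices H \<Longrightarrow> card (vertices H) + card (edges H) < card (vertices G) + card (edges G) \<Longrightarrow>
      K4_at H x \<or> double_regular H \<or> chainseg H"
begin

lemma fin: "finite (vertices G)"
  using finite_vertices[OF G] .

lemma ge3: "X \<noteq> {} \<Longrightarrow> X \<subset> vertices G \<Longrightarrow> 3 \<le> cut_degree G X"
  using conn unfolding edge_connected_iff[OF G] by blast

lemma deg_ge3: "v \<in> vertices G \<Longrightarrow> 3 \<le> cut_degree G {v}"
proof (rule ge3)
  assume "v \<in> vertices G"
  moreover have "vertices G \<noteq> {v}" using card4 by auto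
  ultimately show "{v} \<subset> vertices G" by blast
qed simp

lemma contract_smaller:
  assumes X: "X \<subseteq> vertices G" "a \<in> X" "2 \<le> card X" "3 \<le> card (vertices G - X)" and xa: "x \<in> X \<Longrightarrow> x = a"
  shows "K4_at (contract G X a) x \<or> double_regular (contract G X a) \<or> chainseg (contract G X a)"
proof (rule smaller)
  let ?H = "contract G X a"
  show "multigraph ?H" by (rule multigraph_contract[OF G X(1,2)])
  show "edge_connected 3 ?H" by (rule edge_connected_contract[OF G X(1,2) conn])
  have "card (vertices G - X) = card (vertices G) - card X" "card X \<le> card (vertices G)"
    using X(1) fin by (auto intro: card_Diff_subset finite_subset card_mono)
  then show "4 \<le> card (vertices ?H)" "card (vertices ?H) + card (edges ?H) < card (vertices G) + card (edges G)"
    using card_contract[OF G X(1,2)] X(3,4) card_edges_contract[OF G, of X a] by linarith+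
  show "x \<in> vertices ?H" using xa x by auto
qed

text \<open>Contracting \<open>X\<close> gives a vertex of degree 3, so the result is not double
  regular; a \<open>K4_at\<close> would lift, as all cuts are at least 3. Hence there is a
  segmentation; by parity it may start at the new vertex, and it lifts to a chain starting at
  \<open>X\<close>.\<close>

lemma three_cut_chain:
  assumes no: "\<not> K4_at G x" and X: "X \<subseteq> vertices G" "cut_degree G X = 3" "2 \<le> card X" "2 \<le> card (vertices G - X)"
  shows "\<exists>B. chain G X B \<and> card (vertices G - B) \<le> 2"
proof (cases "card (vertices G - X) \<le> 2")
  case True
  then show ?thesis using X by (intro exI[of _ X]) (auto intro: chain_refl)
next
  case False
  have "X \<noteq> {}" using X(3) by auto
  then obtain a where a: "a \<in> X" "x \<in> X \<Longrightarrow> x = a" by blast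
  let ?H = "contract G X a"
  have VX: "vertices G - X \<noteq> {}"
  proof
    assume "vertices G - X = {}"
    then have "card (vertices G - X) = 0" by (simp only: card.empty)
    then show False using X(4) by linarith
  qed
  have "\<not> K4_at ?H x"
  proof
    assume "K4_at ?H x"
    then obtain T where T: "K4_on ?H T" "x \<in> T" by (auto simp: K4_at_def)
    have "K4_on G T"
    proof (rule K4_on_contract[OF G X(1) a(1) X(2) _ T(1)])
      fix Z assume "a \<in> Z" "Z \<subseteq> X"
      then show "3 \<le> cut_degree G Z" using VX X(1) by (intro ge3) auto
    qed
    then show False using no T(2) by (auto simp: K4_at_def)
  qed
  moreover have da: "cut_degree ?H {a} = 3"
    using cut_degree_contract[OF G a(1), of "{a}"] a(1) X(2) by (simp add: expand_def insert_absorb)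
  moreover from this have "\<not> double_regular ?H" by (auto simp: double_regular_def)
  ultimately have "chainseg ?H" using contract_smaller[OF X(1) a(1) X(3) _ a(2)] False by auto
  then obtain B where B: "chain ?H {a} B" "card (vertices ?H - B) \<le> 2"
    using chain_from_odd[OF multigraph_contract[OF G X(1) a(1)] _ _ da] by auto
  have B': "chain G ({a} \<union> X) (B \<union> X)" "a \<in> B" using chain_uncontract[OF G X(1) a(1) B(1)] by auto
  have "vertices ?H - B = vertices G - (B \<union> X)" using B'(2) by auto
  moreover have "{a} \<union> X = X" using a(1) by blast
  ultimately show ?thesis using B' B(2) by (intro exI[of _ "B \<union> X"]) simp
qed

text \<open>The chains obtained for \<open>X\<close> and for its complement meet in \<open>X\<close>
  once the second is reversed.\<close>

lemma three_cut_chainseg: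
  assumes no: "\<not> K4_at G x" and X: "X \<subseteq> vertices G" "cut_degree G X = 3" "2 \<le> card X" "2 \<le> card (vertices G - X)"
  shows "chainseg G"
proof -
  have VX: "vertices G - (vertices G - X) = X" using X(1) by blast
  obtain B where B: "chain G X B" "card (vertices G - B) \<le> 2" using three_cut_chain[OF assms] by blast
  obtain B' where B': "chain G (vertices G - X) B'" "card (vertices G - B') \<le> 2"
    using three_cut_chain[OF no, of "vertices G - X"] X VX cut_degree_compl[OF G] by auto
  have "chain G (vertices G - B') X" using chain_compl[OF G B'(1)] VX by simp
  then have "chain G (vertices G - B') B" using B(1) chain_trans by blast
  then show ?thesis using B(2) B'(2) by (auto simp: chainseg_def)
qed

text \<open>Sets between \<open>{a}\<close> and \<open>X\<close> other than \<open>{a}\<close> are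
  nontrivial and have cuts of at least 4, and \<open>{a}\<close> does by assumption, so a
  \<open>K4_at\<close> would lift. The contraction has no nontrivial 3-cut either, which leaves one
  alternative.\<close>

lemma contract_four_cut:
  assumes c: "nontrivial_cuts_ge4 G" and X: "X \<subseteq> vertices G" "cut_degree G X = 4" "2 \<le> card X" "3 \<le> card (vertices G - X)"
    and a: "a \<in> X" "4 \<le> cut_degree G {a}" "x \<in> X \<Longrightarrow> x = a" and no: "\<not> K4_at G x"
  shows "double_regular (contract G X a)"
proof -
  let ?H = "contract G X a"
  have "\<not> K4_at ?H x"
  proof
    assume "K4_at ?H x"
    then obtain T where T: "K4_on ?H T" "x \<in> T" by (auto simp: K4_at_def)
    have "K4_on G T"
    proof (rule K4_on_contract[OF G X(1) a(1) X(2) _ T(1)])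
      fix Z assume Z: "a \<in> Z" "Z \<subseteq> X"
      show "4 \<le> cut_degree G Z"
      proof (cases "Z = {a}")
        case False
        then obtain b where "b \<in> Z" "b \<noteq> a" using Z(1) by blast
        then have "card {a, b} \<le> card Z" using Z X(1) fin by (intro card_mono) (auto intro: finite_subset)
        then have "2 \<le> card Z" using \<open>b \<noteq> a\<close> by simp
        moreover have "card (vertices G - X) \<le> card (vertices G - Z)" using Z(2) fin by (intro card_mono) auto
        ultimately have "2 \<le> card Z \<and> 2 \<le> card (vertices G - Z)" using X(4) by linarith
        moreover have "Z \<subseteq> vertices G" using Z(2) X(1) by blast
        ultimately show ?thesis using c unfolding nontrivial_cuts_ge4_def by blast
      qed (use a in simp)
    qed
    then show False using no T(2) by (auto simp: K4_at_def)
  qed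
  moreover have "\<not> chainseg ?H"
  proof (rule nontrivial_cuts_ge4_not_chainseg)
    show "multigraph ?H" by (rule multigraph_contract[OF G X(1) a(1)])
    show "nontrivial_cuts_ge4 ?H" by (rule nontrivial_cuts_ge4_contract[OF G X(1) a(1) c])
    have "card (vertices G - X) = card (vertices G) - card X" "card X \<le> card (vertices G)"
      using X(1) fin by (auto intro: card_Diff_subset finite_subset card_mono)
    then show "4 \<le> card (vertices ?H)" using card_contract[OF G X(1) a(1)] X(4) by linarith
  qed
  ultimately show ?thesis using contract_smaller[OF X(1) a(1) X(3,4) a(3)] by blast
qed

text \<open>Contracting the pair reveals all degrees and multiplicities outside it. There a second,
  disjoint pair with a 4-cut is found, whose contraction reveals the first pair. As \<open>x\<close>
  avoids the first pair, \<open>u\<close> may represent it.\<close>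

lemma four_cut_pair:
  assumes c: "nontrivial_cuts_ge4 G" and n: "5 \<le> card (vertices G)" and no: "\<not> K4_at G x"
    and L: "u \<in> vertices G" "u' \<in> vertices G" "u \<noteq> u'" "cut_degree G {u, u'} = 4" "4 \<le> cut_degree G {u}"
      "x \<notin> {u, u'}"
  shows "double_regular G"
proof -
  let ?L = "{u, u'}" and ?V = "vertices G"
  have cVL: "card (?V - {p, q}) = card ?V - 2" if "p \<in> ?V" "q \<in> ?V" "p \<noteq> q" for p q
    using that fin by (simp add: card_Diff_subset)
  have L': "?L \<subseteq> ?V" "u \<in> ?L" "2 \<le> card ?L" "3 \<le> card (?V - ?L)" using L n cVL[OF L(1-3)] by auto
  let ?H = "contract G ?L u"
  have H: "double_regular ?H" by (rule contract_four_cut[OF c L'(1) L(4) L'(3,4,2) L(5) _ no]) (use L in auto)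
  have expL: "expand ?L u {w} = {w}" if "w \<notin> ?L" for w using that by (auto simp: expand_def)
  have expu: "expand ?L u {u} = ?L" by (simp add: expand_def insert_commute)
  have degL: "cut_degree G {w} = 4" if "w \<in> ?V - ?L" for w
    using double_regularD(1)[OF H, of w] that cut_degree_contract[OF G L'(2), of "{w}"] expL[of w] by simp
  have joinsL: "joins G {w} {w'} = 0 \<or> joins G {w} {w'} = 2" if "w \<in> ?V - ?L" "w' \<in> ?V - ?L" "w \<noteq> w'" for w w'
    using double_regularD(2)[OF H, of w w'] that joins_contract[OF G L'(2), of "{w}" "{w'}"] expL[of w] expL[of w'] by simp
  have joinsLu: "joins G ?L {w} = 0 \<or> joins G ?L {w} = 2" if w: "w \<in> ?V - ?L" for w
  proof -
    have "u \<noteq> w" using w by blast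
    then have "joins ?H {u} {w} = 0 \<or> joins ?H {u} {w} = 2" using double_regularD(2)[OF H, of u w] w by simp
    moreover have "joins ?H {u} {w} = joins G ?L {w}"
      using joins_contract[OF G L'(2), of "{u}" "{w}"] expL[of w] expu w by simp
    ultimately show ?thesis by simp
  qed
  \<comment> \<open>Each outside vertex receives 0 or 2 of the four edges leaving the pair, so at
    most two are adjacent to it, and at least three lie outside.\<close>
  obtain c2 where c2: "c2 \<in> ?V - ?L" "joins G ?L {c2} = 0"
  proof -
    have "\<exists>w\<in>?V - ?L. joins G ?L {w} = 0"
    proof (rule ccontr)
      assume "\<not> ?thesis"
      then have two: "joins G ?L {w} = 2" if "w \<in> ?V - ?L" for w using joinsLu that by blast
      have "4 = joins G ?L (?V - ?L)" using joins_compl[OF G, of ?L] L(4) by simp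
      also have "\<dots> = (\<Sum>w\<in>?V - ?L. joins G ?L {w})" using fin by (intro joins_sum[OF G]) auto
      also have "\<dots> = (\<Sum>w\<in>?V - ?L. 2)" by (rule sum.cong) (use two in auto)
      finally show False using L'(4) by simp
    qed
    then show ?thesis using that by blast
  qed
  have c2L: "joins G {p} {c2} = 0" if "p \<in> ?L" for p
  proof -
    have "joins G {c2} {p} \<le> joins G {c2} ?L" using c2(1) that by (intro joins_mono[OF G]) blast+
    then show ?thesis using c2(2) by (simp add: joins_commute)
  qed
  have "cutset G {c2} \<noteq> {}" using degL[OF c2(1)] by (auto simp: cut_degree_cutset)
  then obtain f where f: "f \<in> edges G" "c2 \<in> ends G f" using cutset_singleton_iff[OF G] by blast
  obtain c1 where c1: "ends G f = {c2, c1}" "c2 \<noteq> c1" "c1 \<in> ?V" by (rule edge_at[OF G f])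
  have pos: "0 < joins G {c2} {c1}" using joins_pos[OF G c1(2)] f(1) c1(1) by blast
  have c1L: "c1 \<in> ?V - ?L"
  proof
    show "c1 \<notin> ?L"
    proof
      assume "c1 \<in> ?L"
      then have "joins G {c1} {c2} = 0" by (rule c2L)
      then show False using pos by (simp add: joins_commute)
    qed
  qed (rule c1(3))
  have "joins G {c2} {c1} = 2" using joinsL[OF c2(1) c1L c1(2)] pos by simp
  then have dX: "cut_degree G {c2, c1} = 4" using cut_degree_pair[OF G c1(2)] degL[OF c2(1)] degL[OF c1L] by simp
  let ?X = "{c2, c1}"
  have X: "?X \<subseteq> ?V" "2 \<le> card ?X" "3 \<le> card (?V - ?X)" using c2(1) c1 n cVL[of c2 c1] by auto
  obtain a where a: "a \<in> ?X" "x \<in> ?X \<Longrightarrow> x = a" by blast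
  have da: "4 \<le> cut_degree G {a}" using a(1) degL[OF c2(1)] degL[OF c1L] by auto
  let ?K = "contract G ?X a"
  have K: "double_regular ?K" by (rule contract_four_cut[OF c X(1) dX X(2,3) a(1) da a(2) no])
  have expX: "expand ?X a {w} = {w}" if "w \<notin> ?X" for w using that a(1) by (auto simp: expand_def)
  have expa: "expand ?X a {a} = ?X" using a(1) by (auto simp: expand_def)
  have degX: "cut_degree G {w} = 4" if "w \<in> ?V - ?X" for w
    using double_regularD(1)[OF K, of w] that cut_degree_contract[OF G a(1), of "{w}"] expX[of w] by simp
  have joinsX: "joins G {w} {w'} = 0 \<or> joins G {w} {w'} = 2" if "w \<in> ?V - ?X" "w' \<in> ?V - ?X" "w \<noteq> w'" for w w'
    using double_regularD(2)[OF K, of w w'] that joins_contract[OF G a(1), of "{w}" "{w'}"] expX[of w] expX[of w'] by simp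
  have disj: "?L \<inter> ?X = {}" using c2(1) c1L by blast
  \<comment> \<open>Since \<open>c2\<close> sends no edge to the first pair, the edges from
    \<open>p\<close> to \<open>c1\<close> are all edges from \<open>p\<close> to the second pair,
    and the second contraction gives their number.\<close>
  have cross: "joins G {p} {q} = 0 \<or> joins G {p} {q} = 2" if p: "p \<in> ?L" and q: "q \<in> ?X" for p q
  proof (cases "q = c2")
    case True
    then show ?thesis using c2L[OF p] by simp
  next
    case False
    then have q1: "q = c1" using q by blast
    have pX: "p \<in> ?V - ?X" using p disj L by blast
    have "joins G {p} ({c2} \<union> {c1}) = joins G {p} {c2} + joins G {p} {c1}"
      using pX c1(2) by (intro joins_un[OF G]) auto
    then have "joins G {p} {c1} = joins G {p} ?X" using c2L[OF p] by (simp add: insert_commute)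
    moreover have "joins ?K {p} {a} = joins G {p} ?X"
      using joins_contract[OF G a(1), of "{p}" "{a}"] expX[of p] expa pX by simp
    moreover have "joins ?K {p} {a} = 0 \<or> joins ?K {p} {a} = 2"
    proof (rule double_regularD(2)[OF K])
      show "p \<in> vertices ?K" "a \<in> vertices ?K" using pX by simp_all
      show "p \<noteq> a" using pX a(1) by blast
    qed
    ultimately show ?thesis using q1 by simp
  qed
  show ?thesis
    unfolding double_regular_def
  proof (intro conjI ballI impI)
    fix w assume "w \<in> ?V"
    then show "cut_degree G {w} = 4" using degL degX disj by blast
  next
    fix p q assume pq: "p \<in> ?V" "q \<in> ?V" "p \<noteq> q"
    consider "p \<notin> ?L" "q \<notin> ?L" | "p \<notin> ?X" "q \<notin> ?X" | "p \<in> ?L" "q \<in> ?X" | "q \<in> ?L" "p \<in> ?X"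
      using disj by blast
    then show "joins G {p} {q} = 0 \<or> joins G {p} {q} = 2"
    proof cases
      case 1
      then show ?thesis using joinsL pq by blast
    next
      case 2
      then show ?thesis using joinsX pq by blast
    next
      case 3
      then show ?thesis by (rule cross)
    next
      case 4
      then show ?thesis using cross[OF 4] by (simp add: joins_commute)
    qed
  qed
qed

end

section \<open>Deleting an edge of a minimal counterexample\<close>

lemma not_singleton: "2 \<le> card A \<Longrightarrow> A \<noteq> {w}"
  by auto

context smaller_graphs
begin

lemma del_edge_smaller:
  assumes c: "nontrivial_cuts_ge4 G" and e: "e \<in> edges G" "ends G e = {u, v}"
    and d: "4 \<le> cut_degree G {u}" "4 \<le> cut_degree G {v}" and no: "\<not> K4_at G x"
  shows "double_regular (del_edge G e) \<or> chainseg (del_edge G e)"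
proof -
  let ?D = "del_edge G e"
  have "edge_connected 3 ?D" by (rule edge_connected_del_edge[OF G conn c e d])
  moreover have "card (edges ?D) < card (edges G)"
    unfolding del_edge_simps by (rule card_Diff1_less[OF finite_edges[OF G] e(1)])
  ultimately have "K4_at ?D x \<or> double_regular ?D \<or> chainseg ?D"
    using x card4 by (intro smaller) (simp_all add: multigraph_del_edge[OF G])
  moreover have "\<not> K4_at ?D x" using no K4_on_del_edge[of G e] unfolding K4_at_def by blast
  ultimately show ?thesis by blast
qed

lemma four_cut_pair_set:
  assumes c: "nontrivial_cuts_ge4 G" and n: "5 \<le> card (vertices G)" and no: "\<not> K4_at G x"
    and L: "L \<subseteq> vertices G" "card L = 2" "cut_degree G L = 4" "u \<in> L" "4 \<le> cut_degree G {u}" "x \<notin> L"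
  shows "double_regular G"
proof -
  obtain p q where pq: "L = {p, q}" "p \<noteq> q" using L(2) unfolding card_2_iff by blast
  then obtain u' where u': "L = {u, u'}" "u \<noteq> u'" using L(4) by blast
  then have "u \<in> vertices G" "u' \<in> vertices G" using L(1) by auto
  then show ?thesis using four_cut_pair[OF c n no _ _ u'(2)] L(3,5,6) unfolding u'(1) by blast
qed

text \<open>The end cuts of the segmentation have width at least 4 in \<open>G\<close>, so
  \<open>e\<close> crosses both and they have width exactly 4. Thus \<open>e\<close> joins the two
  end pairs; the pair avoiding \<open>x\<close> contains an end of \<open>e\<close> of degree at
  least 4.\<close>

lemma del_edge_chainseg:
  assumes c: "nontrivial_cuts_ge4 G" and n: "5 \<le> card (vertices G)" and no: "\<not> K4_at G x"
    and e: "e \<in> edges G" "ends G e = {u, v}" "u \<noteq> v"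
    and d: "4 \<le> cut_degree G {u}" "4 \<le> cut_degree G {v}" and s: "chainseg (del_edge G e)"
  shows "double_regular G"
proof -
  let ?D = "del_edge G e" and ?V = "vertices G"
  obtain L R where LR: "chain ?D L R" "card L = 2" "card (?V - R) = 2"
    using chain_two_sided[OF multigraph_del_edge[OF G] s] card4 by auto
  have sub: "L \<subseteq> R" "L \<subseteq> ?V" "R \<subseteq> ?V" "cut_degree ?D L = 3" "cut_degree ?D R = 3"
    using chain_ends[OF LR(1)] by auto
  have cross: "e \<in> cutset G X \<and> cut_degree G X = 4"
    if X: "X \<subseteq> ?V" "card X = 2 \<or> card (?V - X) = 2" "cut_degree ?D X = 3" for X
  proof -
    have "card (?V - X) = card ?V - card X" "card X \<le> card ?V"
      using X(1) fin by (auto intro: card_Diff_subset finite_subset card_mono)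
    then have "2 \<le> card X \<and> 2 \<le> card (?V - X)" using X(2) n by linarith
    then have "4 \<le> cut_degree G X" using c X(1) unfolding nontrivial_cuts_ge4_def by blast
    then show ?thesis using cut_degree_del_edge[OF G, of X e] X(3) by (simp split: if_splits)
  qed
  have L: "e \<in> cutset G L" "cut_degree G L = 4" using cross[OF sub(2) disjI1[OF LR(2)] sub(4)] by auto
  have R: "e \<in> cutset G R" "cut_degree G R = 4" using cross[OF sub(3) disjI2[OF LR(3)] sub(5)] by auto
  have R': "cut_degree G (?V - R) = 4" using R(2) cut_degree_compl[OF G] by simp
  have uv: "u \<in> ?V" "v \<in> ?V" using e G by (auto simp: multigraph_def)
  have ends: "\<exists>u\<in>L. \<exists>v\<in>?V - R. 4 \<le> cut_degree G {u} \<and> 4 \<le> cut_degree G {v}"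
    using L(1) R(1) sub(1) d uv unfolding cutset_iff[OF e(2,3)] by blast
  then obtain u v where uv: "u \<in> L" "v \<in> ?V - R" "4 \<le> cut_degree G {u}" "4 \<le> cut_degree G {v}" by blast
  show ?thesis
  proof (cases "x \<in> L")
    case False
    then show ?thesis using four_cut_pair_set[OF c n no sub(2) LR(2) L(2) uv(1,3)] by blast
  next
    case True
    then have "x \<notin> ?V - R" using sub(1) by blast
    then show ?thesis using four_cut_pair_set[OF c n no Diff_subset LR(3) R' uv(2,4)] by blast
  qed
qed

text \<open>If deleting \<open>e\<close> leaves a double regular graph, all degrees of
  \<open>G\<close> are at least 4, so another edge \<open>f\<close> may be deleted instead. It is
  chosen at a vertex of degree 4 away from \<open>e\<close>, so that double regularity fails without
  \<open>f\<close>.\<close>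

lemma adjacent_big:
  assumes c: "nontrivial_cuts_ge4 G" and n: "5 \<le> card (vertices G)" and no: "\<not> K4_at G x"
    and e: "e \<in> edges G" "ends G e = {u, v}" "u \<noteq> v"
    and d: "4 \<le> cut_degree G {u}" "4 \<le> cut_degree G {v}"
  shows "double_regular G"
proof (cases "chainseg (del_edge G e)")
  case True
  then show ?thesis by (rule del_edge_chainseg[OF assms])
next
  case False
  let ?D = "del_edge G e" and ?V = "vertices G"
  have D: "double_regular ?D" using del_edge_smaller[OF c e(1,2) d no] False by blast
  have degD: "cut_degree ?D {w} = 4" if "w \<in> ?V" for w using double_regularD(1)[OF D] that by simp
  have big: "4 \<le> cut_degree G {w}" if "w \<in> ?V" for w
    using cut_degree_del_edge[OF G, of "{w}" e] degD[OF that] by simp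
  have "card {u, v} < card ?V" using n e(3) by simp
  then have "\<not> ?V \<subseteq> {u, v}" using card_mono[of "{u, v}" ?V] by auto
  then obtain w where w: "w \<in> ?V" "w \<notin> {u, v}" by blast
  then have "e \<notin> cutset G {w}" using e cutset_singleton_iff[OF G] by auto
  then have dw: "cut_degree G {w} = 4" using cut_degree_del_edge[OF G, of "{w}" e] degD[OF w(1)] by simp
  then have "cutset G {w} \<noteq> {}" by (auto simp: cut_degree_cutset)
  then obtain f where f: "f \<in> edges G" "w \<in> ends G f" using cutset_singleton_iff[OF G] by blast
  obtain z where z: "ends G f = {w, z}" "w \<noteq> z" "z \<in> ?V" by (rule edge_at[OF G f])
  have "f \<in> cutset G {w}" using f cutset_singleton_iff[OF G] by blast
  then have "cut_degree (del_edge G f) {w} = 3" using cut_degree_del_edge[OF G, of "{w}" f] dw by simp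
  then have "\<not> double_regular (del_edge G f)" using double_regularD(1)[of "del_edge G f" w] w(1) by auto
  then have "chainseg (del_edge G f)"
    using del_edge_smaller[OF c f(1) z(1) big[OF w(1)] big[OF z(3)] no] by blast
  then show ?thesis by (rule del_edge_chainseg[OF c n no f(1) z(1,2) big[OF w(1)] big[OF z(3)]])
qed

text \<open>Suppressing both ends of a deleted edge gives a cubic graph again. Such a graph is not
  double regular, and two vertices of degree 3 have an even cut, so it has no segmentation.\<close>

lemma cubic:
  assumes c: "nontrivial_cuts_ge4 G" and n: "5 \<le> card (vertices G)"
    and three: "\<And>v. v \<in> vertices G \<Longrightarrow> cut_degree G {v} = 3"
  shows "K4_at G x"
proof -
  let ?V = "vertices G"
  have simple: "joins G {p} {q} \<le> 1" if "p \<in> ?V" "q \<in> ?V" "p \<noteq> q" for p q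
  proof -
    have "card (?V - {p, q}) = card ?V - 2" using that fin by (simp add: card_Diff_subset)
    then have "4 \<le> cut_degree G {p, q}" using c that n unfolding nontrivial_cuts_ge4_def by simp
    then show ?thesis using cut_degree_pair[OF G that(3)] three that by simp
  qed
  have "even (cut_degree G X + 3 * card X)" if X: "finite X" "X \<subseteq> ?V" for X
    using X
  proof (induction X rule: finite_induct)
    case empty
    then show ?case by (simp add: cut_degree_def)
  next
    case (insert v X)
    have "cut_degree G ({v} \<union> X) + 2 * joins G {v} X = cut_degree G {v} + cut_degree G X"
      using insert by (intro cut_degree_un[OF G]) auto
    then have "cut_degree G (insert v X) + 2 * joins G {v} X = 3 + cut_degree G X" using three insert by simp
    moreover have "even (cut_degree G X + 3 * card X)" using insert by blast
    moreover have "card (insert v X) = Suc (card X)" using insert by simp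
    ultimately show ?case by presburger
  qed
  then have "even (cut_degree G ?V + 3 * card ?V)" using fin by blast
  moreover have "cut_degree G ?V = 0"
  proof -
    have "cut_degree G ?V = cut_degree G {}" using cut_degree_compl[OF G, of ?V] by simp
    then show ?thesis by (simp add: cut_degree_def)
  qed
  \<comment> \<open>All degrees are odd, so the number of vertices is even. Six vertices leave four
    after the two suppressions.\<close>
  ultimately have n6: "6 \<le> card ?V" using n by presburger
  have "\<not> ?V \<subseteq> {x}" using card_mono[of "{x}" ?V] n by auto
  then obtain u where u: "u \<in> ?V" "u \<noteq> x" by blast
  have "cut_degree G {u} = joins G {u} {x} + joins G {u} (?V - {u} - {x})"
    using u x by (intro cut_degree_split[OF G]) auto
  then have "0 < joins G {u} (?V - {u} - {x})" using simple[OF u(1) x u(2)] three[OF u(1)] by linarith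
  then have "cutset G {u} \<inter> cutset G (?V - {u} - {x}) \<noteq> {}" by (auto simp: joins_def)
  then obtain e where e: "e \<in> cutset G {u}" "e \<in> cutset G (?V - {u} - {x})" by blast
  have eG: "e \<in> edges G" "u \<in> ends G e" using e(1) cutset_singleton_iff[OF G] by blast+
  obtain v where v: "ends G e = {u, v}" "u \<noteq> v" "v \<in> ?V" by (rule edge_at[OF G eG])
  have vx: "v \<noteq> x" using e(2) unfolding cutset_iff[OF v(1,2)] by blast
  let ?D = "del_edge G e"
  have D: "multigraph ?D" by (rule multigraph_del_edge[OF G])
  have "e \<in> cutset G {v}" using eG v cutset_singleton_iff[OF G] by blast
  then have dD: "cut_degree ?D {u} = 2" "cut_degree ?D {v} = 2"
    using cut_degree_del_edge[OF G, of "{u}" e] cut_degree_del_edge[OF G, of "{v}" e] e(1) three u(1) v(3) by simp_all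
  have degD: "cut_degree ?D {w} \<le> 3" if "w \<in> ?V" for w
    using cut_degree_del_edge[OF G, of "{w}" e] three[OF that] by simp
  have uD: "u \<in> vertices ?D" using u by simp
  obtain a where a: "a \<in> vertices ?D" "a \<noteq> u" "1 \<le> joins ?D {u} {a}"
    and H1: "multigraph (contract ?D {u, a} a)" "vertices (contract ?D {u, a} a) = vertices ?D - {u}"
    and K1: "\<And>T. K4_on (contract ?D {u, a} a) T \<Longrightarrow> K4_on ?D T"
    and d1: "\<And>Z. Z \<subseteq> vertices ?D - {u} \<Longrightarrow>
       cut_degree (contract ?D {u, a} a) Z = cut_degree ?D (if a \<in> Z then insert u Z else Z)"
    and le1: "\<And>w. w \<in> vertices ?D - {u} \<Longrightarrow> cut_degree (contract ?D {u, a} a) {w} \<le> cut_degree ?D {w}"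
    by (rule suppress[OF D uD dD(1)]) blast
  let ?H1 = "contract ?D {u, a} a"
  \<comment> \<open>There are no parallel edges, so \<open>u\<close> and \<open>v\<close> are
    nonadjacent after the deletion, and suppressing \<open>u\<close> does not change the degree 2 of
    \<open>v\<close>.\<close>
  have "a \<noteq> v"
  proof
    assume av: "a = v"
    have "cutset ?D {u} \<inter> cutset ?D {v} = cutset G {u} \<inter> cutset G {v} - {e}" by (auto simp: cutset_del_edge)
    moreover have "e \<in> cutset G {u} \<inter> cutset G {v}" using e(1) \<open>e \<in> cutset G {v}\<close> by blast
    moreover have "card (cutset G {u} \<inter> cutset G {v}) \<le> 1" using simple[OF u(1) v(3,2)] by (simp add: joins_def)
    ultimately have "joins ?D {u} {v} = 0" using finite_cutset[OF G] by (simp add: joins_def)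
    then show False using a(3) av by simp
  qed
  then have dv: "cut_degree ?H1 {v} = 2" using d1[of "{v}"] v(2,3) dD(2) by simp
  have vH: "v \<in> vertices ?H1" using H1(2) v(2,3) by simp
  obtain b where b: "b \<in> vertices ?H1" "b \<noteq> v" "1 \<le> joins ?H1 {v} {b}"
    and H2: "multigraph (contract ?H1 {v, b} b)" "vertices (contract ?H1 {v, b} b) = vertices ?H1 - {v}"
    and K2: "\<And>T. K4_on (contract ?H1 {v, b} b) T \<Longrightarrow> K4_on ?H1 T"
    and d2: "\<And>Z. Z \<subseteq> vertices ?H1 - {v} \<Longrightarrow>
       cut_degree (contract ?H1 {v, b} b) Z = cut_degree ?H1 (if b \<in> Z then insert v Z else Z)"
    and le2: "\<And>w. w \<in> vertices ?H1 - {v} \<Longrightarrow> cut_degree (contract ?H1 {v, b} b) {w} \<le> cut_degree ?H1 {w}"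
    by (rule suppress[OF H1(1) vH dv]) blast
  let ?H = "contract ?H1 {v, b} b"
  have VH: "vertices ?H = ?V - {u, v}" unfolding H2(2) H1(2) by auto
  have cVH: "card (vertices ?H) = card ?V - 2" unfolding VH using u v fin by (simp add: card_Diff_subset)
  have "edge_connected 3 ?H"
    unfolding edge_connected_iff[OF H2(1)]
  proof (intro allI impI)
    fix Z assume Z: "Z \<noteq> {} \<and> Z \<subset> vertices ?H"
    then have ZV: "Z \<noteq> {}" "Z \<subset> ?V - {u, v}" unfolding VH by auto
    define Z1 where "Z1 = (if b \<in> Z then insert v Z else Z)"
    define Z2 where "Z2 = (if a \<in> Z1 then insert u Z1 else Z1)"
    have Z1: "Z1 \<subseteq> vertices ?D - {u}" using ZV v(2,3) by (auto simp: Z1_def)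
    have "cut_degree ?H Z = cut_degree ?H1 Z1" unfolding Z1_def using Z H2(2) by (intro d2) blast
    also have "\<dots> = cut_degree ?D Z2" unfolding Z2_def by (rule d1[OF Z1])
    also have "3 \<le> \<dots>"
    proof (rule cut_degree_del_edge_ge3[OF G conn c eG(1) v(1)])
      have sub: "Z \<subseteq> Z2" "Z2 \<subseteq> Z \<union> {u, v}" by (auto simp: Z1_def Z2_def)
      show "Z2 \<noteq> {}" using sub(1) ZV(1) by blast
      show "Z2 \<subset> ?V" using sub(2) ZV(2) u(1) v(3) by blast
      obtain z where z: "z \<in> Z" using ZV(1) by blast
      obtain y where y: "y \<in> ?V" "y \<notin> Z" "y \<noteq> u" "y \<noteq> v" using ZV(2) by blast
      have "z \<in> Z2" "z \<noteq> u" "z \<noteq> v" "y \<notin> Z2" using z y sub ZV(2) by blast+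
      then show "4 \<le> cut_degree G {u} \<or> Z2 \<noteq> {u} \<and> Z2 \<noteq> ?V - {u}"
        "4 \<le> cut_degree G {v} \<or> Z2 \<noteq> {v} \<and> Z2 \<noteq> ?V - {v}" using y by blast+
    qed
    finally show "3 \<le> cut_degree ?H Z" .
  qed
  moreover have "card (edges ?H) \<le> card (edges G)"
  proof -
    have "card (edges ?H) \<le> card (edges ?H1)" by (rule card_edges_contract[OF H1(1)])
    also have "\<dots> \<le> card (edges ?D)" by (rule card_edges_contract[OF D])
    also have "\<dots> \<le> card (edges G)" using finite_edges[OF G] by (intro card_mono) auto
    finally show ?thesis .
  qed
  moreover have "x \<in> vertices ?H" unfolding VH using x u(2) vx by blast
  moreover have n4: "4 \<le> card (vertices ?H)" using cVH n6 by linarith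
  ultimately have "K4_at ?H x \<or> double_regular ?H \<or> chainseg ?H"
    using cVH n6 by (intro smaller[OF H2(1)]) linarith+
  moreover have deg: "cut_degree ?H {w} = 3" if "w \<in> vertices ?H" for w
  proof -
    have w: "w \<in> ?V" "w \<noteq> u" "w \<noteq> v" using that unfolding VH by auto
    have "cut_degree ?H {w} \<le> cut_degree ?H1 {w}" using that unfolding H2(2) by (intro le2)
    also have "\<dots> \<le> cut_degree ?D {w}" using w by (intro le1) simp
    also have "\<dots> \<le> 3" by (rule degD[OF w(1)])
    finally have "cut_degree ?H {w} \<le> 3" .
    moreover have "vertices ?H \<noteq> {w}" by (rule not_singleton) (use n4 in linarith)
    then have "3 \<le> cut_degree ?H {w}" using \<open>edge_connected 3 ?H\<close> that unfolding edge_connected_iff[OF H2(1)] by blast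
    ultimately show ?thesis by simp
  qed
  moreover have "\<not> double_regular ?H" using deg double_regularD(1)[of ?H x] \<open>x \<in> vertices ?H\<close> by fastforce
  moreover have "\<not> chainseg ?H"
  proof
    assume "chainseg ?H"
    then obtain L R where LR: "chain ?H L R" "card L = 2" by (rule chain_two_sided[OF H2(1) _ n4])
    obtain p q where pq: "L = {p, q}" "p \<noteq> q" using LR(2) unfolding card_2_iff by blast
    have "L \<subseteq> vertices ?H" "cut_degree ?H L = 3" using chain_ends[OF LR(1)] by blast+
    then have "3 + 2 * joins ?H {p} {q} = 6" using cut_degree_pair[OF H2(1) pq(2)] deg pq(1) by simp
    then show False by presburger
  qed
  ultimately have "K4_at ?H x" by blast
  then obtain T where "K4_on ?H T" "x \<in> T" by (auto simp: K4_at_def)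
  then have "K4_on G T" "x \<in> T" using K4_on_del_edge[OF K1[OF K2]] by blast+
  then show ?thesis by (auto simp: K4_at_def)
qed

text \<open>An edge from \<open>v\<close> to some \<open>u \<noteq> x\<close> is deleted and \<open>u\<close>, which now has degree 2, is suppressed. If the result
  has a segmentation, then the end of it that avoids \<open>v\<close> contains all other neighbours of \<open>u\<close> and
  sends two of its three edges from a single vertex of degree at least 4; the next vertex of the
  segmentation has even degree, hence is a neighbour of that vertex.\<close>
lemma isolated_big:
  assumes c: "nontrivial_cuts_ge4 G" and n: "5 \<le> card (vertices G)"
    and indep: "\<And>p q. p \<in> vertices G \<Longrightarrow> q \<in> vertices G \<Longrightarrow> p \<noteq> q \<Longrightarrow>
      4 \<le> cut_degree G {p} \<Longrightarrow> 4 \<le> cut_degree G {q} \<Longrightarrow> joins G {p} {q} = 0"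
    and v: "v \<in> vertices G" "4 \<le> cut_degree G {v}"
  shows "K4_at G x"
proof -
  let ?V = "vertices G"
  \<comment> \<open>Otherwise all edges at \<open>v\<close> go to \<open>x\<close>, and the cut
    around \<open>{v, x}\<close> forces \<open>x\<close> to have degree at least 4, against
    \<open>indep\<close>.\<close>
  have "0 < joins G {v} (?V - {v} - {x})"
  proof (rule ccontr)
    assume "\<not> ?thesis"
    then have z: "joins G {v} (?V - {v} - {x}) = 0" by simp
    have "cut_degree G {v} \<noteq> joins G {v} (?V - {v})" if "v = x" using that z v(2) by (simp add: joins_def)
    then have vx: "v \<noteq> x" using joins_compl[OF G, of "{v}"] by auto
    have j: "cut_degree G {v} = joins G {v} {x}"
      using cut_degree_split[OF G, of "{v}" "{x}"] vx x z by simp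
    have "card (?V - {v, x}) = card ?V - 2" using vx v x fin by (simp add: card_Diff_subset)
    then have "4 \<le> cut_degree G {v, x}" using c vx v x n unfolding nontrivial_cuts_ge4_def by simp
    then have "4 \<le> cut_degree G {x}" using cut_degree_pair[OF G vx] j by simp
    then have "joins G {v} {x} = 0" by (rule indep[OF v(1) x vx v(2)])
    then show False using j v(2) by simp
  qed
  then have "cutset G {v} \<inter> cutset G (?V - {v} - {x}) \<noteq> {}" by (auto simp: joins_def)
  then obtain e where e: "e \<in> cutset G {v}" "e \<in> cutset G (?V - {v} - {x})" by blast
  have eG: "e \<in> edges G" "v \<in> ends G e" using e(1) cutset_singleton_iff[OF G] by blast+
  obtain u where u: "ends G e = {v, u}" "v \<noteq> u" "u \<in> ?V" by (rule edge_at[OF G eG])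
  have ux: "u \<noteq> x" using e(2) unfolding cutset_iff[OF u(1,2)] by blast
  have "0 < joins G {v} {u}" using joins_pos[OF G u(2)] eG(1) u(1) by blast
  then have "\<not> 4 \<le> cut_degree G {u}" using indep[OF v(1) u(3,2) v(2)] by auto
  then have du: "cut_degree G {u} = 3" using deg_ge3[OF u(3)] by linarith
  let ?D = "del_edge G e"
  have D: "multigraph ?D" by (rule multigraph_del_edge[OF G])
  have "e \<in> cutset G {u}" using eG u cutset_singleton_iff[OF G] by blast
  then have dD: "cut_degree ?D {u} = 2" using cut_degree_del_edge[OF G, of "{u}" e] du by simp
  have degD: "cut_degree ?D {w} \<le> cut_degree G {w}" for w
    using cut_degree_del_edge[OF G, of "{w}" e] by simp
  have joinsD: "joins ?D A B \<le> joins G A B" for A B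
    unfolding joins_def using finite_cutset[OF G] by (intro card_mono) (auto simp: cutset_del_edge)
  have uD: "u \<in> vertices ?D" using u by simp
  obtain a where a: "a \<in> vertices ?D" "a \<noteq> u" "1 \<le> joins ?D {u} {a}"
    and H: "multigraph (contract ?D {u, a} a)" and VH: "vertices (contract ?D {u, a} a) = vertices ?D - {u}"
    and K: "\<And>T. K4_on (contract ?D {u, a} a) T \<Longrightarrow> K4_on ?D T"
    and dH: "\<And>Z. Z \<subseteq> vertices ?D - {u} \<Longrightarrow>
       cut_degree (contract ?D {u, a} a) Z = cut_degree ?D (if a \<in> Z then insert u Z else Z)"
    and leH: "\<And>w. w \<in> vertices ?D - {u} \<Longrightarrow> cut_degree (contract ?D {u, a} a) {w} \<le> cut_degree ?D {w}"
    by (rule suppress[OF D uD dD]) blast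
  let ?H = "contract ?D {u, a} a"
  note VH' = VH[unfolded del_edge_simps] and dH' = dH[unfolded del_edge_simps]
  have cVH: "card (vertices ?H) = card ?V - 1" unfolding VH' using u(3) fin by simp
  have leG: "cut_degree ?H {w} \<le> cut_degree G {w}" if "w \<in> vertices ?H" for w
    using leH[of w] degD[of w] that unfolding VH by linarith
  have connH: "edge_connected 3 ?H"
    unfolding edge_connected_iff[OF H]
  proof (intro allI impI)
    fix Z assume "Z \<noteq> {} \<and> Z \<subset> vertices ?H"
    then have Z: "Z \<noteq> {}" "Z \<subset> ?V - {u}" unfolding VH' by auto
    define Y where "Y = (if a \<in> Z then insert u Z else Z)"
    have sub: "Z \<subseteq> Y" "Y \<subseteq> insert u Z" by (auto simp: Y_def)
    obtain z where z: "z \<in> Z" using Z(1) by blast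
    obtain y where y: "y \<in> ?V" "y \<notin> Z" "y \<noteq> u" using Z(2) by blast
    have zy: "z \<in> Y" "z \<noteq> u" "y \<notin> Y" using z y sub Z(2) by blast+
    have "cut_degree ?H Z = cut_degree ?D Y" unfolding Y_def using Z(2) by (intro dH') blast
    also have "3 \<le> \<dots>"
    proof (rule cut_degree_del_edge_ge3[OF G conn c eG(1) u(1)])
      show "4 \<le> cut_degree G {v} \<or> Y \<noteq> {v} \<and> Y \<noteq> ?V - {v}" using v(2) by blast
      show "4 \<le> cut_degree G {u} \<or> Y \<noteq> {u} \<and> Y \<noteq> ?V - {u}" using zy y by blast
      show "Y \<noteq> {}" using zy by blast
      show "Y \<subset> ?V" using sub(2) Z(2) u(3) y(1) zy(3) by blast
    qed
    finally show "3 \<le> cut_degree ?H Z" .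
  qed
  have degH: "3 \<le> cut_degree ?H {w}" if "w \<in> vertices ?H" for w
  proof -
    have "vertices ?H \<noteq> {w}" by (rule not_singleton) (use cVH n in linarith)
    then show ?thesis using connH that unfolding edge_connected_iff[OF H] by blast
  qed
  have "card (edges ?H) \<le> card (edges G)"
  proof -
    have "card (edges ?H) \<le> card (edges ?D)" by (rule card_edges_contract[OF D])
    also have "\<dots> \<le> card (edges G)" using finite_edges[OF G] by (intro card_mono) auto
    finally show ?thesis .
  qed
  moreover have "x \<in> vertices ?H" unfolding VH' using x ux by blast
  moreover have n4: "4 \<le> card (vertices ?H)" using cVH n by linarith
  ultimately have "K4_at ?H x \<or> double_regular ?H \<or> chainseg ?H"
    using cVH n by (intro smaller[OF H connH]) linarith+
  \<comment> \<open>Degree 4 everywhere makes all vertices of \<open>G\<close> except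
    \<open>u\<close> big. By \<open>indep\<close> all edges at \<open>v\<close> would then go to
    \<open>u\<close>, which has only three.\<close>
  moreover have "\<not> double_regular ?H"
  proof
    assume dr: "double_regular ?H"
    have big: "4 \<le> cut_degree G {w}" if "w \<in> ?V - {u}" for w
      using double_regularD(1)[OF dr, of w] leG[of w] that unfolding VH' by simp
    have vu: "v \<in> ?V - {u}" using v u by blast
    have "cut_degree G {v} = joins G {v} {u} + joins G {v} (?V - {v} - {u})"
      using u by (intro cut_degree_split[OF G]) auto
    moreover have "joins G {v} (?V - {v} - {u}) = (\<Sum>w\<in>?V - {v} - {u}. joins G {v} {w})"
      using fin by (intro joins_sum[OF G]) auto
    moreover have "\<dots> = 0"
    proof (rule sum.neutral, rule ballI)
      fix w assume w: "w \<in> ?V - {v} - {u}"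
      show "joins G {v} {w} = 0" by (rule indep[OF v(1) _ _ v(2) big]) (use w in auto)
    qed
    moreover have "joins G {u} {v} \<le> joins G {u} (?V - {u})" using u(2) vu by (intro joins_mono[OF G]) auto
    ultimately show False using v(2) du joins_compl[OF G, of "{u}"] joins_commute[of G "{u}" "{v}"] by simp
  qed
  moreover have "\<not> chainseg ?H"
  proof
    assume "chainseg ?H"
    then obtain L R where LR: "chain ?H L R" "card L = 2" "card (vertices ?H - R) = 2"
      by (rule chain_two_sided[OF H _ n4])
    \<comment> \<open>The two end pairs are disjoint, so \<open>v\<close> misses one of them;
      reversal makes it the first.\<close>
    have "\<exists>P Q. chain ?H P Q \<and> card P = 2 \<and> card (vertices ?H - Q) = 2 \<and> v \<notin> P"
    proof (cases "v \<in> L")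
      case True
      have LR': "L \<subseteq> R" "L \<subseteq> vertices ?H" using chain_ends[OF LR(1)] by auto
      then have "vertices ?H - (vertices ?H - L) = L" by blast
      then show ?thesis using chain_compl[OF H LR(1)] LR(2,3) LR'(1) True by (metis DiffD2 subsetD)
    qed (use LR in blast)
    then obtain P Q where PQ: "chain ?H P Q" "card P = 2" "card (vertices ?H - Q) = 2" and vP: "v \<notin> P" by blast
    have P: "P \<subseteq> ?V - {u}" "cut_degree ?H P = 3" using chain_ends[OF PQ(1)] unfolding VH' by auto
    have finP: "finite P" using P(1) fin by (meson finite_Diff finite_subset)
    have "card (?V - P) = card ?V - card P" using P(1) fin by (intro card_Diff_subset[OF finP]) blast
    then have "2 \<le> card P \<and> 2 \<le> card (?V - P)" using PQ(2) n by linarith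
    moreover have "P \<subseteq> ?V" using P(1) by blast
    ultimately have "4 \<le> cut_degree G P" using c unfolding nontrivial_cuts_ge4_def by blast
    moreover have "e \<notin> cutset G P" using vP P(1) unfolding cutset_iff[OF u(1,2)] by blast
    ultimately have dP: "4 \<le> cut_degree ?D P" using cut_degree_del_edge[OF G, of P e] by simp
    have aP: "a \<in> P" using dH'[OF P(1)] P(2) dP by (simp split: if_splits)
    have uP: "u \<notin> P" using P(1) by blast
    have "cut_degree ?D ({u} \<union> P) = 3" using dH'[OF P(1)] P(2) aP by simp
    moreover have "cut_degree ?D ({u} \<union> P) + 2 * joins ?D {u} P = cut_degree ?D {u} + cut_degree ?D P"
      using uP by (intro cut_degree_un[OF D]) auto
    moreover have "cut_degree ?D {u} = joins ?D {u} P + joins ?D {u} (vertices ?D - {u} - P)"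
      using uP P(1) by (intro cut_degree_split[OF D]) auto
    \<comment> \<open>Adding \<open>u\<close> to \<open>P\<close> lowers the cut from at least 4 to
      3, so both remaining edges at \<open>u\<close> go into \<open>P\<close>.\<close>
    ultimately have u_out: "joins ?D {u} (vertices ?D - {u} - P) = 0" using dD dP by linarith
    have u_in: "joins ?D {u} P \<le> 2" using \<open>cut_degree ?D {u} = joins ?D {u} P + _\<close> dD by linarith
    \<comment> \<open>As \<open>u\<close> has no neighbours outside \<open>P\<close>, suppressing it
      changes no multiplicity at \<open>w\<close>.\<close>
    have out: "joins ?H {w} {z} \<le> joins G {w} {z}" if w: "w \<in> vertices ?H" "w \<notin> P" and z: "z \<in> vertices ?H" "z \<noteq> w" for w z
    proof -
      have wu: "w \<noteq> u" "w \<noteq> a" "w \<in> ?V" using w aP unfolding VH' by auto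
      have "joins ?D {u} {w} \<le> joins ?D {u} (vertices ?D - {u} - P)"
        using w wu by (intro joins_mono[OF D]) auto
      then have uw: "joins ?D {w} {u} = 0" using u_out by (simp add: joins_commute)
      have ew: "expand {u, a} a {w} = {w}" using wu by (auto simp: expand_def)
      have "joins ?H {w} {z} = joins ?D {w} {z}"
      proof (cases "z = a")
        case True
        have "expand {u, a} a {z} = {u} \<union> {a}" using True by (auto simp: expand_def)
        then have "joins ?H {w} {z} = joins ?D {w} ({u} \<union> {a})" using joins_contract[OF D, of a "{u, a}" "{w}" "{z}"] ew by simp
        also have "\<dots> = joins ?D {w} {u} + joins ?D {w} {a}" using wu a(2) by (intro joins_un[OF D]) auto
        finally show ?thesis using uw True by simp
      next
        case False
        then have "expand {u, a} a {z} = {z}" using z unfolding VH' by (auto simp: expand_def)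
        then show ?thesis using joins_contract[OF D, of a "{u, a}" "{w}" "{z}"] ew by simp
      qed
      then show ?thesis using joinsD by simp
    qed
    have indepH: "joins ?H {w} {z} = 0"
      if "w \<in> vertices ?H" "w \<notin> P" "z \<in> vertices ?H" "z \<noteq> w" "4 \<le> cut_degree G {w}" "4 \<le> cut_degree G {z}" for w z
    proof -
      have "joins G {w} {z} = 0" by (rule indep) (use that VH' in auto)
      then show ?thesis using out[OF that(1-4)] by simp
    qed
    have bigG: "4 \<le> cut_degree G {w}" if "w \<in> vertices ?H" "cut_degree ?H {w} \<noteq> 3" for w
      using leG[OF that(1)] degH[OF that(1)] that(2) by linarith
    \<comment> \<open>If both degrees exceeded 3, there would be at least three edges between
      \<open>p\<close> and \<open>q\<close>. By \<open>indep\<close> none of them comes from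
      \<open>G\<close>, and suppressing \<open>u\<close> creates at most two. Then one degree is 3,
      and parity makes the other even.\<close>
    have split: "\<exists>p q. P = {p, q} \<and> p \<noteq> q \<and> cut_degree ?H {p} = 3 \<and> 4 \<le> cut_degree ?H {q}"
    proof -
      obtain p q where pq: "P = {p, q}" "p \<noteq> q" using PQ(2) unfolding card_2_iff by blast
      have pqH: "p \<in> vertices ?H" "q \<in> vertices ?H" using P(1) pq(1) unfolding VH' by auto
      have s: "3 + 2 * joins ?H {p} {q} = cut_degree ?H {p} + cut_degree ?H {q}"
        using cut_degree_pair[OF H pq(2)] P(2) pq(1) by simp
      have "cut_degree ?H {p} = 3 \<or> cut_degree ?H {q} = 3"
      proof (rule ccontr)
        assume "\<not> ?thesis"
        then have n3: "cut_degree ?H {p} \<noteq> 3" "cut_degree ?H {q} \<noteq> 3" by auto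
        then have "cut_degree ?H {p} \<ge> 4" "cut_degree ?H {q} \<ge> 4" using degH[OF pqH(1)] degH[OF pqH(2)] by linarith+
        then have j3: "3 \<le> joins ?H {p} {q}" using s by presburger
        have j0: "joins ?D {p} {q} = 0"
        proof -
          have "joins G {p} {q} = 0" by (rule indep) (use pqH pq(2) bigG n3 VH' in auto)
          then show ?thesis using joinsD[of "{p}" "{q}"] by simp
        qed
        have main: "joins ?H {p} {q} \<le> 2" if "p = a" "P = {p, q}" "p \<noteq> q" "joins ?D {p} {q} = 0" "q \<noteq> u" for p q
        proof -
          have "expand {u, a} a {p} = {u} \<union> {a}" "expand {u, a} a {q} = {q}" using that by (auto simp: expand_def)
          then have "joins ?H {p} {q} = joins ?D ({u} \<union> {a}) {q}"
            using joins_contract[OF D, of a "{u, a}" "{p}" "{q}"] by simp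
          also have "\<dots> = joins ?D {q} {u} + joins ?D {q} {a}"
            unfolding joins_commute[of _ "{u} \<union> {a}"] using that a(2) by (intro joins_un[OF D]) auto
          also have "\<dots> = joins ?D {u} {q}" using that by (simp add: joins_commute)
          also have "\<dots> \<le> joins ?D {u} P" using that uP by (intro joins_mono[OF D]) auto
          finally show ?thesis using u_in by simp
        qed
        have "joins ?H {p} {q} \<le> 2"
        proof (cases "p = a")
          case True
          then show ?thesis using main[OF True pq j0] uP pq(1) by blast
        next
          case False
          then have "q = a" using aP pq(1) by blast
          moreover have "P = {q, p}" "q \<noteq> p" "p \<noteq> u" using pq uP by blast+
          moreover have "joins ?D {q} {p} = 0" using j0 by (simp add: joins_commute)
          ultimately have "joins ?H {q} {p} \<le> 2" by (intro main)
          then show ?thesis by (simp add: joins_commute)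
        qed
        then show False using j3 by simp
      qed
      then show ?thesis
      proof
        assume p3: "cut_degree ?H {p} = 3"
        then have "cut_degree ?H {q} \<noteq> 3" using s by presburger
        then have "4 \<le> cut_degree ?H {q}" using degH[OF pqH(2)] by linarith
        then show ?thesis using pq p3 by blast
      next
        assume q3: "cut_degree ?H {q} = 3"
        then have "cut_degree ?H {p} \<noteq> 3" using s by presburger
        then have "4 \<le> cut_degree ?H {p}" using degH[OF pqH(1)] by linarith
        moreover have "P = {q, p}" "q \<noteq> p" using pq by blast+
        ultimately show ?thesis using q3 by blast
      qed
    qed
    then obtain p q where pq: "P = {p, q}" "p \<noteq> q" and p3: "cut_degree ?H {p} = 3" and q4: "4 \<le> cut_degree ?H {q}" by blast
    have pqH: "p \<in> vertices ?H" "q \<in> vertices ?H" using P(1) pq(1) unfolding VH' by auto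
    have PH: "P \<subseteq> vertices ?H" using P(1) unfolding VH' .
    have qG: "4 \<le> cut_degree G {q}" using bigG[OF pqH(2)] q4 by simp
    let ?m = "joins ?H {p} {q}" and ?W = "vertices ?H - P"
    \<comment> \<open>Hence \<open>?m\<close> is at least 2, and \<open>p\<close> has at most one
      edge leaving \<open>P\<close>.\<close>
    have m: "cut_degree ?H {q} = 2 * ?m"
      using cut_degree_pair[OF H pq(2)] P(2) pq(1) p3 by simp
    have pW: "vertices ?H - {p} - {q} = ?W" "vertices ?H - {q} - {p} = ?W" using pq(1) by auto
    have p_out: "joins ?H {p} ?W \<le> 1"
      using cut_degree_split[OF H, of "{p}" "{q}"] pW(1) pq(2) pqH p3 m q4 by simp
    have q_out: "joins ?H {q} ?W = ?m"
      using cut_degree_split[OF H, of "{q}" "{p}"] pW(2) pq(2) pqH m joins_commute[of ?H "{p}" "{q}"] by simp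
    show False
    proof (cases "card (vertices ?H) = 4")
      case False
      have cQ: "3 \<le> card Q"
      proof -
        have Q: "Q \<subseteq> vertices ?H" using chain_ends[OF PQ(1)] by blast
        then have "card (vertices ?H - Q) = card (vertices ?H) - card Q"
          using finite_vertices[OF H] by (intro card_Diff_subset) (auto intro: finite_subset)
        then show ?thesis using PQ(3) n4 False by linarith
      qed
      have "card P \<le> 3" using PQ(2) by simp
      then obtain Z where Z: "chain ?H P Z" "card Z = 3" using chain_at_card[OF H PQ(1) _ cQ] by blast
      have PZ: "P \<subseteq> Z" "Z \<subseteq> vertices ?H" "cut_degree ?H Z = 3" using chain_ends[OF Z(1)] by auto
      have "card (Z - P) = 1" using card_Diff_subset[OF finP PZ(1)] Z(2) PQ(2) by simp
      then obtain w where w: "Z - P = {w}" by (rule card_1_singletonE)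
      have wH: "w \<in> vertices ?H" "w \<notin> P" using w PZ(2) by auto
      have Zw: "Z = {w} \<union> P" using w PZ(1) by auto
      have "cut_degree ?H Z + 2 * joins ?H {w} P = cut_degree ?H {w} + cut_degree ?H P"
        unfolding Zw using wH(2) by (intro cut_degree_un[OF H]) auto
      \<comment> \<open>Even degree makes \<open>w\<close> big in \<open>G\<close> and so not
        adjacent to \<open>q\<close>. Its edges to \<open>P\<close> all end in \<open>p\<close>, at
        most one in number, so its degree would be at most 2.\<close>
      then have dw: "cut_degree ?H {w} = 2 * joins ?H {w} P" using PZ(3) P(2) by simp
      then have "cut_degree ?H {w} \<noteq> 3" by presburger
      then have wG: "4 \<le> cut_degree G {w}" by (rule bigG[OF wH(1)])
      have "joins ?H {w} ({p} \<union> {q}) = joins ?H {w} {p} + joins ?H {w} {q}"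
        using wH(2) pq by (intro joins_un[OF H]) auto
      then have "joins ?H {w} P = joins ?H {w} {p} + joins ?H {w} {q}" using pq(1) by (simp add: insert_commute)
      moreover have "joins ?H {p} {w} \<le> joins ?H {p} ?W" using wH pq(1) by (intro joins_mono[OF H]) auto
      moreover have "joins ?H {w} {q} = 0"
        using indepH[OF wH pqH(2) _ wG qG] wH(2) pq(1) by blast
      ultimately show False using dw p_out degH[OF wH(1)] joins_commute[of ?H "{p}" "{w}"] by linarith
    next
      \<comment> \<open>The chain is just \<open>P\<close>, so there is no next vertex; the other
        side \<open>{v, z}\<close> takes over. All edges from \<open>q\<close> leaving
        \<open>P\<close> end in \<open>z\<close>, which has degree 3. At most one edge
        \<open>vz\<close> remains, yet the degree of \<open>v\<close> is twice their number.\<close>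
      case True
      have cW: "card ?W = 2" using card_Diff_subset[OF finP PH] PQ(2) True by simp
      have vH: "v \<in> vertices ?H" using v(1) u(2) unfolding VH' by blast
      have vW: "v \<in> ?W" using vH vP by blast
      then have "card (?W - {v}) = 1" using cW by simp
      then obtain z where z': "?W - {v} = {z}" by (rule card_1_singletonE)
      have z: "?W = {v, z}" "v \<noteq> z" using insert_Diff[OF vW] z' by auto
      have zH: "z \<in> vertices ?H" "z \<notin> P" using z by blast+
      have vq: "joins ?H {v} {q} = 0" using indepH[OF vH vP pqH(2) _ v(2) qG] vP pq(1) by blast
      have "joins ?H {q} ({v} \<union> {z}) = joins ?H {q} {v} + joins ?H {q} {z}"
        using z vP zH pq by (intro joins_un[OF H]) auto
      then have zq: "joins ?H {z} {q} = ?m" using q_out z(1) vq by (simp add: joins_commute insert_commute)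
      have "\<not> 4 \<le> cut_degree G {z}"
      proof
        assume "4 \<le> cut_degree G {z}"
        then have "joins ?H {z} {q} = 0" using indepH[OF zH pqH(2) _ _ qG] zH(2) pq(1) by blast
        then show False using zq m q4 by simp
      qed
      then have z3: "cut_degree ?H {z} = 3" using bigG[OF zH(1)] by blast
      have "cut_degree ?H ?W = 3" using cut_degree_compl[OF H, of P] P(2) by simp
      then have vz: "cut_degree ?H {v} = 2 * joins ?H {v} {z}"
        using cut_degree_pair[OF H z(2)] z(1) z3 by simp
      have "joins ?H {z} ({q} \<union> {v}) \<le> joins ?H {z} (vertices ?H - {z})"
        using zH z pqH vH pq(1) by (intro joins_mono[OF H]) auto
      moreover have "joins ?H {z} ({q} \<union> {v}) = joins ?H {z} {q} + joins ?H {z} {v}"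
        using zH z vP pq by (intro joins_un[OF H]) auto
      ultimately have "joins ?H {z} {q} + joins ?H {z} {v} \<le> 3" using joins_compl[OF H, of "{z}"] z3 by simp
      then show False using zq vz m q4 degH[OF vH] joins_commute[of ?H "{z}" "{v}"] by linarith
    qed
  qed
  ultimately have "K4_at ?H x" by blast
  then obtain T where "K4_on ?H T" "x \<in> T" by (auto simp: K4_at_def)
  then have "K4_on G T" "x \<in> T" using K4_on_del_edge[OF K] by blast+
  then show ?thesis by (auto simp: K4_at_def)
qed

lemma K4_at_or_double_regular_or_chainseg: "K4_at G x \<or> double_regular G \<or> chainseg G"
proof (cases "nontrivial_cuts_ge4 G")
  case False
  then obtain X where X: "X \<subseteq> vertices G" "2 \<le> card X" "2 \<le> card (vertices G - X)" "\<not> 4 \<le> cut_degree G X"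
    unfolding nontrivial_cuts_ge4_def by blast
  have "X \<noteq> {}" using X(2) by auto
  moreover have "X \<noteq> vertices G"
  proof
    assume "X = vertices G"
    then have "vertices G - X = {}" by blast
    then show False using X(3) by (simp only: card.empty)
  qed
  ultimately have "3 \<le> cut_degree G X" using X(1) by (intro ge3) auto
  then have "cut_degree G X = 3" using X(4) by linarith
  then show ?thesis using three_cut_chainseg[OF _ X(1) _ X(2,3)] by blast
next
  case c: True
  show ?thesis
  proof (cases "card (vertices G) = 4")
    case True
    have "4 \<le> cut_degree G {v, w}" if "v \<in> vertices G" "w \<in> vertices G" "v \<noteq> w" for v w
    proof -
      have "card (vertices G - {v, w}) = 2" using that fin True by (simp add: card_Diff_subset)
      then show ?thesis using c that unfolding nontrivial_cuts_ge4_def by simp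
    qed
    then show ?thesis using four_vertices[OF G True deg_ge3] x by (auto simp: K4_at_def)
  next
    case False
    then have n: "5 \<le> card (vertices G)" using card4 by simp
    show ?thesis
    proof (cases "\<exists>p\<in>vertices G. \<exists>q\<in>vertices G. p \<noteq> q \<and> 4 \<le> cut_degree G {p} \<and> 4 \<le> cut_degree G {q} \<and> joins G {p} {q} \<noteq> 0")
      case True
      then obtain p q where pq: "p \<noteq> q" "4 \<le> cut_degree G {p}" "4 \<le> cut_degree G {q}" "joins G {p} {q} \<noteq> 0" by blast
      then obtain e where "e \<in> edges G" "ends G e = {p, q}" using joins_pos[OF G pq(1)] by auto
      then show ?thesis using adjacent_big[OF c n _ _ _ pq(1-3)] by blast
    next
      case indep: False
      show ?thesis
      proof (cases "\<exists>v\<in>vertices G. 4 \<le> cut_degree G {v}")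
        case True
        then show ?thesis using isolated_big[OF c n] indep by blast
      next
        case False
        have "cut_degree G {v} = 3" if "v \<in> vertices G" for v
          using False deg_ge3[OF that] that by fastforce
        then show ?thesis using cubic[OF c n] by blast
      qed
    qed
  qed
qed

end

text \<open>Vertices and edges are counted together, since deletions lower only the number of
  edges.\<close>

lemma K4_at_or_obstruction:
  fixes G :: "('v, 'e) mgraph"
  assumes "multigraph G" "edge_connected 3 G" "4 \<le> card (vertices G)" "x \<in> vertices G"
  shows "K4_at G x \<or> double_regular G \<or> chainseg G"
  using assms
proof (induction "card (vertices G) + card (edges G)" arbitrary: G rule: less_induct)
  case less
  interpret smaller_graphs G x
    by unfold_locales (use less in auto)
  show ?case by (rule K4_at_or_double_regular_or_chainseg)
qed

theorem corollary2p8: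
  fixes G :: "('v, 'e) mgraph" and r :: "'v option" and y :: nat
  assumes "multigraph G"
    and "edge_connected 3 G"
    and "card (vertices G) \<ge> 4"
    and "set_option r \<subseteq> vertices G"
    and "y \<in> vertices (complete_graph 4)"
  shows "\<not> (case r of
              None \<Rightarrow> has_immersion G (complete_graph 4)
            | Some x \<Rightarrow> has_rooted_immersion G x (complete_graph 4) y)
         \<longleftrightarrow> doubled_cycle G \<or> has_segmentation G 2 2 3"
proof
  assume no: "\<not> (case r of
              None \<Rightarrow> has_immersion G (complete_graph 4)
            | Some x \<Rightarrow> has_rooted_immersion G x (complete_graph 4) y)"
  have ne: "vertices G \<noteq> {}" using assms(3) by auto
  \<comment> \<open>Without a root an arbitrary vertex is taken, as an immersion rooted there is in
    particular an immersion.\<close>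
  then obtain x where x: "x \<in> vertices G" "r = None \<or> r = Some x"
    using assms(4) by (cases r) auto
  have "\<not> K4_at G x"
  proof
    assume "K4_at G x"
    then obtain T where T: "K4_on G T" "x \<in> T" by (auto simp: K4_at_def)
    have "y < 4" using assms(5) by (simp add: K4_edges)
    then obtain \<phi> where "immersion_map (complete_graph 4) G \<phi>" "\<phi> y = x"
      using K4_on_immersion_map[OF assms(1) T] by blast
    then show False using no x(2) by (auto simp: has_immersion_def has_rooted_immersion_def)
  qed
  then have "double_regular G \<or> chainseg G" using K4_at_or_obstruction[OF assms(1-3) x(1)] by blast
  then show "doubled_cycle G \<or> has_segmentation G 2 2 3"
    using double_regular_doubled_cycle[OF assms(1,2) ne] chainseg_has_segmentation by blast
next
  assume "doubled_cycle G \<or> has_segmentation G 2 2 3"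
  then have "\<not> K4_on G T" for T
    using doubled_cycle_not_K4_on[OF assms(1)] has_segmentation_not_K4_on[OF assms(1)] by blast
  then have "\<not> immersion_map (complete_graph 4) G \<phi>" for \<phi> using immersion_map_K4_on by blast
  then show "\<not> (case r of
              None \<Rightarrow> has_immersion G (complete_graph 4)
            | Some x \<Rightarrow> has_rooted_immersion G x (complete_graph 4) y)"
    by (auto simp: has_immersion_def has_rooted_immersion_def split: option.splits)
qed

end
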